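(* Let $B$ be a finite Blaschke product with $n$ zeros and let $\mathcal{M}$ be a weak*-closed subspace of $H^\infty$ which is invariant under $H_1^\infty(B)$ but not under $H^\infty(B)$. Then there exist $B$-inner functions $J_1,\ldots,J_r$ ($r\le n$), an integer $k\le 2r-1$, and functions \[\varphi_i=(\beta_{1i}+\beta_{2i}B)J_1+(\beta_{3i}+\beta_{4i}B)J_2+\cdots+(\beta_{2r-1,i}+\beta_{2r,i}B)J_r,\quad i=1,\ldots,k,\] with complex numbers $\beta_{ji}$ satisfying $|\beta_{1i}|^2+|\beta_{2i}|^2+\cdots+|\beta_{2r,i}|^2=1$, such that \[\mathcal{M}=\Big(\sum_{i=1}^{k}\oplus\langle\varphi_i\rangle\Big)\oplus\sum_{j=1}^{r}\oplus B^2J_jH^\infty(B),\] where $\langle\varphi_i\rangle$ is the span of $\varphi_i$ and $\oplus$ denotes a direct sum.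
   Context: $H^2,H^\infty$ are the classical Hardy spaces on the unit circle. $B(z)=\prod_{i=1}^n\frac{z-a_i}{1-\overline{a_i}z}$ with $a_i$ in the open unit disc (the paper takes $a_1=0$). $H^\infty(B)=\{f\circ B: f\in H^\infty\}$, and $H^\infty_1(B)$ is the weak*-closure in $H^\infty$ of the linear span of $\{1,B^2,B^3,\ldots\}$. A subspace $\mathcal M$ is invariant under an algebra $A\subset H^\infty$ if $af\in\mathcal M$ for all $a\in A$, $f\in\mathcal M$. A function $\varphi\in H^\infty$ is $B$-inner if $\{B^m\varphi: m=0,1,2,\ldots\}$ is an orthonormal set in $H^2$. *)

theory Defs
  imports "HOL-Analysis.Analysis"
begin

text \<open>Functions are modelled on the open unit disc (Poisson/analytic model of the
  Hardy spaces); elements of our function spaces are normalised to vanish off the disc.\<close>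

definition hinf :: "(complex \<Rightarrow> complex) set" where
  "hinf = {f. f holomorphic_on ball 0 1 \<and> bounded (f ` ball 0 1) \<and>
              (\<forall>z. z \<notin> ball 0 1 \<longrightarrow> f z = 0)}"

definition blaschke :: "nat \<Rightarrow> (nat \<Rightarrow> complex) \<Rightarrow> complex \<Rightarrow> complex" where
  "blaschke n a z = (if z \<in> ball 0 1 then (\<Prod>i<n. (z - a i) / (1 - cnj (a i) * z)) else 0)"

definition hinf_of :: "(complex \<Rightarrow> complex) \<Rightarrow> (complex \<Rightarrow> complex) set" where
  "hinf_of B = {(\<lambda>z. if z \<in> ball 0 1 then f (B z) else 0) | f. f \<in> hinf}"

definition h2_inner :: "(complex \<Rightarrow> complex) \<Rightarrow> (complex \<Rightarrow> complex) \<Rightarrow> complex" where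
  "h2_inner f g = Lim (at_left 1)
     (\<lambda>r::real. integral {0..2*pi} (\<lambda>t. f (of_real r * cis t) * cnj (g (of_real r * cis t))) / (2 * pi))"

definition B_inner :: "(complex \<Rightarrow> complex) \<Rightarrow> (complex \<Rightarrow> complex) \<Rightarrow> bool" where
  "B_inner B \<phi> \<longleftrightarrow> \<phi> \<in> hinf \<and>
     (\<forall>m l::nat. h2_inner (\<lambda>z. B z ^ m * \<phi> z) (\<lambda>z. B z ^ l * \<phi> z) = (if m = l then 1 else 0))"

definition wstar_pair :: "(real \<Rightarrow> complex) \<Rightarrow> (complex \<Rightarrow> complex) \<Rightarrow> complex" where
  "wstar_pair g f = Lim (at_left 1)
     (\<lambda>r::real. integral {0..2*pi} (\<lambda>t. f (of_real r * cis t) * g t))"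

definition wstar_closed :: "(complex \<Rightarrow> complex) set \<Rightarrow> bool" where
  "wstar_closed C \<longleftrightarrow> C \<subseteq> hinf \<and>
     (\<forall>f \<in> hinf - C. \<exists>G e. finite G \<and> (\<forall>g\<in>G. g absolutely_integrable_on {0..2*pi}) \<and> e > 0 \<and>
        (\<forall>h \<in> hinf. (\<forall>g\<in>G. cmod (wstar_pair g h - wstar_pair g f) < e) \<longrightarrow> h \<notin> C))"

definition wstar_closure :: "(complex \<Rightarrow> complex) set \<Rightarrow> (complex \<Rightarrow> complex) set" where
  "wstar_closure S = \<Inter>{C. wstar_closed C \<and> S \<subseteq> C}"

definition hinf1 :: "(complex \<Rightarrow> complex) \<Rightarrow> (complex \<Rightarrow> complex) set" where
  "hinf1 B = wstar_closure
     {(\<lambda>z. if z \<in> ball 0 1 then (\<Sum>m\<in>F. c m * B z ^ m) else 0) | F c. finite F \<and> 1 \<notin> F}"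

definition invariant_under :: "(complex \<Rightarrow> complex) set \<Rightarrow> (complex \<Rightarrow> complex) set \<Rightarrow> bool" where
  "invariant_under A M \<longleftrightarrow> (\<forall>a\<in>A. \<forall>f\<in>M. (\<lambda>z. a z * f z) \<in> M)"

definition csubspace :: "(complex \<Rightarrow> complex) set \<Rightarrow> bool" where
  "csubspace M \<longleftrightarrow> (\<lambda>z. 0) \<in> M \<and> (\<forall>f\<in>M. \<forall>g\<in>M. (\<lambda>z. f z + g z) \<in> M) \<and>
                    (\<forall>c. \<forall>f\<in>M. (\<lambda>z. c * f z) \<in> M)"

definition Bphi :: "(complex \<Rightarrow> complex) \<Rightarrow> (nat \<Rightarrow> complex \<Rightarrow> complex) \<Rightarrow> (nat \<Rightarrow> nat \<Rightarrow> complex)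
                    \<Rightarrow> nat \<Rightarrow> nat \<Rightarrow> complex \<Rightarrow> complex" where
  "Bphi B J \<beta> r i z = (\<Sum>j<r. (\<beta> (2*j) i + \<beta> (2*j+1) i * B z) * J j z)"

end

theory Submission
  imports Defs "HOL-Complex_Analysis.Complex_Analysis" "HOL-Library.Function_Algebras"
begin

text \<open>
  Put \<open>N = {f. B\<^sup>2 f \<in> M \<and> B\<^sup>3 f \<in> M}\<close>. Then \<open>B\<^sup>2 N \<subseteq> M \<subseteq> N\<close> and \<open>B N \<subseteq> N\<close>, so once
  \<open>N\<close> is known to be the direct sum of the \<open>J\<^sub>j H\<^sup>\<infinity>(B)\<close> for an orthonormal basis \<open>J\<^sub>1, \<dots>, J\<^sub>r\<close> of
  \<open>N \<ominus> B N\<close>, the quotient \<open>M / B\<^sup>2 N\<close> is a proper subspace of the \<open>2r\<close>-dimensional span of the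
  \<open>J\<^sub>j\<close> and \<open>B J\<^sub>j\<close>.

  Everything is done inside the disc, without boundary values. Multiplication by \<open>B\<close> is isometric because
  \<open>1 - \<bar>B\<bar>\<^sup>2 \<le> \<kappa> (1 - \<bar>z\<bar>\<^sup>2)\<close>. With \<open>F\<^sub>w = 1 / (1 - cnj w B)\<close> the Herglotz function
  \<open>G(w) = 2 \<langle>f, F\<^sub>w f\<rangle> - \<parallel>f\<parallel>\<^sup>2\<close> satisfies \<open>Re G(w) = (1 - \<bar>w\<bar>\<^sup>2) \<parallel>f F\<^sub>w\<parallel>\<^sup>2\<close>, whence
  \<open>\<bar>f\<bar>\<^sup>2 \<le> \<kappa> Re G(B)\<close>. This bound shows that the projection of an element of \<open>N\<close> onto \<open>N \<ominus> B N\<close> is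
  again bounded, and it lets \<open>1 / (1 + \<epsilon> G(B))\<close> turn norm limits into bounded pointwise limits, under which
  weak* closed subspaces are closed. Finally \<open>f = \<Sum> J\<^sub>j g\<^sub>j(B)\<close> with \<open>g\<^sub>j(w) = \<langle>f, F\<^sub>w J\<^sub>j\<rangle>\<close>, and \<open>r \<le> n\<close>
  follows by averaging \<open>\<Sum> \<bar>J\<^sub>j\<bar>\<^sup>2 \<le> (1 - \<bar>B\<bar>\<^sup>2) / (1 - \<bar>z\<bar>\<^sup>2)\<close> over circles.
\<close>

section \<open>Circle means and the Hardy inner product\<close>

text \<open>The algebra \<open>hinf1 B\<close> contains \<open>B\<^sup>2\<close> and
  \<open>B\<^sup>3\<close> but in general not \<open>B\<close>; hence the two conditions on
  \<open>N\<close>. Multiplication by \<open>B\<close> moves the second power to the third and the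
  third to the fourth, and \<open>B\<^sup>4 = B\<^sup>2 B\<^sup>2\<close> acts on \<open>M\<close>.
  If \<open>M\<close> contained every combination of the \<open>J\<^sub>j\<close> and
  \<open>B J\<^sub>j\<close>, it would equal \<open>N\<close> and be invariant under
  \<open>hinf_of B\<close>; excluding this costs one dimension and gives \<open>2r - 1\<close>.

  The main obstacle is that \<open>N\<close> consists of bounded functions and is in general not
  complete in the \<open>H\<^sup>2\<close> norm, so the Wold decomposition of the isometry
  \<open>B\<close> does not apply directly: projections, quotients by \<open>B\<close> and
  coordinate functions could be unbounded, and each needs its own sup bound.

  Moreover \<open>h2_inner\<close> and \<open>wstar_pair\<close> are radial limits whose existence
  must be shown. Square-summable Taylor coefficients settle the first; the second pairs with a
  merely integrable weight and needs a Cauchy estimate that is uniform over bounded sets of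
  functions.

  \<open>hb\<close> drops the normalisation off the disc, so that constants and kernels
  qualify.\<close>

definition hb :: "(complex \<Rightarrow> complex) \<Rightarrow> bool" where
  "hb f \<longleftrightarrow> f holomorphic_on ball 0 1 \<and> bounded (f ` ball 0 1)"

definition coef :: "(complex \<Rightarrow> complex) \<Rightarrow> nat \<Rightarrow> complex" where
  "coef f m = (deriv ^^ m) f 0 / fact m"

lemma hbD: "hb f \<Longrightarrow> f holomorphic_on ball 0 1"
  by (simp add: hb_def)

lemma hb_bound:
  assumes "hb f" obtains C where "C > 0" "\<And>z. norm z < 1 \<Longrightarrow> norm (f z) \<le> C"
  using assms unfolding hb_def bounded_pos by auto

lemma hbI:
  assumes "f holomorphic_on ball 0 1" "\<And>z. norm z < 1 \<Longrightarrow> norm (f z) \<le> C"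
  shows "hb f"
  using assms unfolding hb_def bounded_iff by (auto intro!: exI[of _ C])

lemma coef_sums:
  assumes "f holomorphic_on ball 0 1" "norm z < 1"
  shows "(\<lambda>m. coef f m * z ^ m) sums f z"
  using holomorphic_power_series[OF assms(1), of z] assms(2) by (simp add: coef_def)

lemma coef_norm_summable:
  assumes "f holomorphic_on ball 0 1" "0 \<le> r" "r < (1::real)"
  shows "summable (\<lambda>m. norm (coef f m) * r ^ m)"
proof -
  obtain s where s: "r < s" "s < 1" using dense assms by blast
  have "summable (\<lambda>m. coef f m * (of_real s) ^ m)"
    using coef_sums[OF assms(1), of "of_real s"] s assms by (auto simp: sums_iff)
  from powser_insidea[OF this, of "of_real r"] show ?thesis
    using s assms by (simp add: norm_mult norm_power)
qed

abbreviation circle_integral :: "(complex \<Rightarrow> complex) \<Rightarrow> (real \<Rightarrow> complex) \<Rightarrow> real \<Rightarrow> complex" where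
  "circle_integral f g r \<equiv> integral {0..2*pi} (\<lambda>t. f (of_real r * cis t) * g t)"

lemma absolutely_integrable_continuous_mult:
  fixes u g :: "real \<Rightarrow> complex"
  assumes "continuous_on {a..b} u" "g absolutely_integrable_on {a..b}"
  shows "(\<lambda>t. u t * g t) absolutely_integrable_on {a..b}"
proof (rule absolutely_integrable_bounded_measurable_product[OF bilinear_times])
  show "u \<in> borel_measurable (lebesgue_on {a..b})"
    by (rule continuous_imp_measurable_on_sets_lebesgue[OF assms(1)]) simp
  show "bounded (u ` {a..b})"
    by (intro compact_imp_bounded compact_continuous_image assms) simp
qed (use assms in auto)

lemma continuous_on_circle:
  assumes "f holomorphic_on ball 0 1" "0 \<le> r" "r < (1::real)"
  shows "continuous_on S (\<lambda>t. f (of_real r * cis t))"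
proof -
  have "continuous_on S (f \<circ> (\<lambda>t. of_real r * cis t))"
    by (intro continuous_on_compose continuous_intros
         continuous_on_subset[OF holomorphic_on_imp_continuous_on[OF assms(1)]])
       (use assms in \<open>auto simp: norm_mult\<close>)
  thus ?thesis by (simp add: o_def)
qed

text \<open>For \<open>r < 1\<close> the Taylor series converges absolutely on the circle, so its
  partial sums times \<open>g\<close> are dominated by a constant multiple of
  \<open>norm (g t)\<close>. The weight is kept merely integrable because the weak* pairing uses the
  same expansion.\<close>

lemma circle_integral_sums:
  assumes f: "f holomorphic_on ball 0 1" and r: "0 \<le> r" "r < (1::real)"
    and g: "g absolutely_integrable_on {0..2*pi}"
  shows "(\<lambda>m. coef f m * of_real r ^ m * integral {0..2*pi} (\<lambda>t. cis (real m * t) * g t))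
           sums circle_integral f g r"
proof -
  define p where "p K t = (\<Sum>m<K. coef f m * (of_real r * cis t) ^ m) * g t" for K :: nat and t
  define A where "A = (\<Sum>m. norm (coef f m) * r ^ m)"
  have sA: "summable (\<lambda>m. norm (coef f m) * r ^ m)" by (rule coef_norm_summable[OF f r])
  have gi: "(\<lambda>t. cis (real m * t) * g t) integrable_on {0..2*pi}" for m
    by (rule set_lebesgue_integral_eq_integral(1),
        rule absolutely_integrable_continuous_mult[OF _ g]) (intro continuous_intros)
  have peq: "p K = (\<lambda>t. \<Sum>m<K. (coef f m * of_real r ^ m) * (cis (real m * t) * g t))" for K
    by (rule ext) (simp add: p_def sum_distrib_right power_mult_distrib Complex.DeMoivre mult.assoc)
  have pint: "(p K) integrable_on {0..2*pi}" for K
    unfolding peq by (intro integrable_sum integrable_on_mult_right gi) auto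
  have "(\<lambda>K. integral {0..2*pi} (p K)) \<longlonglongrightarrow> circle_integral f g r"
  proof (rule dominated_convergence(2)[where h = "\<lambda>t. A * norm (g t)"])
    show "(\<lambda>t. A * norm (g t)) integrable_on {0..2*pi}"
      by (rule integrable_on_mult_right) (use g in \<open>simp add: absolutely_integrable_on_def\<close>)
    fix K t
    have "norm (\<Sum>m<K. coef f m * (of_real r * cis t) ^ m) \<le> (\<Sum>m<K. norm (coef f m) * r ^ m)"
      by (rule sum_norm_le) (use r in \<open>simp add: norm_mult norm_power\<close>)
    also have "\<dots> \<le> A" unfolding A_def
      by (rule sum_le_suminf[OF sA]) (use r in auto)
    finally show "norm (p K t) \<le> A * norm (g t)"
      unfolding p_def norm_mult by (rule mult_right_mono) simp
  next
    fix t
    have "(\<lambda>K. \<Sum>m<K. coef f m * (of_real r * cis t) ^ m) \<longlonglongrightarrow> f (of_real r * cis t)"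
      using coef_sums[OF f, of "of_real r * cis t"] r by (simp add: sums_def norm_mult)
    thus "(\<lambda>K. p K t) \<longlonglongrightarrow> f (of_real r * cis t) * g t"
      unfolding p_def by (intro tendsto_intros)
  qed (rule pint)
  moreover have "integral {0..2*pi} (p K) =
     (\<Sum>m<K. coef f m * of_real r ^ m * integral {0..2*pi} (\<lambda>t. cis (real m * t) * g t))" for K
    unfolding peq by (subst integral_sum) (auto intro!: integrable_on_mult_right gi)
  ultimately show ?thesis by (simp add: sums_def)
qed

lemma integral_cis_cnj_cis:
  "integral {0..2*pi} (\<lambda>t. cis (real m * t) * cnj (cis (real k * t))) = (if m = k then 2 * pi else 0)"
proof (cases "m = k")
  case True
  have "cis x * cnj (cis x) = 1" for x
    by (simp add: complex_mult_cnj cis.code flip: cis_cnj)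
  with True show ?thesis by (simp add: cis_cnj cis_mult scaleR_conv_of_real)
next
  case False
  define d where "d = real m - real k"
  have d: "d \<noteq> 0" using False by (simp add: d_def)
  have "((\<lambda>t. cis (d * t)) has_integral (cis (d * (2*pi)) / (\<i> * d) - cis (d * 0) / (\<i> * d))) {0..2*pi}"
  proof (rule fundamental_theorem_of_calculus)
    fix x assume "x \<in> {0..2*pi}"
    have "((\<lambda>z. exp (\<i> * d * z) / (\<i> * d)) has_field_derivative exp (\<i> * d * of_real x)) (at (of_real x))"
      using d by (auto intro!: derivative_eq_intros)
    from has_vector_derivative_real_field[OF this, of "{0..2*pi}"]
    show "((\<lambda>t. cis (d * t) / (\<i> * d)) has_vector_derivative cis (d * x)) (at x within {0..2*pi})"
      by (simp add: cis_conv_exp mult_ac)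
  qed simp
  moreover have "cis (d * (2*pi)) = 1"
  proof -
    have "d * (2 * pi) = 2 * pi * of_int (int m - int k)" by (simp add: d_def)
    thus ?thesis by (metis cis_multiple_2pi Ints_of_int)
  qed
  ultimately have "((\<lambda>t. cis (d * t)) has_integral 0) {0..2*pi}" by simp
  moreover have "cis (real m * t) * cnj (cis (real k * t)) = cis (d * t)" for t
    by (simp add: cis_cnj cis_mult d_def algebra_simps)
  ultimately show ?thesis using False by (simp add: integral_unique)
qed

lemma circle_integral_coef:
  assumes f: "f holomorphic_on ball 0 1" and r: "0 \<le> r" "r < (1::real)"
  shows "integral {0..2*pi} (\<lambda>t. f (of_real r * cis t) * cnj (cis (real m * t)))
           = 2 * pi * coef f m * of_real r ^ m"
proof -
  have g: "(\<lambda>t. cnj (cis (real m * t))) absolutely_integrable_on {0..2*pi}"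
    by (intro absolutely_integrable_continuous_real continuous_intros)
  have "(\<lambda>k. coef f k * of_real r ^ k * complex_of_real (if k = m then 2 * pi else 0))
     sums integral {0..2*pi} (\<lambda>t. f (of_real r * cis t) * cnj (cis (real m * t)))"
    using circle_integral_sums[OF f r g] unfolding integral_cis_cnj_cis by simp
  moreover have "(\<lambda>k. coef f k * of_real r ^ k * complex_of_real (if k = m then 2 * pi else 0))
       = (\<lambda>k. if k = m then coef f k * of_real r ^ k * complex_of_real (2 * pi) else 0)"
    by auto
  ultimately show ?thesis
    using sums_unique2[OF _ sums_single[of m "\<lambda>k. coef f k * of_real r ^ k * complex_of_real (2 * pi)"]]
    by (simp add: mult_ac)
qed

definition circle_mean :: "real \<Rightarrow> (complex \<Rightarrow> complex) \<Rightarrow> (complex \<Rightarrow> complex) \<Rightarrow> complex" where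
  "circle_mean r f g =
     integral {0..2*pi} (\<lambda>t. f (of_real r * cis t) * cnj (g (of_real r * cis t))) / (2 * pi)"

lemma h2_inner_Lim: "h2_inner f g = Lim (at_left 1) (\<lambda>r. circle_mean r f g)"
  by (simp add: h2_inner_def circle_mean_def)

text \<open>Parseval on the circle of radius \<open>r\<close>. The moments of \<open>cnj g\<close>
  are conjugate Taylor coefficients carrying a second factor \<open>r ^ m\<close>, which explains
  the powers of \<open>r\<^sup>2\<close>.\<close>

lemma circle_mean_sums:
  assumes f: "f holomorphic_on ball 0 1" and g: "g holomorphic_on ball 0 1"
    and r: "0 \<le> r" "r < (1::real)"
  shows "(\<lambda>m. coef f m * cnj (coef g m) * of_real (r\<^sup>2) ^ m) sums circle_mean r f g"
proof -
  let ?G = "\<lambda>t. cnj (g (of_real r * cis t))"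
  have G: "?G absolutely_integrable_on {0..2*pi}"
    by (intro absolutely_integrable_continuous_real continuous_intros continuous_on_circle[OF g r])
  have "integral {0..2*pi} (\<lambda>t. cis (real m * t) * ?G t) = 2 * pi * cnj (coef g m) * of_real r ^ m" for m
  proof -
    have "integral {0..2*pi} (\<lambda>t. cis (real m * t) * ?G t)
        = cnj (integral {0..2*pi} (\<lambda>t. g (of_real r * cis t) * cnj (cis (real m * t))))"
      by (simp add: integral_cnj mult.commute)
    thus ?thesis unfolding circle_integral_coef[OF g r] by simp
  qed
  hence "(\<lambda>m. coef f m * of_real r ^ m * (2 * pi * cnj (coef g m) * of_real r ^ m))
     sums integral {0..2*pi} (\<lambda>t. f (of_real r * cis t) * ?G t)"
    using circle_integral_sums[OF f r G] by simp
  from sums_divide[OF this, of "2*pi"] show ?thesis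
    by (simp add: circle_mean_def mult_ac power2_eq_square power_mult_distrib)
qed

lemma circle_integral_norm_bound:
  assumes f: "f holomorphic_on ball 0 1" and r: "0 \<le> r" "r < (1::real)"
    and C: "\<And>z. norm z < 1 \<Longrightarrow> norm (f z) \<le> C"
    and g: "g absolutely_integrable_on {0..2*pi}"
  shows "norm (circle_integral f g r) \<le> C * integral {0..2*pi} (\<lambda>t. norm (g t))"
proof -
  have "norm (circle_integral f g r) \<le> integral {0..2*pi} (\<lambda>t. C * norm (g t))"
  proof (rule integral_norm_bound_integral)
    show "(\<lambda>t. f (of_real r * cis t) * g t) integrable_on {0..2*pi}"
      by (rule set_lebesgue_integral_eq_integral(1),
          rule absolutely_integrable_continuous_mult[OF continuous_on_circle[OF f r] g])
    show "(\<lambda>t. C * norm (g t)) integrable_on {0..2*pi}"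
      by (rule integrable_on_mult_right) (use g in \<open>simp add: absolutely_integrable_on_def\<close>)
  next
    fix t
    show "norm (f (of_real r * cis t) * g t) \<le> C * norm (g t)"
      unfolding norm_mult using r by (intro mult_right_mono C) (auto simp: norm_mult)
  qed
  thus ?thesis by simp
qed

lemma circle_mean_norm_bound:
  assumes f: "f holomorphic_on ball 0 1" and g: "g holomorphic_on ball 0 1" and r: "0 \<le> r" "r < (1::real)"
    and C: "\<And>t. norm (f (of_real r * cis t) * cnj (g (of_real r * cis t))) \<le> C"
  shows "norm (circle_mean r f g) \<le> C"
proof -
  have "norm (integral {0..2*pi} (\<lambda>t. f (of_real r * cis t) * cnj (g (of_real r * cis t))))
       \<le> integral {0..2*pi} (\<lambda>t. C)"
    by (rule integral_norm_bound_integral)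
       (use C in \<open>auto intro!: integrable_continuous_real continuous_intros continuous_on_circle[OF f r] continuous_on_circle[OF g r]\<close>)
  also have "\<dots> = 2 * pi * C" by simp
  finally show ?thesis by (simp add: circle_mean_def norm_divide field_simps norm_mult)
qed

text \<open>With absolute summability Abel's theorem is an instance of Tannery's: for
  \<open>r\<close> in the unit interval every term is dominated by
  \<open>norm (c m)\<close>.\<close>

lemma abel_at_left_1:
  fixes c :: "nat \<Rightarrow> 'a :: {real_normed_algebra_1, banach}"
  assumes "summable (\<lambda>m. norm (c m))"
  shows "((\<lambda>r. \<Sum>m. c m * of_real r ^ m) \<longlongrightarrow> (\<Sum>m. c m)) (at_left 1)"
proof -
  have ev: "eventually (\<lambda>r::real. 0 < r \<and> r < 1) (at_left 1)"
    unfolding eventually_at_left_field by (intro exI[of _ 0]) auto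
  have lim: "((\<lambda>r. c m * of_real r ^ m) \<longlongrightarrow> c m) (at_left 1)" for m
  proof -
    have "((\<lambda>r. c m * of_real r ^ m) \<longlongrightarrow> c m * of_real 1 ^ m) (at_left 1)"
      by (intro tendsto_intros)
    thus ?thesis by simp
  qed
  have bd: "eventually (\<lambda>(m,r). norm (c m * of_real r ^ m) \<le> norm (c m)) (at_top \<times>\<^sub>F at_left 1)"
    unfolding eventually_prod_filter
  proof (intro exI conjI)
    show "\<forall>x y. True \<longrightarrow> (0 < y \<and> y < 1) \<longrightarrow> (case (x, y) of (m, r) \<Rightarrow> norm (c m * of_real r ^ m) \<le> norm (c m))"
    proof (clarsimp)
      fix m :: nat and r :: real assume r: "0 < r" "r < 1"
      have "norm (c m * of_real r ^ m) \<le> norm (c m) * norm (of_real r ^ m :: 'a)" by (rule norm_mult_ineq)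
      also have "norm (of_real r ^ m :: 'a) = r ^ m" using r by (simp flip: of_real_power)
      also have "norm (c m) * r ^ m \<le> norm (c m) * 1"
        using r by (intro mult_left_mono power_le_one) auto
      finally show "norm (c m * of_real r ^ m) \<le> norm (c m)" by simp
    qed
  qed (use ev in auto)
  show ?thesis
    using tannerys_theorem[OF lim bd assms] by simp
qed

lemma filterlim_square_at_left_1: "filterlim (\<lambda>r::real. r\<^sup>2) (at_left 1) (at_left 1)"
proof (rule filterlim_at_withinI)
  have "((\<lambda>r::real. r\<^sup>2) \<longlongrightarrow> 1\<^sup>2) (at_left 1)" by (intro tendsto_intros)
  thus "((\<lambda>r::real. r\<^sup>2) \<longlongrightarrow> 1) (at_left 1)" by simp
  show "eventually (\<lambda>r::real. r\<^sup>2 \<in> {..<1} - {1}) (at_left 1)"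
    unfolding eventually_at_left_field
    by (intro exI[of _ 0]) (auto simp: power_less_one_iff power2_eq_1_iff)
qed

text \<open>By Parseval a finite section with weights \<open>(r\<^sup>2) ^ m\<close> is at most the
  mean square of \<open>f\<close> on a circle, hence at most \<open>C\<^sup>2\<close>. The weights
  disappear on letting \<open>r\<close> tend to 1 in the finite sum.\<close>

lemma coef_l2:
  assumes f: "f holomorphic_on ball 0 1" and C: "\<And>z. norm z < 1 \<Longrightarrow> norm (f z) \<le> C"
  shows "summable (\<lambda>m. (norm (coef f m))\<^sup>2)" "(\<Sum>m. (norm (coef f m))\<^sup>2) \<le> C\<^sup>2"
proof -
  have C0: "0 \<le> C" using order_trans[OF norm_ge_zero C[of 0]] by simp
  have *: "(\<Sum>m<K. (norm (coef f m))\<^sup>2 * (r\<^sup>2) ^ m) \<le> C\<^sup>2" if r: "0 < r" "r < 1" for r :: real and K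
  proof -
    have s: "(\<lambda>m. of_real ((norm (coef f m))\<^sup>2 * (r\<^sup>2) ^ m)) sums circle_mean r f f"
      using circle_mean_sums[OF f f, of r] r
      by (simp add: complex_norm_square of_real_power[of "r\<^sup>2"] del: of_real_power)
    have sr: "(\<lambda>m. (norm (coef f m))\<^sup>2 * (r\<^sup>2) ^ m) sums Re (circle_mean r f f)"
      using sums_Re[OF s] by simp
    have "(\<Sum>m<K. (norm (coef f m))\<^sup>2 * (r\<^sup>2) ^ m) \<le> Re (circle_mean r f f)"
      using sum_le_suminf[OF sums_summable[OF sr], of "{..<K}"] sums_unique[OF sr] by auto
    also have "\<dots> \<le> norm (circle_mean r f f)" by (rule complex_Re_le_cmod)
    also have "\<dots> \<le> C\<^sup>2"
    proof (rule circle_mean_norm_bound[OF f f])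
      fix t
      show "norm (f (of_real r * cis t) * cnj (f (of_real r * cis t))) \<le> C\<^sup>2"
        unfolding power2_eq_square norm_mult complex_mod_cnj
        using r C0 by (intro mult_mono C) (auto simp: norm_mult)
    qed (use r in auto)
    finally show ?thesis .
  qed
  have fin: "(\<Sum>m<K. (norm (coef f m))\<^sup>2) \<le> C\<^sup>2" for K
  proof (rule tendsto_upperbound)
    have "((\<lambda>r::real. \<Sum>m<K. (norm (coef f m))\<^sup>2 * (r\<^sup>2) ^ m) \<longlongrightarrow> (\<Sum>m<K. (norm (coef f m))\<^sup>2 * (1\<^sup>2) ^ m)) (at_left 1)"
      by (intro tendsto_intros)
    thus "((\<lambda>r::real. \<Sum>m<K. (norm (coef f m))\<^sup>2 * (r\<^sup>2) ^ m) \<longlongrightarrow> (\<Sum>m<K. (norm (coef f m))\<^sup>2)) (at_left 1)"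
      by simp
    show "\<forall>\<^sub>F r in at_left 1. (\<Sum>m<K. (norm (coef f m))\<^sup>2 * (r\<^sup>2) ^ m) \<le> C\<^sup>2"
      unfolding eventually_at_left_field by (intro exI[of _ 0]) (use * in auto)
  qed simp
  show sm: "summable (\<lambda>m. (norm (coef f m))\<^sup>2)"
    by (rule summableI_nonneg_bounded[where x = "C\<^sup>2"]) (use fin in auto)
  show "(\<Sum>m. (norm (coef f m))\<^sup>2) \<le> C\<^sup>2"
    by (rule suminf_le_const[OF sm fin])
qed

lemma coef_cnj_coef_summable:
  assumes "hb f" "hb g"
  shows "summable (\<lambda>m. norm (coef f m * cnj (coef g m)))"
proof (rule summable_comparison_test'[where N = 0])
  obtain C D where "\<And>z. norm z < 1 \<Longrightarrow> norm (f z) \<le> C" "\<And>z. norm z < 1 \<Longrightarrow> norm (g z) \<le> D"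
    using hb_bound assms by metis
  with assms show "summable (\<lambda>m. (norm (coef f m))\<^sup>2 + (norm (coef g m))\<^sup>2)"
    by (intro summable_add coef_l2) (auto simp: hb_def)
  fix m
  have "0 \<le> (norm (coef f m) - norm (coef g m))\<^sup>2 + (norm (coef f m))\<^sup>2 + (norm (coef g m))\<^sup>2" by simp
  thus "norm (norm (coef f m * cnj (coef g m))) \<le> (norm (coef f m))\<^sup>2 + (norm (coef g m))\<^sup>2"
    by (simp add: norm_mult power2_eq_square algebra_simps)
qed

lemma circle_mean_tendsto_suminf:
  assumes "hb f" "hb g"
  shows "((\<lambda>r. circle_mean r f g) \<longlongrightarrow> (\<Sum>m. coef f m * cnj (coef g m))) (at_left 1)"
proof -
  have "((\<lambda>r. \<Sum>m. coef f m * cnj (coef g m) * of_real (r\<^sup>2) ^ m) \<longlongrightarrow> (\<Sum>m. coef f m * cnj (coef g m))) (at_left 1)"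
    by (rule filterlim_compose[OF abel_at_left_1[OF coef_cnj_coef_summable[OF assms]] filterlim_square_at_left_1])
  moreover have "eventually (\<lambda>r. (\<Sum>m. coef f m * cnj (coef g m) * of_real (r\<^sup>2) ^ m) = circle_mean r f g) (at_left 1)"
    unfolding eventually_at_left_field
  proof (intro exI[of _ 0] conjI allI impI)
    fix r :: real assume "0 < r" "r < 1"
    thus "(\<Sum>m. coef f m * cnj (coef g m) * of_real (r\<^sup>2) ^ m) = circle_mean r f g"
      by (intro sums_unique[symmetric] circle_mean_sums hbD assms) auto
  qed simp
  ultimately show ?thesis by (rule Lim_transform_eventually)
qed

lemma h2_inner_suminf:
  assumes "hb f" "hb g"
  shows "h2_inner f g = (\<Sum>m. coef f m * cnj (coef g m))"
  unfolding h2_inner_Lim by (rule tendsto_Lim[OF _ circle_mean_tendsto_suminf[OF assms]]) simp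

lemma circle_mean_tendsto:
  assumes "hb f" "hb g"
  shows "((\<lambda>r. circle_mean r f g) \<longlongrightarrow> h2_inner f g) (at_left 1)"
  using circle_mean_tendsto_suminf[OF assms] h2_inner_suminf[OF assms] by simp

section \<open>Bounded holomorphic functions and the algebraic laws of the inner product\<close>

lemma hb_const [intro]: "hb (\<lambda>z. c)"
  by (rule hbI[where C = "norm c"]) auto

lemma hb_add [intro]:
  assumes "hb f" "hb g" shows "hb (\<lambda>z. f z + g z)"
proof -
  obtain C D where CD: "\<And>z. norm z < 1 \<Longrightarrow> norm (f z) \<le> C" "\<And>z. norm z < 1 \<Longrightarrow> norm (g z) \<le> D"
    using hb_bound assms by metis
  show ?thesis
    by (rule hbI[where C = "C + D"])
       (use assms CD in \<open>auto intro!: holomorphic_intros norm_triangle_mono simp: hb_def\<close>)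
qed

lemma hb_mult [intro]:
  assumes "hb f" "hb g" shows "hb (\<lambda>z. f z * g z)"
proof -
  obtain C D where CD: "C > 0" "\<And>z. norm z < 1 \<Longrightarrow> norm (f z) \<le> C" "\<And>z. norm z < 1 \<Longrightarrow> norm (g z) \<le> D"
    using hb_bound assms by metis
  show ?thesis
    by (rule hbI[where C = "C * D"])
       (use assms CD in \<open>auto intro!: holomorphic_intros mult_mono simp: hb_def norm_mult\<close>)
qed

lemma hb_uminus [intro]: "hb f \<Longrightarrow> hb (\<lambda>z. - f z)"
  using hb_mult[OF hb_const[of "-1"], of f] by simp

lemma hb_diff [intro]: "hb f \<Longrightarrow> hb g \<Longrightarrow> hb (\<lambda>z. f z - g z)"
  using hb_add[of f "\<lambda>z. - g z"] by auto

lemma hb_power [intro]: "hb f \<Longrightarrow> hb (\<lambda>z. f z ^ m)"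
  by (induction m) auto

lemma hb_sum [intro]: "(\<And>i. i \<in> I \<Longrightarrow> hb (f i)) \<Longrightarrow> hb (\<lambda>z. \<Sum>i\<in>I. f i z)"
  by (induction I rule: infinite_finite_induct) auto

lemmas hb_intros = hb_const hb_add hb_mult hb_uminus hb_diff hb_power hb_sum

lemma eventually_at_left_1I:
  assumes "\<And>r::real. 0 < r \<Longrightarrow> r < 1 \<Longrightarrow> P r" shows "eventually P (at_left 1)"
  unfolding eventually_at_left_field by (intro exI[of _ 0]) (use assms in auto)

text \<open>\<open>h2_inner\<close> is a \<open>Lim\<close> and says nothing before convergence is
  known. The algebraic laws are therefore checked for the means at a fixed radius and carried over
  by this rule.\<close>

lemma h2_inner_eqI:
  assumes "((\<lambda>r. circle_mean r f g) \<longlongrightarrow> L) (at_left 1)" shows "h2_inner f g = L"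
  unfolding h2_inner_Lim by (rule tendsto_Lim[OF _ assms]) simp

lemma circle_mean_integrable:
  assumes "hb f" "hb g" "0 \<le> r" "r < (1::real)"
  shows "(\<lambda>t. f (of_real r * cis t) * cnj (g (of_real r * cis t))) integrable_on {0..2*pi}"
  using assms by (auto intro!: integrable_continuous_real continuous_intros continuous_on_circle simp: hb_def)

lemma h2_inner_cong:
  assumes "hb f" "hb g" "\<And>z. norm z < 1 \<Longrightarrow> f z = f' z" "\<And>z. norm z < 1 \<Longrightarrow> g z = g' z"
  shows "h2_inner f g = h2_inner f' g'"
proof (rule sym, rule h2_inner_eqI, rule Lim_transform_eventually[OF circle_mean_tendsto[OF assms(1,2)]])
  show "\<forall>\<^sub>F r in at_left 1. circle_mean r f g = circle_mean r f' g'"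
    by (rule eventually_at_left_1I) (auto simp: circle_mean_def norm_mult assms(3,4))
qed

lemma h2_inner_add_left:
  assumes "hb f" "hb g" "hb h"
  shows "h2_inner (\<lambda>z. f z + g z) h = h2_inner f h + h2_inner g h"
proof (rule h2_inner_eqI, rule Lim_transform_eventually[OF tendsto_add[OF circle_mean_tendsto circle_mean_tendsto]])
  show "\<forall>\<^sub>F r in at_left 1. circle_mean r f h + circle_mean r g h = circle_mean r (\<lambda>z. f z + g z) h"
    by (rule eventually_at_left_1I)
       (auto simp: circle_mean_def distrib_right add_divide_distrib integral_add circle_mean_integrable assms)
qed (use assms in auto)

lemma h2_inner_scale_left:
  assumes "hb f" "hb g"
  shows "h2_inner (\<lambda>z. c * f z) g = c * h2_inner f g"
proof (rule h2_inner_eqI, rule Lim_transform_eventually[OF tendsto_mult_left[OF circle_mean_tendsto]])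
  show "\<forall>\<^sub>F r in at_left 1. c * circle_mean r f g = circle_mean r (\<lambda>z. c * f z) g"
    by (rule eventually_at_left_1I) (auto simp: circle_mean_def mult.assoc)
qed (use assms in auto)

lemma h2_inner_cnj:
  assumes "hb f" "hb g"
  shows "h2_inner g f = cnj (h2_inner f g)"
proof (rule h2_inner_eqI, rule Lim_transform_eventually[OF tendsto_cnj[OF circle_mean_tendsto]])
  show "\<forall>\<^sub>F r in at_left 1. cnj (circle_mean r f g) = circle_mean r g f"
    by (rule eventually_at_left_1I) (auto simp: circle_mean_def integral_cnj mult.commute)
qed (use assms in auto)

lemma h2_inner_add_right:
  assumes "hb f" "hb g" "hb h"
  shows "h2_inner h (\<lambda>z. f z + g z) = h2_inner h f + h2_inner h g"
  using assms h2_inner_add_left[OF assms] by (simp add: h2_inner_cnj[of _ h] hb_add)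

lemma h2_inner_scale_right:
  assumes "hb f" "hb g"
  shows "h2_inner g (\<lambda>z. c * f z) = cnj c * h2_inner g f"
proof -
  have "hb (\<lambda>z. c * f z)" using assms by auto
  thus ?thesis using assms by (simp add: h2_inner_cnj[of _ g] h2_inner_scale_left)
qed

lemma h2_inner_diff_left:
  assumes "hb f" "hb g" "hb h"
  shows "h2_inner (\<lambda>z. f z - g z) h = h2_inner f h - h2_inner g h"
  using assms h2_inner_add_left[of f "\<lambda>z. (-1) * g z" h] h2_inner_scale_left[of g h "-1"]
  by (simp add: hb_uminus)

lemma h2_inner_diff_right:
  assumes "hb f" "hb g" "hb h"
  shows "h2_inner h (\<lambda>z. f z - g z) = h2_inner h f - h2_inner h g"
  using assms h2_inner_add_right[of f "\<lambda>z. (-1) * g z" h] h2_inner_scale_right[of g h "-1"]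
  by (simp add: hb_uminus)

lemma h2_inner_zero_left: "hb g \<Longrightarrow> h2_inner (\<lambda>z. 0) g = 0"
  using h2_inner_scale_left[of "\<lambda>z. 0" g 0] by auto

lemma h2_inner_sum_left:
  assumes "finite I" "\<And>i. i \<in> I \<Longrightarrow> hb (f i)" "hb h"
  shows "h2_inner (\<lambda>z. \<Sum>i\<in>I. f i z) h = (\<Sum>i\<in>I. h2_inner (f i) h)"
  using assms by (induction I rule: finite_induct) (auto simp: h2_inner_add_left hb_sum h2_inner_zero_left)

section \<open>The Hardy norm, point evaluations and limits\<close>

definition h2_norm :: "(complex \<Rightarrow> complex) \<Rightarrow> real" where
  "h2_norm f = sqrt (Re (h2_inner f f))"

lemma h2_inner_self_suminf:
  assumes "hb f"
  shows "h2_inner f f = of_real (\<Sum>m. (norm (coef f m))\<^sup>2)" "summable (\<lambda>m. (norm (coef f m))\<^sup>2)"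
proof -
  obtain C where "\<And>z. norm z < 1 \<Longrightarrow> norm (f z) \<le> C"
    using hb_bound assms by metis
  with assms show s: "summable (\<lambda>m. (norm (coef f m))\<^sup>2)" by (intro coef_l2) (auto simp: hb_def)
  show "h2_inner f f = of_real (\<Sum>m. (norm (coef f m))\<^sup>2)"
    unfolding h2_inner_suminf[OF assms assms] suminf_of_real[OF s]
    by (simp add: complex_norm_square del: of_real_power)
qed

lemma h2_norm_ge_0: "0 \<le> h2_norm f" if "hb f"
  using h2_inner_self_suminf[OF that] by (simp add: h2_norm_def suminf_nonneg)

lemma h2_norm_sq: "hb f \<Longrightarrow> (h2_norm f)\<^sup>2 = (\<Sum>m. (norm (coef f m))\<^sup>2)"
  using h2_inner_self_suminf[of f] by (simp add: h2_norm_def suminf_nonneg)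

lemma h2_inner_self: "hb f \<Longrightarrow> h2_inner f f = of_real ((h2_norm f)\<^sup>2)"
  using h2_inner_self_suminf(1)[of f] h2_norm_sq[of f] by simp

lemma h2_norm_cong:
  "hb f \<Longrightarrow> (\<And>z. norm z < 1 \<Longrightarrow> f z = g z) \<Longrightarrow> h2_norm f = h2_norm g"
  unfolding h2_norm_def using h2_inner_cong[of f f g g] by simp

lemma h2_norm_scale: "hb f \<Longrightarrow> h2_norm (\<lambda>z. c * f z) = norm c * h2_norm f"
proof -
  assume f: "hb f"
  have h: "hb (\<lambda>z. c * f z)" using f by auto
  have "complex_of_real ((h2_norm (\<lambda>z. c * f z))\<^sup>2) = of_real ((norm c * h2_norm f)\<^sup>2)"
    unfolding h2_inner_self[OF h, symmetric] power_mult_distrib of_real_mult h2_inner_self[OF f, symmetric]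
    using f h by (simp add: h2_inner_scale_left h2_inner_scale_right complex_norm_square del: of_real_power)
  hence "(h2_norm (\<lambda>z. c * f z))\<^sup>2 = (norm c * h2_norm f)\<^sup>2" by (simp only: of_real_eq_iff)
  thus ?thesis using h2_norm_ge_0[OF f] h2_norm_ge_0[OF h] by (simp add: power2_eq_iff_nonneg)
qed

text \<open>Cauchy-Schwarz between the Taylor coefficients and the powers of \<open>z\<close>, whose
  squared moduli sum to \<open>1 / (1 - (norm z)\<^sup>2)\<close>. This is how norm estimates become
  pointwise estimates in the whole development.\<close>

lemma h2_eval_bound:
  assumes f: "hb f" and z: "norm z < 1"
  shows "(norm (f z))\<^sup>2 \<le> (h2_norm f)\<^sup>2 / (1 - (norm z)\<^sup>2)"
proof (rule tendsto_upperbound)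
  have z2: "(norm z)\<^sup>2 < 1" using z by (simp add: power_less_one_iff)
  have geo: "(\<lambda>m. ((norm z)\<^sup>2) ^ m) sums (1 / (1 - (norm z)\<^sup>2))"
    by (rule geometric_sums) (use z2 in simp)
  show "(\<lambda>K. (norm (\<Sum>m<K. coef f m * z ^ m))\<^sup>2) \<longlonglongrightarrow> (norm (f z))\<^sup>2"
    using coef_sums[OF hbD[OF f] z] unfolding sums_def by (intro tendsto_intros)
  show "\<forall>\<^sub>F K in sequentially. (norm (\<Sum>m<K. coef f m * z ^ m))\<^sup>2 \<le> (h2_norm f)\<^sup>2 / (1 - (norm z)\<^sup>2)"
  proof (rule always_eventually, rule allI)
    fix K
    have "norm (\<Sum>m<K. coef f m * z ^ m) \<le> (\<Sum>m<K. norm (coef f m) * norm z ^ m)"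
      by (rule sum_norm_le) (simp add: norm_mult norm_power)
    hence "(norm (\<Sum>m<K. coef f m * z ^ m))\<^sup>2 \<le> (\<Sum>m<K. norm (coef f m) * norm z ^ m)\<^sup>2"
      by (rule power_mono) simp
    also have "\<dots> \<le> (\<Sum>m<K. (norm (coef f m))\<^sup>2) * (\<Sum>m<K. (norm z ^ m)\<^sup>2)"
      by (rule Cauchy_Schwarz_ineq_sum)
    also have "\<dots> \<le> (h2_norm f)\<^sup>2 * (1 / (1 - (norm z)\<^sup>2))"
    proof (rule mult_mono)
      show "(\<Sum>m<K. (norm (coef f m))\<^sup>2) \<le> (h2_norm f)\<^sup>2"
        unfolding h2_norm_sq[OF f] by (rule sum_le_suminf) (use h2_inner_self_suminf[OF f] in auto)
      show "(\<Sum>m<K. (norm z ^ m)\<^sup>2) \<le> 1 / (1 - (norm z)\<^sup>2)"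
        using sum_le_suminf[OF sums_summable[OF geo], of "{..<K}"] sums_unique[OF geo]
        by (simp add: power_mult[symmetric] mult.commute)
    qed (auto intro: sum_nonneg)
    finally show "(norm (\<Sum>m<K. coef f m * z ^ m))\<^sup>2 \<le> (h2_norm f)\<^sup>2 / (1 - (norm z)\<^sup>2)" by simp
  qed
qed simp

lemma h2_norm_eq_0_imp:
  assumes "hb f" "h2_norm f = 0" "norm z < 1" shows "f z = 0"
  using h2_eval_bound[OF assms(1,3)] assms(2) by simp

lemma h2_norm_diff_sq:
  assumes f: "hb f" and g: "hb g"
  shows "(h2_norm (\<lambda>z. f z - g z))\<^sup>2 = (h2_norm f)\<^sup>2 - 2 * Re (h2_inner f g) + (h2_norm g)\<^sup>2"
proof -
  have d: "hb (\<lambda>z. f z - g z)" using f g by auto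
  have "complex_of_real ((h2_norm (\<lambda>z. f z - g z))\<^sup>2) =
      of_real ((h2_norm f)\<^sup>2) - h2_inner f g - cnj (h2_inner f g) + of_real ((h2_norm g)\<^sup>2)"
    unfolding h2_inner_self[OF d, symmetric] h2_inner_self[OF f, symmetric] h2_inner_self[OF g, symmetric]
    using f g d h2_inner_cnj[OF f g] by (simp add: h2_inner_diff_left h2_inner_diff_right)
  from arg_cong[OF this, of Re] show ?thesis by simp
qed

lemma h2_cauchy_schwarz:
  assumes f: "hb f" and g: "hb g"
  shows "norm (h2_inner f g) \<le> h2_norm f * h2_norm g"
proof (cases "h2_norm g = 0")
  case True
  have "h2_inner f g = h2_inner f (\<lambda>z. 0 * g z)"
    using h2_norm_eq_0_imp[OF g True] by (intro h2_inner_cong f g) auto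
  also have "\<dots> = 0" using f g by (subst h2_inner_scale_right) auto
  finally show ?thesis using h2_norm_ge_0 f g by simp
next
  case False
  hence pos: "h2_norm g > 0" using h2_norm_ge_0[OF g] by simp
  \<comment> \<open>The coefficient of the orthogonal projection of \<open>f\<close> onto
    \<open>g\<close>, so that the nonnegative quantity below is the squared distance of
    \<open>f\<close> from the line through \<open>g\<close>.\<close>
  define c where "c = h2_inner f g / of_real ((h2_norm g)\<^sup>2)"
  have cg: "hb (\<lambda>z. c * g z)" using g by auto
  have "0 \<le> (h2_norm (\<lambda>z. f z - c * g z))\<^sup>2" by simp
  also have "\<dots> = (h2_norm f)\<^sup>2 - 2 * Re (cnj c * h2_inner f g) + (norm c * h2_norm g)\<^sup>2"
    unfolding h2_norm_diff_sq[OF f cg] h2_inner_scale_right[OF g f] h2_norm_scale[OF g] ..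
  also have "cnj c * h2_inner f g = of_real ((norm (h2_inner f g))\<^sup>2 / (h2_norm g)\<^sup>2)"
    unfolding c_def by (simp add: complex_norm_square mult.commute del: of_real_power)
  also have "(norm c * h2_norm g)\<^sup>2 = (norm (h2_inner f g))\<^sup>2 / (h2_norm g)\<^sup>2"
    using pos unfolding c_def by (simp add: norm_divide norm_power power_mult_distrib power_divide field_simps)
  finally have "(norm (h2_inner f g))\<^sup>2 / (h2_norm g)\<^sup>2 \<le> (h2_norm f)\<^sup>2" by simp
  hence "(norm (h2_inner f g))\<^sup>2 \<le> (h2_norm f * h2_norm g)\<^sup>2"
    using pos by (simp add: field_simps power_mult_distrib)
  thus ?thesis using h2_norm_ge_0 f g by (blast intro: power2_le_imp_le mult_nonneg_nonneg)
qed

lemma h2_norm_triangle: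
  assumes f: "hb f" and g: "hb g"
  shows "h2_norm (\<lambda>z. f z + g z) \<le> h2_norm f + h2_norm g"
proof (rule power2_le_imp_le)
  have g': "hb (\<lambda>z. (-1) * g z)" using g by auto
  have "(h2_norm (\<lambda>z. f z + g z))\<^sup>2 = (h2_norm f)\<^sup>2 + 2 * Re (h2_inner f g) + (h2_norm g)\<^sup>2"
    using h2_norm_diff_sq[OF f g'] h2_inner_scale_right[OF g f, of "-1"] h2_norm_scale[OF g, of "-1"] by simp
  also have "Re (h2_inner f g) \<le> h2_norm f * h2_norm g"
    using complex_Re_le_cmod h2_cauchy_schwarz[OF f g] order_trans by blast
  finally show "(h2_norm (\<lambda>z. f z + g z))\<^sup>2 \<le> (h2_norm f + h2_norm g)\<^sup>2"
    by (simp add: power2_eq_square algebra_simps)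
qed (use h2_norm_ge_0 f g in auto)

lemma circle_norm_sq_integrable:
  assumes "hb f" "0 \<le> r" "r < (1::real)"
  shows "(\<lambda>t. (norm (f (of_real r * cis t)))\<^sup>2) integrable_on {0..2*pi}"
  using assms by (auto intro!: integrable_continuous_real continuous_intros continuous_on_circle simp: hb_def)

lemma Re_circle_mean_self:
  assumes "hb f" "0 \<le> r" "r < (1::real)"
  shows "Re (circle_mean r f f) = integral {0..2*pi} (\<lambda>t. (norm (f (of_real r * cis t)))\<^sup>2) / (2 * pi)"
proof -
  have "((\<lambda>t. complex_of_real ((norm (f (of_real r * cis t)))\<^sup>2)) has_integral
      of_real (integral {0..2*pi} (\<lambda>t. (norm (f (of_real r * cis t)))\<^sup>2))) {0..2*pi}"
    by (rule has_integral_of_real[OF integrable_integral[OF circle_norm_sq_integrable[OF assms]]])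
  hence "circle_mean r f f = of_real (integral {0..2*pi} (\<lambda>t. (norm (f (of_real r * cis t)))\<^sup>2) / (2 * pi))"
    unfolding circle_mean_def complex_norm_square[symmetric] by (simp add: integral_unique)
  thus ?thesis by auto
qed

lemma circle_mean_self_tendsto:
  assumes "hb f"
  shows "((\<lambda>r. Re (circle_mean r f f)) \<longlongrightarrow> (h2_norm f)\<^sup>2) (at_left 1)"
  using tendsto_Re[OF circle_mean_tendsto[OF assms assms]] h2_inner_self[OF assms] by simp

lemma circle_mean_self_le:
  assumes f: "hb f" and r: "0 \<le> r" "r < (1::real)"
  shows "Re (circle_mean r f f) \<le> (h2_norm f)\<^sup>2"
proof -
  have s: "(\<lambda>m. of_real ((norm (coef f m))\<^sup>2 * (r\<^sup>2) ^ m)) sums circle_mean r f f"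
    using circle_mean_sums[OF hbD[OF f] hbD[OF f] r]
    by (simp add: complex_norm_square of_real_power[of "r\<^sup>2"] del: of_real_power)
  have sr: "(\<lambda>m. (norm (coef f m))\<^sup>2 * (r\<^sup>2) ^ m) sums Re (circle_mean r f f)"
    using sums_Re[OF s] by simp
  have "(norm (coef f m))\<^sup>2 * (r\<^sup>2) ^ m \<le> (norm (coef f m))\<^sup>2" for m
    using r by (simp add: mult_left_le power_le_one)
  hence "(\<Sum>m. (norm (coef f m))\<^sup>2 * (r\<^sup>2) ^ m) \<le> (\<Sum>m. (norm (coef f m))\<^sup>2)"
    by (intro suminf_le sums_summable[OF sr] h2_inner_self_suminf[OF f]) auto
  thus ?thesis using sums_unique[OF sr] h2_norm_sq[OF f] by simp
qed

lemma h2_norm_le_pointwise: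
  assumes f: "hb f" and g: "hb g" and le: "\<And>z. norm z < 1 \<Longrightarrow> norm (f z) \<le> norm (g z)"
  shows "h2_norm f \<le> h2_norm g"
proof (rule power2_le_imp_le)
  show "(h2_norm f)\<^sup>2 \<le> (h2_norm g)\<^sup>2"
  proof (rule tendsto_le[OF _ circle_mean_self_tendsto[OF g] circle_mean_self_tendsto[OF f]])
    show "\<forall>\<^sub>F r in at_left 1. Re (circle_mean r f f) \<le> Re (circle_mean r g g)"
    proof (rule eventually_at_left_1I)
      fix r :: real assume r: "0 < r" "r < 1"
      have "integral {0..2*pi} (\<lambda>t. (norm (f (of_real r * cis t)))\<^sup>2)
          \<le> integral {0..2*pi} (\<lambda>t. (norm (g (of_real r * cis t)))\<^sup>2)"
        using r by (intro integral_le circle_norm_sq_integrable f g power_mono le) (auto simp: norm_mult)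
      thus "Re (circle_mean r f f) \<le> Re (circle_mean r g g)"
        using r by (simp add: Re_circle_mean_self f g divide_right_mono)
    qed
  qed simp
qed (rule h2_norm_ge_0[OF g])

lemma h2_norm_mult_le:
  assumes f: "hb f" and g: "hb g" and C: "0 \<le> C" "\<And>z. norm z < 1 \<Longrightarrow> norm (f z) \<le> C"
  shows "h2_norm (\<lambda>z. f z * g z) \<le> C * h2_norm g"
proof -
  have "h2_norm (\<lambda>z. f z * g z) \<le> h2_norm (\<lambda>z. of_real C * g z)"
    using assms by (intro h2_norm_le_pointwise) (auto simp: norm_mult intro!: mult_right_mono)
  thus ?thesis using h2_norm_scale[OF g, of "of_real C"] C by simp
qed

text \<open>On a fixed circle the evaluation bound dominates all \<open>f k\<close> by the same
  constant, so their circle means converge to that of \<open>g\<close>. Each mean is at most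
  \<open>c\<^sup>2\<close>, since circle means never exceed the squared norm; only afterwards does
  the radius tend to 1.\<close>

lemma h2_norm_fatou:
  assumes fk: "\<And>k. hb (f k)" and g: "hb g" and lim: "\<And>z. norm z < 1 \<Longrightarrow> (\<lambda>k. f k z) \<longlonglongrightarrow> g z"
    and c: "0 \<le> c" "\<And>k. h2_norm (f k) \<le> c"
  shows "h2_norm g \<le> c"
proof (rule power2_le_imp_le)
  show "(h2_norm g)\<^sup>2 \<le> c\<^sup>2"
  proof (rule tendsto_upperbound[OF circle_mean_self_tendsto[OF g]])
    show "\<forall>\<^sub>F r in at_left 1. Re (circle_mean r g g) \<le> c\<^sup>2"
    proof (rule eventually_at_left_1I)
      fix r :: real assume r: "0 < r" "r < 1"
      have r2: "r\<^sup>2 < 1" using r by (simp add: power_less_one_iff)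
      have "(\<lambda>k. integral {0..2*pi} (\<lambda>t. (norm (f k (of_real r * cis t)))\<^sup>2))
            \<longlonglongrightarrow> integral {0..2*pi} (\<lambda>t. (norm (g (of_real r * cis t)))\<^sup>2)"
      proof (rule dominated_convergence(2)[where h = "\<lambda>t. c\<^sup>2 / (1 - r\<^sup>2)"])
        fix k t
        have "(norm (f k (of_real r * cis t)))\<^sup>2 \<le> (h2_norm (f k))\<^sup>2 / (1 - r\<^sup>2)"
          using h2_eval_bound[OF fk[of k], of "of_real r * cis t"] r by (simp add: norm_mult)
        also have "\<dots> \<le> c\<^sup>2 / (1 - r\<^sup>2)"
          using r2 c h2_norm_ge_0[OF fk] by (intro divide_right_mono power_mono) auto
        finally show "norm ((norm (f k (of_real r * cis t)))\<^sup>2) \<le> c\<^sup>2 / (1 - r\<^sup>2)" by simp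
      next
        fix t show "(\<lambda>k. (norm (f k (of_real r * cis t)))\<^sup>2) \<longlonglongrightarrow> (norm (g (of_real r * cis t)))\<^sup>2"
          using r by (intro tendsto_intros lim) (auto simp: norm_mult)
      qed (use r in \<open>auto intro!: circle_norm_sq_integrable fk\<close>)
      hence "(\<lambda>k. Re (circle_mean r (f k) (f k))) \<longlonglongrightarrow> Re (circle_mean r g g)"
        using r by (simp add: Re_circle_mean_self fk g tendsto_divide)
      thus "Re (circle_mean r g g) \<le> c\<^sup>2"
      proof (rule tendsto_upperbound)
        show "\<forall>\<^sub>F k in sequentially. Re (circle_mean r (f k) (f k)) \<le> c\<^sup>2"
        proof (rule always_eventually, rule allI)
          fix k
          have "Re (circle_mean r (f k) (f k)) \<le> (h2_norm (f k))\<^sup>2"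
            using r by (intro circle_mean_self_le fk) auto
          also have "\<dots> \<le> c\<^sup>2" using c h2_norm_ge_0[OF fk] by (intro power_mono) auto
          finally show "Re (circle_mean r (f k) (f k)) \<le> c\<^sup>2" .
        qed
      qed simp
    qed
  qed simp
qed (rule c)

section \<open>Weak* closed subspaces and bounded pointwise limits\<close>

text \<open>Bessel's inequality, tested on the trigonometric polynomial \<open>p\<close> whose
  coefficients are the conjugated moments: its integral against \<open>g\<close> is the partial sum
  \<open>S\<close>, while its squared modulus integrates to \<open>2 * pi * S\<close>.\<close>

lemma bessel_cis:
  fixes g :: "real \<Rightarrow> complex"
  assumes g: "g absolutely_integrable_on {0..2*pi}" and K: "\<And>t. t \<in> {0..2*pi} \<Longrightarrow> norm (g t) \<le> K"
  shows "summable (\<lambda>m. (norm (integral {0..2*pi} (\<lambda>t. cis (real m * t) * g t)))\<^sup>2)"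
proof -
  define \<gamma> where "\<gamma> m = integral {0..2*pi} (\<lambda>t. cis (real m * t) * g t)" for m
  have gi: "(\<lambda>t. cis (real m * t) * g t) integrable_on {0..2*pi}" for m
    by (rule set_lebesgue_integral_eq_integral(1),
        rule absolutely_integrable_continuous_mult[OF _ g]) (intro continuous_intros)
  have K0: "0 \<le> K" using order_trans[OF norm_ge_zero K[of 0]] by simp
  have bd: "(\<Sum>m<N. (norm (\<gamma> m))\<^sup>2) \<le> 4 * pi\<^sup>2 * K\<^sup>2" for N
  proof -
    define S where "S = (\<Sum>m<N. (norm (\<gamma> m))\<^sup>2)"
    define p where "p t = (\<Sum>m<N. cnj (\<gamma> m) * cis (real m * t))" for t
    have cp: "continuous_on A p" for A unfolding p_def by (intro continuous_intros)
    have pg: "((\<lambda>t. p t * g t) has_integral of_real S) {0..2*pi}"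
    proof -
      have "((\<lambda>t. \<Sum>m<N. cnj (\<gamma> m) * (cis (real m * t) * g t)) has_integral (\<Sum>m<N. cnj (\<gamma> m) * \<gamma> m)) {0..2*pi}"
        unfolding \<gamma>_def by (intro has_integral_sum has_integral_mult_right integrable_integral gi) simp
      thus ?thesis
        by (simp add: p_def S_def sum_distrib_right mult.assoc complex_norm_square mult.commute[of "cnj _"] del: of_real_power)
    qed
    have pp: "((\<lambda>t. p t * cnj (p t)) has_integral of_real (2 * pi * S)) {0..2*pi}"
    proof -
      have c: "((\<lambda>t. cis (real m * t) * cnj (cis (real k * t))) has_integral complex_of_real (if m = k then 2*pi else 0)) {0..2*pi}" for m k
        unfolding integral_cis_cnj_cis[symmetric]
        by (intro integrable_integral integrable_continuous_real continuous_intros)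
      have "((\<lambda>t. \<Sum>m<N. \<Sum>k<N. cnj (\<gamma> m) * \<gamma> k * (cis (real m * t) * cnj (cis (real k * t)))) has_integral
             (\<Sum>m<N. \<Sum>k<N. cnj (\<gamma> m) * \<gamma> k * complex_of_real (if m = k then 2*pi else 0))) {0..2*pi}"
        by (intro has_integral_sum has_integral_mult_right c) auto
      also have "(\<lambda>t. \<Sum>m<N. \<Sum>k<N. cnj (\<gamma> m) * \<gamma> k * (cis (real m * t) * cnj (cis (real k * t)))) = (\<lambda>t. p t * cnj (p t))"
        unfolding p_def cnj_sum sum_product by (intro ext sum.cong refl) (simp add: mult_ac)
      also have "(\<Sum>m<N. \<Sum>k<N. cnj (\<gamma> m) * \<gamma> k * complex_of_real (if m = k then 2*pi else 0)) = of_real (2 * pi * S)"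
        by (simp add: S_def sum_distrib_left complex_norm_square mult_ac if_distrib cong: if_cong del: of_real_power)
      finally show ?thesis .
    qed
    have pp': "((\<lambda>t. (norm (p t))\<^sup>2) has_integral 2 * pi * S) {0..2*pi}"
    proof -
      have "p t * cnj (p t) = of_real ((norm (p t))\<^sup>2)" for t by (simp only: complex_norm_square)
      hence "((\<lambda>t. complex_of_real ((norm (p t))\<^sup>2)) has_integral of_real (2 * pi * S)) {0..2*pi}" using pp by simp
      from has_integral_Re[OF this] show ?thesis by simp
    qed
    \<comment> \<open>The weights \<open>1 / (4 * pi)\<close> and \<open>pi\<close> are the case of
      the arithmetic-geometric inequality for which the first term integrates to
      \<open>S / 2\<close> and can be absorbed on the left.\<close>
    have "norm (integral {0..2*pi} (\<lambda>t. p t * g t)) \<le> integral {0..2*pi} (\<lambda>t. (norm (p t))\<^sup>2 / (4 * pi) + pi * K\<^sup>2)"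
    proof (rule integral_norm_bound_integral)
      show "(\<lambda>t. p t * g t) integrable_on {0..2*pi}" using pg by blast
      show "(\<lambda>t. (norm (p t))\<^sup>2 / (4 * pi) + pi * K\<^sup>2) integrable_on {0..2*pi}"
        by (intro integrable_continuous_real continuous_intros cp) auto
      fix t assume t: "t \<in> {0..2*pi}"
      have "norm (p t * g t) \<le> norm (p t) * K" unfolding norm_mult by (intro mult_left_mono K t) simp
      also have "\<dots> \<le> (norm (p t))\<^sup>2 / (4 * pi) + pi * K\<^sup>2"
      proof -
        have "0 \<le> (norm (p t) - 2 * pi * K)\<^sup>2 / (4 * pi)" by simp
        also have "\<dots> = (norm (p t))\<^sup>2 / (4 * pi) - norm (p t) * K + pi * K\<^sup>2"
          by (simp add: field_simps power2_eq_square)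
        finally show ?thesis by simp
      qed
      finally show "norm (p t * g t) \<le> (norm (p t))\<^sup>2 / (4 * pi) + pi * K\<^sup>2" .
    qed
    also have "\<dots> = 2 * pi * S / (4 * pi) + 2 * pi * (pi * K\<^sup>2)"
    proof (rule integral_unique)
      have "((\<lambda>t. pi * K\<^sup>2) has_integral (2 * pi) * (pi * K\<^sup>2)) {0..2*pi}"
        using has_integral_const_real[of "pi * K\<^sup>2" 0 "2*pi"] by simp
      thus "((\<lambda>t. (norm (p t))\<^sup>2 / (4 * pi) + pi * K\<^sup>2) has_integral (2 * pi * S / (4 * pi) + 2 * pi * (pi * K\<^sup>2))) {0..2*pi}"
        by (intro has_integral_add has_integral_divide pp')
    qed
    also have "integral {0..2*pi} (\<lambda>t. p t * g t) = of_real S" using pg by (rule integral_unique)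
    finally have "\<bar>S\<bar> \<le> S / 2 + 2 * pi\<^sup>2 * K\<^sup>2" by (simp add: power2_eq_square mult_ac)
    hence "S \<le> 4 * pi\<^sup>2 * K\<^sup>2" by linarith
    thus ?thesis by (simp add: S_def)
  qed
  show ?thesis
    by (rule summableI_nonneg_bounded[where x = "4 * pi\<^sup>2 * K\<^sup>2"]) (use bd in \<open>auto simp: \<gamma>_def\<close>)
qed

text \<open>Uniform Cauchy condition at the boundary: the threshold \<open>d\<close> depends on
  \<open>g\<close> and \<open>e\<close> but not on \<open>f\<close> in the unit ball. This
  uniformity later permits the exchange of the radial limit with a limit of functions.\<close>

definition unif_radial :: "(real \<Rightarrow> complex) \<Rightarrow> bool" where
  "unif_radial g \<longleftrightarrow> (\<forall>e>0. \<exists>d\<ge>0. d < 1 \<and> (\<forall>f r s. f holomorphic_on ball 0 1 \<longrightarrow> (\<forall>z. norm z < 1 \<longrightarrow> norm (f z) \<le> 1) \<longrightarrow>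
      d < r \<and> r \<le> s \<and> s < 1 \<longrightarrow>
      norm (circle_integral f g s - circle_integral f g r) \<le> e))"

text \<open>The difference of two circle integrals is a series in \<open>coef f m\<close> times the
  moments of \<open>g\<close>, with weights \<open>s ^ m - r ^ m\<close>. Both sequences are square
  summable, the first with sum at most 1, and Abel's theorem for the squared moments makes the
  weighted part small independently of \<open>f\<close>.\<close>

lemma unif_radial_bounded:
  fixes g :: "real \<Rightarrow> complex"
  assumes g: "g absolutely_integrable_on {0..2*pi}" and K: "\<And>t. t \<in> {0..2*pi} \<Longrightarrow> norm (g t) \<le> K"
  shows "unif_radial g"
  unfolding unif_radial_def
proof (intro allI impI)
  fix e :: real assume e: "e > 0"
  define \<gamma> where "\<gamma> m = integral {0..2*pi} (\<lambda>t. cis (real m * t) * g t)" for m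
  have sg: "summable (\<lambda>m. (norm (\<gamma> m))\<^sup>2)" unfolding \<gamma>_def by (rule bessel_cis[OF g K])
  have "((\<lambda>r. \<Sum>m. (norm (\<gamma> m))\<^sup>2 * of_real r ^ m) \<longlongrightarrow> (\<Sum>m. (norm (\<gamma> m))\<^sup>2)) (at_left 1)"
    by (rule abel_at_left_1) (use sg in simp)
  hence "eventually (\<lambda>r. (\<Sum>m. (norm (\<gamma> m))\<^sup>2 * of_real r ^ m) > (\<Sum>m. (norm (\<gamma> m))\<^sup>2) - e\<^sup>2) (at_left 1)"
    by (rule order_tendstoD(1)) (use e in simp)
  then obtain d0 where d0: "d0 < 1" "\<And>r. d0 < r \<Longrightarrow> r < 1 \<Longrightarrow> (\<Sum>m. (norm (\<gamma> m))\<^sup>2 * r ^ m) > (\<Sum>m. (norm (\<gamma> m))\<^sup>2) - e\<^sup>2"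
    unfolding eventually_at_left_field by auto
  define d where "d = max d0 0"
  show "\<exists>d\<ge>0. d < 1 \<and> (\<forall>f r s. f holomorphic_on ball 0 1 \<longrightarrow> (\<forall>z. norm z < 1 \<longrightarrow> norm (f z) \<le> 1) \<longrightarrow>
      d < r \<and> r \<le> s \<and> s < 1 \<longrightarrow>
      norm (circle_integral f g s - circle_integral f g r) \<le> e)"
  proof (intro exI[of _ d] conjI allI impI)
    show d: "0 \<le> d" "d < 1" using d0 by (auto simp: d_def)
    fix f r s assume f: "f holomorphic_on ball 0 1" and f1: "\<forall>z. norm z < 1 \<longrightarrow> norm (f z) \<le> 1"
      and rs: "d < r \<and> r \<le> s \<and> s < 1"
    have r: "0 \<le> r" "r < 1" and s: "0 \<le> s" "s < 1" using rs d by auto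
    define b where "b m = coef f m * of_real s ^ m * \<gamma> m - coef f m * of_real r ^ m * \<gamma> m" for m
    have bs: "b sums (circle_integral f g s - circle_integral f g r)"
      unfolding b_def \<gamma>_def by (intro sums_diff circle_integral_sums f g r s)
    have sf: "summable (\<lambda>m. (norm (coef f m))\<^sup>2)" and sf1: "(\<Sum>m. (norm (coef f m))\<^sup>2) \<le> 1\<^sup>2"
      using coef_l2[OF f, of 1] f1 by auto
    \<comment> \<open>A majorant that no longer involves \<open>s\<close>: since
      \<open>r ^ m \<le> s ^ m \<le> 1\<close>, the square of \<open>s ^ m - r ^ m\<close> is at
      most \<open>1 - r ^ m\<close>.\<close>
    define q where "q m = (norm (\<gamma> m))\<^sup>2 - (norm (\<gamma> m))\<^sup>2 * r ^ m" for m
    have sr: "summable (\<lambda>m. (norm (\<gamma> m))\<^sup>2 * r ^ m)"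
      by (rule summable_comparison_test'[OF sg, where N = 0])
         (use r in \<open>auto simp: abs_mult power_le_one mult_left_le\<close>)
    have sq: "summable q" unfolding q_def by (intro summable_diff sg sr)
    have qle: "(\<Sum>m. q m) \<le> e\<^sup>2"
      unfolding q_def suminf_diff[OF sg sr, symmetric] using d0(2)[of r] rs by (simp add: d_def)
    \<comment> \<open>Weighted arithmetic-geometric inequality; the weights are balanced so that the
      bounds 1 and \<open>e\<^sup>2\<close> of the two sums each contribute
      \<open>e / 2\<close>.\<close>
    have bq: "norm (b m) \<le> e / 2 * (norm (coef f m))\<^sup>2 + 1 / (2 * e) * q m" for m
    proof -
      have rm: "0 \<le> r ^ m" "r ^ m \<le> s ^ m" "s ^ m \<le> 1"
        using r s rs by (auto intro: power_mono power_le_one)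
      have "b m = coef f m * \<gamma> m * of_real (s ^ m - r ^ m)" by (simp add: b_def algebra_simps)
      hence nb: "norm (b m) = norm (coef f m) * (norm (\<gamma> m) * (s ^ m - r ^ m))"
        using rm by (simp add: norm_mult del: of_real_diff of_real_power)
      have "(norm (\<gamma> m) * (s ^ m - r ^ m))\<^sup>2 \<le> q m"
      proof -
        have "(s ^ m - r ^ m)\<^sup>2 \<le> (1 - r ^ m) * 1"
          unfolding power2_eq_square using rm by (intro mult_mono) auto
        hence "(norm (\<gamma> m))\<^sup>2 * (s ^ m - r ^ m)\<^sup>2 \<le> (norm (\<gamma> m))\<^sup>2 * (1 - r ^ m)"
          by (intro mult_left_mono) auto
        thus ?thesis unfolding q_def power_mult_distrib by (simp add: right_diff_distrib)
      qed
      hence "1 / (2 * e) * (norm (\<gamma> m) * (s ^ m - r ^ m))\<^sup>2 \<le> 1 / (2 * e) * q m"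
        using e by (intro mult_left_mono) auto
      moreover have "x * y \<le> e / 2 * x\<^sup>2 + 1 / (2 * e) * y\<^sup>2" for x y :: real
      proof -
        have "0 \<le> (e * x - y)\<^sup>2 / (2 * e)" using e by simp
        also have "\<dots> = e / 2 * x\<^sup>2 + 1 / (2 * e) * y\<^sup>2 - x * y"
          using e by (simp add: field_simps power2_eq_square)
        finally show ?thesis by simp
      qed
      ultimately show ?thesis unfolding nb using order_trans by (smt (verit))
    qed
    have smaj: "summable (\<lambda>m. e / 2 * (norm (coef f m))\<^sup>2 + 1 / (2 * e) * q m)"
      by (intro summable_add summable_mult sf sq)
    have snb: "summable (\<lambda>m. norm (b m))"
      by (rule summable_comparison_test'[OF smaj, where N = 0]) (use bq in auto)
    have "norm (\<Sum>m. b m) \<le> (\<Sum>m. norm (b m))" by (rule summable_norm[OF snb])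
    also have "\<dots> \<le> (\<Sum>m. e / 2 * (norm (coef f m))\<^sup>2 + 1 / (2 * e) * q m)"
      by (rule suminf_le[OF bq snb smaj])
    also have "\<dots> = e / 2 * (\<Sum>m. (norm (coef f m))\<^sup>2) + 1 / (2 * e) * (\<Sum>m. q m)"
      using suminf_add[OF summable_mult[OF sf, of "e/2"] summable_mult[OF sq, of "1/(2*e)"]]
        suminf_mult[OF sf, of "e/2"] suminf_mult[OF sq, of "1/(2*e)"] by simp
    also have "\<dots> \<le> e / 2 * 1 + 1 / (2 * e) * e\<^sup>2"
      using sf1 qle e by (intro add_mono mult_left_mono) auto
    also have "\<dots> = e" using e by (simp add: field_simps power2_eq_square)
    finally show "norm (circle_integral f g s - circle_integral f g r) \<le> e"
      using sums_unique[OF bs] by simp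
  qed
qed

lemma truncation_approx_L1:
  fixes g :: "real \<Rightarrow> complex"
  assumes g: "g absolutely_integrable_on S" and S: "S \<in> sets lebesgue" and e: "e > 0"
  obtains h K where "h absolutely_integrable_on S" "\<And>t. norm (h t) \<le> K"
    "integral S (\<lambda>t. norm (g t - h t)) \<le> e"
proof -
  \<comment> \<open>Radial truncation: \<open>g t\<close> is unchanged while its modulus is at most
    \<open>Suc k\<close> and is rescaled to modulus \<open>Suc k\<close> otherwise. With
    \<open>Suc k\<close> in place of \<open>k\<close> the quotient never becomes
    \<open>0 / 0\<close>.\<close>
  define c where "c k t = of_real (real (Suc k) / max (real (Suc k)) (norm (g t))) * g t" for k t
  have gm: "g \<in> borel_measurable (lebesgue_on S)"
    using absolutely_integrable_measurable[OF S] g by blast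
  have m: "(\<lambda>t. complex_of_real (real (Suc k) / max (real (Suc k)) (norm (g t)))) \<in> borel_measurable (lebesgue_on S)" for k
    using gm by measurable
  have w: "0 \<le> real (Suc k) / max (real (Suc k)) x" "real (Suc k) / max (real (Suc k)) x \<le> 1" for k x
    by (auto simp: divide_simps)
  have ac: "c k absolutely_integrable_on S" for k
    unfolding c_def
  proof (rule absolutely_integrable_bounded_measurable_product[OF bilinear_times m S _ g])
    show "bounded ((\<lambda>t. complex_of_real (real (Suc k) / max (real (Suc k)) (norm (g t)))) ` S)"
      unfolding bounded_iff by (intro exI[of _ 1]) (use w in \<open>auto simp del: of_nat_Suc of_real_divide\<close>)
  qed
  have bd: "norm (c k t) \<le> real (Suc k)" for k t
  proof -
    have "norm (c k t) = real (Suc k) / max (real (Suc k)) (norm (g t)) * norm (g t)"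
      using w(1)[of k "norm (g t)"] by (simp add: c_def norm_mult del: of_nat_Suc of_real_divide)
    also have "\<dots> \<le> real (Suc k)" by (auto simp: divide_simps max_def simp del: of_nat_Suc)
    finally show ?thesis .
  qed
  have dif: "norm (g t - c k t) \<le> norm (g t)" for k t
  proof -
    have "g t - c k t = of_real (1 - real (Suc k) / max (real (Suc k)) (norm (g t))) * g t"
      by (simp add: c_def algebra_simps)
    hence "norm (g t - c k t) = (1 - real (Suc k) / max (real (Suc k)) (norm (g t))) * norm (g t)"
      using w(2)[of k "norm (g t)"] by (simp add: norm_mult del: of_real_diff of_nat_Suc of_real_divide)
    also have "\<dots> \<le> 1 * norm (g t)" using w(1)[of k "norm (g t)"] by (intro mult_right_mono) auto
    finally show ?thesis by simp
  qed
  have "(\<lambda>k. integral S (\<lambda>t. norm (g t - c k t))) \<longlonglongrightarrow> integral S (\<lambda>t. 0)"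
  proof (rule dominated_convergence(2)[where h = "\<lambda>t. norm (g t)"])
    show "(\<lambda>t. norm (g t - c k t)) integrable_on S" for k
      using set_integral_diff(1)[OF g ac[of k]] by (simp add: absolutely_integrable_on_def)
    show "(\<lambda>t. norm (g t)) integrable_on S" using g by (simp add: absolutely_integrable_on_def)
    fix t
    obtain k0 where k0: "norm (g t) \<le> real k0" using real_arch_simple by blast
    have "eventually (\<lambda>k. norm (g t - c k t) = 0) sequentially"
      using eventually_ge_at_top[of k0]
    proof eventually_elim
      case (elim k)
      hence "norm (g t) \<le> real (Suc k)" using k0 by simp
      hence "max (real (Suc k)) (norm (g t)) = real (Suc k)" by (simp only: max_absorb1)
      thus ?case unfolding c_def by (simp only:) simp
    qed
    thus "(\<lambda>k. norm (g t - c k t)) \<longlonglongrightarrow> 0" by (rule tendsto_eventually)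
  qed (use dif in auto)
  hence "eventually (\<lambda>k. integral S (\<lambda>t. norm (g t - c k t)) < e) sequentially"
    using e by (intro order_tendstoD) auto
  then obtain k where "integral S (\<lambda>t. norm (g t - c k t)) < e"
    unfolding eventually_sequentially by auto
  with ac[of k] bd[of k] that show ?thesis by force
qed

lemma unif_radialE:
  assumes "unif_radial g" "e > 0"
  obtains d where "0 \<le> d" "d < 1"
    "\<And>f r s. f holomorphic_on ball 0 1 \<Longrightarrow> (\<And>z. norm z < 1 \<Longrightarrow> norm (f z) \<le> 1) \<Longrightarrow>
      d < r \<Longrightarrow> r \<le> s \<Longrightarrow> s < 1 \<Longrightarrow>
      norm (circle_integral f g s - circle_integral f g r) \<le> e"
  using assms(1)[unfolded unif_radial_def, rule_format, OF assms(2)]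
proof (elim exE conjE)
  fix d :: real
  assume d: "0 \<le> d" "d < 1" and D: "\<forall>f r s. f holomorphic_on ball 0 1 \<longrightarrow> (\<forall>z. norm z < 1 \<longrightarrow> norm (f z) \<le> 1) \<longrightarrow>
      d < r \<and> r \<le> s \<and> s < 1 \<longrightarrow>
      norm (circle_integral f g s - circle_integral f g r) \<le> e"
  show thesis
  proof (rule that[OF d])
    fix f r s assume "f holomorphic_on ball 0 1" "\<And>z. norm z < 1 \<Longrightarrow> norm (f z) \<le> 1" "d < r" "r \<le> s" "s < 1"
    thus "norm (circle_integral f g s - circle_integral f g r) \<le> e"
      using D[rule_format, of f r s] by simp
  qed
qed

text \<open>Replacing \<open>g\<close> by a bounded truncation at \<open>L\<^sup>1\<close> distance
  \<open>e / 3\<close> changes each circle integral by at most \<open>e / 3\<close>, because the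
  test functions are bounded by 1. The bounded case supplies the remaining third.\<close>

lemma unif_radial_absolutely_integrable:
  fixes g :: "real \<Rightarrow> complex"
  assumes g: "g absolutely_integrable_on {0..2*pi}"
  shows "unif_radial g"
  unfolding unif_radial_def
proof (intro allI impI)
  fix e :: real assume e: "e > 0"
  obtain h K where h: "h absolutely_integrable_on {0..2*pi}" "\<And>t. norm (h t) \<le> K"
    "integral {0..2*pi} (\<lambda>t. norm (g t - h t)) \<le> e / 3"
    using truncation_approx_L1[OF g _, of "e/3"] e by auto
  have "unif_radial h" by (rule unif_radial_bounded[OF h(1,2)])
  then obtain d where d: "0 \<le> d" "d < 1"
    "\<And>f r s. f holomorphic_on ball 0 1 \<Longrightarrow> (\<And>z. norm z < 1 \<Longrightarrow> norm (f z) \<le> 1) \<Longrightarrow>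
      d < r \<Longrightarrow> r \<le> s \<Longrightarrow> s < 1 \<Longrightarrow>
      norm (circle_integral f h s - circle_integral f h r) \<le> e / 3"
    by (rule unif_radialE[of h "e/3"]) (use e in auto)
  have gh: "(\<lambda>t. g t - h t) absolutely_integrable_on {0..2*pi}" by (rule set_integral_diff(1)[OF g h(1)])
  show "\<exists>d\<ge>0. d < 1 \<and> (\<forall>f r s. f holomorphic_on ball 0 1 \<longrightarrow> (\<forall>z. norm z < 1 \<longrightarrow> norm (f z) \<le> 1) \<longrightarrow>
      d < r \<and> r \<le> s \<and> s < 1 \<longrightarrow>
      norm (circle_integral f g s - circle_integral f g r) \<le> e)"
  proof (intro exI[of _ d] conjI allI impI d(1,2))
    fix f r s assume f: "f holomorphic_on ball 0 1" and f1: "\<forall>z. norm z < 1 \<longrightarrow> norm (f z) \<le> 1"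
      and rs: "d < r \<and> r \<le> s \<and> s < 1"
    have D: "norm (circle_integral f g u - circle_integral f h u) \<le> e / 3"
      if u: "0 \<le> u" "u < 1" for u
    proof -
      have "(\<lambda>t. f (of_real u * cis t) * k t) integrable_on {0..2*pi}" if "k absolutely_integrable_on {0..2*pi}" for k
        by (rule set_lebesgue_integral_eq_integral(1),
            rule absolutely_integrable_continuous_mult[OF continuous_on_circle[OF f u] that])
      hence "circle_integral f g u - circle_integral f h u
          = integral {0..2*pi} (\<lambda>t. f (of_real u * cis t) * (g t - h t))"
        using g h(1) by (simp add: right_diff_distrib integral_diff)
      also have "norm \<dots> \<le> 1 * integral {0..2*pi} (\<lambda>t. norm (g t - h t))"
        using f1 by (intro circle_integral_norm_bound f u gh) auto
      finally show ?thesis using h(3) by simp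
    qed
    have r: "0 \<le> r" "r < 1" and s: "0 \<le> s" "s < 1" using rs d by auto
    have "norm (circle_integral f h s - circle_integral f h r) \<le> e / 3"
      using rs f1 by (intro d(3) f) auto
    with D[OF r] D[OF s]
    show "norm (circle_integral f g s - circle_integral f g r) \<le> e"
      by norm
  qed
qed

text \<open>One circle computes the pairing up to \<open>e\<close> for all functions bounded by
  \<open>C\<close>. The proof also shows that the radial limit defining \<open>wstar_pair\<close>
  exists; scaling by \<open>C\<close> reduces the estimate to the unit ball.\<close>

lemma wstar_pair_uniform:
  fixes g :: "real \<Rightarrow> complex"
  assumes g: "g absolutely_integrable_on {0..2*pi}" and e: "e > 0" and C: "C > 0"
  obtains r where "0 \<le> r" "r < 1"
    "\<And>f. f holomorphic_on ball 0 1 \<Longrightarrow> (\<And>z. norm z < 1 \<Longrightarrow> norm (f z) \<le> C) \<Longrightarrow>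
      norm (wstar_pair g f - circle_integral f g r) \<le> e"
proof -
  define F where "F f r = circle_integral f g r" for f :: "complex \<Rightarrow> complex" and r :: real
  have ex: "\<exists>d\<ge>0. d < 1 \<and> (\<forall>f r s. f holomorphic_on ball 0 1 \<longrightarrow> (\<forall>z. norm z < 1 \<longrightarrow> norm (f z) \<le> C) \<longrightarrow>
      d < r \<and> r \<le> s \<and> s < 1 \<longrightarrow> norm (F f s - F f r) \<le> e)" if e: "e > 0" for e
  proof -
    have "e / C > 0" using e C by simp
    from unif_radial_absolutely_integrable[OF g, unfolded unif_radial_def, rule_format, OF this]
    obtain d where d: "0 \<le> d" "d < 1" and D: "\<forall>f r s. f holomorphic_on ball 0 1 \<longrightarrow> (\<forall>z. norm z < 1 \<longrightarrow> norm (f z) \<le> 1) \<longrightarrow>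
      d < r \<and> r \<le> s \<and> s < 1 \<longrightarrow>
      norm (circle_integral f g s - circle_integral f g r) \<le> e / C"
      by (elim exE conjE) (rule that)
    show ?thesis
    proof (intro exI[of _ d] conjI allI impI d(1,2))
      fix f r s assume f: "f holomorphic_on ball 0 1" and f1: "\<forall>z. norm z < 1 \<longrightarrow> norm (f z) \<le> C"
        and rs: "d < r \<and> r \<le> s \<and> s < 1"
      have Fc: "F (\<lambda>z. f z / of_real C) u = F f u / of_real C" for u
        unfolding F_def by simp
      have "norm (F (\<lambda>z. f z / of_real C) s - F (\<lambda>z. f z / of_real C) r) \<le> e / C"
        unfolding F_def by (rule D[rule_format, of "\<lambda>z. f z / of_real C"])
          (use C f1 rs in \<open>auto simp: norm_divide intro!: holomorphic_intros f\<close>)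
      thus "norm (F f s - F f r) \<le> e"
        using C by (simp add: Fc norm_divide divide_simps flip: diff_divide_distrib)
    qed
  qed
  have lim: "((\<lambda>r. F f r) \<longlongrightarrow> wstar_pair g f) (at_left 1)"
    if f: "f holomorphic_on ball 0 1" "\<And>z. norm z < 1 \<Longrightarrow> norm (f z) \<le> C" for f
  proof -
    have exf: "\<exists>d\<ge>0. d < 1 \<and> (\<forall>r s. d < r \<longrightarrow> r \<le> s \<longrightarrow> s < 1 \<longrightarrow> norm (F f s - F f r) \<le> e)" if "e > 0" for e
      using ex[OF that]
    proof (elim exE conjE)
      fix d assume "0 \<le> d" "d < 1" and D: "\<forall>f r s. f holomorphic_on ball 0 1 \<longrightarrow> (\<forall>z. norm z < 1 \<longrightarrow> norm (f z) \<le> C) \<longrightarrow>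
        d < r \<and> r \<le> s \<and> s < 1 \<longrightarrow> norm (F f s - F f r) \<le> e"
      thus ?thesis using D[rule_format, of f] f by (intro exI[of _ d]) simp
    qed
    \<comment> \<open>Completeness is applied along one sequence of radii tending to 1; the Cauchy
      estimate then upgrades this to the full limit from the left.\<close>
    define \<rho> where "\<rho> n = 1 + - inverse (real (Suc n))" for n
    have \<rho>: "0 \<le> \<rho> n" "\<rho> n < 1" for n by (auto simp: \<rho>_def field_simps)
    have \<rho>1: "\<rho> \<longlonglongrightarrow> 1"
      unfolding \<rho>_def by (rule LIMSEQ_inverse_real_of_nat_add_minus)
    have "Cauchy (\<lambda>n. F f (\<rho> n))"
    proof (rule metric_CauchyI)
      fix e :: real assume "e > 0"
      then obtain d where d: "0 \<le> d" "d < 1" "\<And>r s. d < r \<Longrightarrow> r \<le> s \<Longrightarrow> s < 1 \<Longrightarrow> norm (F f s - F f r) \<le> e / 2"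
        using exf[OF half_gt_zero] by meson
      from order_tendstoD(1)[OF \<rho>1 d(2)] obtain N where N: "\<And>n. n \<ge> N \<Longrightarrow> d < \<rho> n"
        unfolding eventually_sequentially by auto
      show "\<exists>M. \<forall>m\<ge>M. \<forall>n\<ge>M. dist (F f (\<rho> m)) (F f (\<rho> n)) < e"
      proof (intro exI[of _ N] allI impI)
        fix m n assume "N \<le> m" "N \<le> n"
        hence "norm (F f (\<rho> m) - F f (\<rho> n)) \<le> e / 2"
          using d(3)[of "\<rho> m" "\<rho> n"] d(3)[of "\<rho> n" "\<rho> m"] N \<rho> by (cases "\<rho> m \<le> \<rho> n") (auto simp: norm_minus_commute)
        thus "dist (F f (\<rho> m)) (F f (\<rho> n)) < e" using \<open>e > 0\<close> by (simp add: dist_norm)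
      qed
    qed
    then obtain L where L: "(\<lambda>n. F f (\<rho> n)) \<longlonglongrightarrow> L" using Cauchy_convergent_iff convergent_def by blast
    have "((\<lambda>r. F f r) \<longlongrightarrow> L) (at_left 1)"
    proof (rule tendstoI)
      fix e :: real assume "e > 0"
      then obtain d where d: "0 \<le> d" "d < 1" "\<And>r s. d < r \<Longrightarrow> r \<le> s \<Longrightarrow> s < 1 \<Longrightarrow> norm (F f s - F f r) \<le> e / 2"
        using exf[OF half_gt_zero] by meson
      show "eventually (\<lambda>r. dist (F f r) L < e) (at_left 1)"
        unfolding eventually_at_left_field
      proof (intro exI[of _ d] conjI allI impI d(2))
        fix r assume r: "d < r" "r < 1"
        have "norm (L - F f r) \<le> e / 2"
        proof (rule tendsto_upperbound)
          show "(\<lambda>n. norm (F f (\<rho> n) - F f r)) \<longlonglongrightarrow> norm (L - F f r)" by (intro tendsto_intros L)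
          show "eventually (\<lambda>n. norm (F f (\<rho> n) - F f r) \<le> e / 2) sequentially"
            using order_tendstoD(1)[OF \<rho>1 r(2)]
            by eventually_elim (use r \<rho> d(3) in auto)
        qed simp
        thus "dist (F f r) L < e" using \<open>e > 0\<close> by (simp add: dist_norm norm_minus_commute)
      qed
    qed
    moreover from this have "wstar_pair g f = L" unfolding wstar_pair_def F_def by (intro tendsto_Lim) auto
    ultimately show ?thesis by simp
  qed
  obtain d where d: "0 \<le> d" "d < 1" "\<And>f r s. f holomorphic_on ball 0 1 \<Longrightarrow> (\<And>z. norm z < 1 \<Longrightarrow> norm (f z) \<le> C) \<Longrightarrow>
      d < r \<Longrightarrow> r \<le> s \<Longrightarrow> s < 1 \<Longrightarrow> norm (F f s - F f r) \<le> e"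
    using ex[OF e] by meson
  define r where "r = (1 + d) / 2"
  have r: "d < r" "r < 1" using d by (auto simp: r_def)
  show ?thesis
  proof (rule that[of r])
    fix f assume f: "f holomorphic_on ball 0 1" "\<And>z. norm z < 1 \<Longrightarrow> norm (f z) \<le> C"
    have "norm (wstar_pair g f - F f r) \<le> e"
    proof (rule tendsto_upperbound)
      show "((\<lambda>s. norm (F f s - F f r)) \<longlongrightarrow> norm (wstar_pair g f - F f r)) (at_left 1)"
        by (intro tendsto_intros lim f)
      show "eventually (\<lambda>s. norm (F f s - F f r) \<le> e) (at_left 1)"
        unfolding eventually_at_left_field
        by (intro exI[of _ r]) (use r d(3)[OF f] in auto)
    qed simp
    thus "norm (wstar_pair g f - circle_integral f g r) \<le> e"
      by (simp add: F_def)
  qed (use r d in auto)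
qed

text \<open>A single radius serves the limit and all members of the sequence. On that circle
  dominated convergence applies, with the weight \<open>g\<close> times the common bound as
  majorant.\<close>

lemma wstar_pair_bp_continuous:
  fixes g :: "real \<Rightarrow> complex"
  assumes g: "g absolutely_integrable_on {0..2*pi}"
    and fk: "\<And>k. fk k holomorphic_on ball 0 1" "\<And>k z. norm z < 1 \<Longrightarrow> norm (fk k z) \<le> C"
    and f: "f holomorphic_on ball 0 1"
    and lim: "\<And>z. norm z < 1 \<Longrightarrow> (\<lambda>k. fk k z) \<longlonglongrightarrow> f z"
  shows "(\<lambda>k. wstar_pair g (fk k)) \<longlonglongrightarrow> wstar_pair g f"
proof (rule LIMSEQ_I)
  fix e :: real assume e: "e > 0"
  define C' where "C' = max C 1"
  have C': "C' > 0" "\<And>k z. norm z < 1 \<Longrightarrow> norm (fk k z) \<le> C'" using fk(2) by (auto simp: C'_def le_max_iff_disj)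
  have fC: "norm (f z) \<le> C'" if "norm z < 1" for z
    by (rule tendsto_upperbound[OF tendsto_norm[OF lim[OF that]]]) (use C' that in auto)
  obtain r where r: "0 \<le> r" "r < 1" "\<And>f. f holomorphic_on ball 0 1 \<Longrightarrow> (\<And>z. norm z < 1 \<Longrightarrow> norm (f z) \<le> C') \<Longrightarrow>
      norm (wstar_pair g f - circle_integral f g r) \<le> e / 3"
    using wstar_pair_uniform[OF g, of "e/3" C'] e C' by auto
  have "(\<lambda>k. circle_integral (fk k) g r) \<longlonglongrightarrow> circle_integral f g r"
  proof (rule dominated_convergence(2)[where h = "\<lambda>t. C' * norm (g t)"])
    show "(\<lambda>t. fk k (of_real r * cis t) * g t) integrable_on {0..2*pi}" for k
      by (rule set_lebesgue_integral_eq_integral(1),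
          rule absolutely_integrable_continuous_mult[OF continuous_on_circle[OF fk(1) r(1,2)] g])
    show "(\<lambda>t. C' * norm (g t)) integrable_on {0..2*pi}"
      by (rule integrable_on_mult_right) (use g in \<open>simp add: absolutely_integrable_on_def\<close>)
    show "norm (fk k (of_real r * cis t) * g t) \<le> C' * norm (g t)" for k t
      unfolding norm_mult using r by (intro mult_right_mono C') (auto simp: norm_mult)
    show "(\<lambda>k. fk k (of_real r * cis t) * g t) \<longlonglongrightarrow> f (of_real r * cis t) * g t" for t
      using r by (intro tendsto_intros lim) (auto simp: norm_mult)
  qed
  from LIMSEQ_D[OF this, of "e/3"] e
  obtain N where N: "\<And>k. k \<ge> N \<Longrightarrow> norm (circle_integral (fk k) g r - circle_integral f g r) < e / 3"
    by auto
  show "\<exists>no. \<forall>k\<ge>no. norm (wstar_pair g (fk k) - wstar_pair g f) < e"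
  proof (intro exI[of _ N] allI impI)
    fix k assume "N \<le> k"
    from N[OF this] r(3)[OF fk(1) C'(2), of k] r(3)[OF f fC]
    show "norm (wstar_pair g (fk k) - wstar_pair g f) < e" by norm
  qed
qed

text \<open>The sequential form in which weak* closedness of \<open>M\<close> enters. Unlike weak*
  closedness it passes to \<open>N\<close> at once, since multiplication by powers of
  \<open>B\<close> preserves bounded pointwise convergence.\<close>

definition bp_closed :: "(complex \<Rightarrow> complex) set \<Rightarrow> bool" where
  "bp_closed M \<longleftrightarrow> (\<forall>fk f C. (\<forall>k. fk k \<in> M) \<and> (\<forall>k z. norm z < 1 \<longrightarrow> norm (fk k z) \<le> C) \<and> f \<in> hinf \<and>
      (\<forall>z. norm z < 1 \<longrightarrow> (\<lambda>k. fk k z) \<longlonglongrightarrow> f z) \<longrightarrow> f \<in> M)"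

lemma bp_closedD:
  assumes "bp_closed M" "\<And>k. fk k \<in> M" "\<And>k z. norm z < 1 \<Longrightarrow> norm (fk k z) \<le> C" "f \<in> hinf"
    "\<And>z. norm z < 1 \<Longrightarrow> (\<lambda>k. fk k z) \<longlonglongrightarrow> f z"
  shows "f \<in> M"
  using assms unfolding bp_closed_def by blast

lemma hinf_iff: "f \<in> hinf \<longleftrightarrow> hb f \<and> (\<forall>z. norm z \<ge> 1 \<longrightarrow> f z = 0)"
  by (auto simp: hinf_def hb_def)

text \<open>A limit outside \<open>M\<close> has a basic neighbourhood disjoint from
  \<open>M\<close>, given by finitely many weights. Continuity of each pairing puts a member of the
  sequence into it.\<close>

lemma wstar_closed_imp_bp_closed:
  assumes M: "wstar_closed M"
  shows "bp_closed M"
  unfolding bp_closed_def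
proof (intro allI impI, elim conjE)
  fix fk f C
  assume fk: "\<forall>k. fk k \<in> M" and C: "\<forall>k z. norm z < 1 \<longrightarrow> norm (fk k z) \<le> C" and f: "f \<in> hinf"
    and lim: "\<forall>z. norm z < 1 \<longrightarrow> (\<lambda>k. fk k z) \<longlonglongrightarrow> f z"
  have sub: "M \<subseteq> hinf" using M by (simp add: wstar_closed_def)
  show "f \<in> M"
  proof (rule ccontr)
    assume "f \<notin> M"
    then obtain G e where G: "finite G" "\<forall>g\<in>G. g absolutely_integrable_on {0..2*pi}" "e > 0"
      "\<forall>h \<in> hinf. (\<forall>g\<in>G. cmod (wstar_pair g h - wstar_pair g f) < e) \<longrightarrow> h \<notin> M"
      using M f unfolding wstar_closed_def by blast
    have "eventually (\<lambda>k. \<forall>g\<in>G. cmod (wstar_pair g (fk k) - wstar_pair g f) < e) sequentially"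
    proof (rule eventually_ball_finite[OF G(1)], rule ballI)
      fix g assume "g \<in> G"
      hence "(\<lambda>k. wstar_pair g (fk k)) \<longlonglongrightarrow> wstar_pair g f"
        using G fk sub C f lim by (intro wstar_pair_bp_continuous[where C = C]) (auto simp: hinf_def)
      from tendstoD[OF this G(3)] show "eventually (\<lambda>k. cmod (wstar_pair g (fk k) - wstar_pair g f) < e) sequentially"
        by (simp add: dist_norm)
    qed
    then obtain k where "\<forall>g\<in>G. cmod (wstar_pair g (fk k) - wstar_pair g f) < e"
      unfolding eventually_sequentially by auto
    thus False using G(4) fk sub by blast
  qed
qed

section \<open>Multiplication by a finite Blaschke product\<close>

lemma one_minus_moebius_sq:
  assumes "norm a < 1" "norm (z::complex) < 1"
  shows "1 - cnj a * z \<noteq> 0"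
    "1 - (norm ((z - a) / (1 - cnj a * z)))\<^sup>2 = (1 - (norm a)\<^sup>2) * (1 - (norm z)\<^sup>2) / (norm (1 - cnj a * z))\<^sup>2"
proof -
  have "norm (cnj a * z) < 1 * 1"
    unfolding norm_mult using assms by (intro mult_strict_mono') auto
  thus ne: "1 - cnj a * z \<noteq> 0" by auto
  have "complex_of_real ((norm (1 - cnj a * z))\<^sup>2 - (norm (z - a))\<^sup>2) = of_real ((1 - (norm a)\<^sup>2) * (1 - (norm z)\<^sup>2))"
    unfolding of_real_diff of_real_mult complex_norm_square of_real_1
    by (simp add: algebra_simps)
  hence "(norm (1 - cnj a * z))\<^sup>2 - (norm (z - a))\<^sup>2 = (1 - (norm a)\<^sup>2) * (1 - (norm z)\<^sup>2)"
    by (simp only: of_real_eq_iff)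
  thus "1 - (norm ((z - a) / (1 - cnj a * z)))\<^sup>2 = (1 - (norm a)\<^sup>2) * (1 - (norm z)\<^sup>2) / (norm (1 - cnj a * z))\<^sup>2"
    using ne by (simp add: norm_divide power_divide field_simps)
qed

lemma one_minus_prod_le_sum:
  fixes x :: "nat \<Rightarrow> real"
  assumes "\<And>i. i < n \<Longrightarrow> 0 \<le> x i \<and> x i \<le> 1"
  shows "1 - (\<Prod>i<n. x i) \<le> (\<Sum>i<n. 1 - x i)"
  using assms
proof (induction n)
  case (Suc n)
  have p: "0 \<le> (\<Prod>i<n. x i)" "(\<Prod>i<n. x i) \<le> 1"
    using Suc.prems by (auto intro!: prod_nonneg prod_le_1)
  have "(1 - (\<Prod>i<n. x i)) * (1 - x n) \<ge> 0" using p Suc.prems[of n] by simp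
  hence "1 - (\<Prod>i<Suc n. x i) \<le> (1 - (\<Prod>i<n. x i)) + (1 - x n)" by (simp add: algebra_simps)
  also have "\<dots> \<le> (\<Sum>i<Suc n. 1 - x i)" using Suc by simp
  finally show ?case .
qed simp

locale finite_blaschke =
  fixes n :: nat and a :: "nat \<Rightarrow> complex"
  assumes n_pos: "n \<ge> 1" and a_disc: "\<forall>i<n. a i \<in> ball 0 1" and a0: "a 0 = 0"
begin

abbreviation "B \<equiv> blaschke n a"

lemma a_lt: "i < n \<Longrightarrow> norm (a i) < 1"
  using a_disc by auto

lemma B_off: "norm z \<ge> 1 \<Longrightarrow> B z = 0"
  by (simp add: blaschke_def)

lemma B_eq: "norm z < 1 \<Longrightarrow> B z = (\<Prod>i<n. (z - a i) / (1 - cnj (a i) * z))"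
  by (simp add: blaschke_def)

lemma B_hol: "B holomorphic_on ball 0 1"
proof -
  have "(\<lambda>z. \<Prod>i<n. (z - a i) / (1 - cnj (a i) * z)) holomorphic_on ball 0 1"
    using one_minus_moebius_sq(1)[OF a_lt] by (intro holomorphic_intros) auto
  thus ?thesis by (rule holomorphic_transform) (simp add: B_eq)
qed

lemma moebius_le: "i < n \<Longrightarrow> norm z < 1 \<Longrightarrow> norm ((z - a i) / (1 - cnj (a i) * z)) \<le> 1"
proof -
  assume i: "i < n" "norm z < 1"
  have "(norm (a i))\<^sup>2 \<le> 1" "(norm z)\<^sup>2 \<le> 1" using a_lt[OF i(1)] i(2) by (auto simp: power_le_one)
  hence "0 \<le> (1 - (norm (a i))\<^sup>2) * (1 - (norm z)\<^sup>2) / (norm (1 - cnj (a i) * z))\<^sup>2" by simp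
  hence "(norm ((z - a i) / (1 - cnj (a i) * z)))\<^sup>2 \<le> 1\<^sup>2"
    using one_minus_moebius_sq(2)[OF a_lt[OF i(1)] i(2)] by simp
  thus ?thesis by (rule power2_le_imp_le) simp
qed

lemma B_le_norm: "norm z < 1 \<Longrightarrow> norm (B z) \<le> norm z"
proof -
  assume z: "norm z < 1"
  \<comment> \<open>Because \<open>a 0 = 0\<close>, one of the factors is \<open>z\<close> itself;
    the remaining factors have modulus at most 1.\<close>
  have "{..<n} = insert 0 ({..<n} - {0})" using n_pos by auto
  hence "B z = z * (\<Prod>i\<in>{..<n} - {0}. (z - a i) / (1 - cnj (a i) * z))"
    unfolding B_eq[OF z] by (subst \<open>{..<n} = _\<close>, subst prod.insert) (auto simp: a0)
  moreover have "norm (\<Prod>i\<in>{..<n} - {0}. (z - a i) / (1 - cnj (a i) * z)) \<le> 1"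
    unfolding prod_norm[symmetric] by (intro prod_le_1) (use moebius_le[OF _ z] in auto)
  ultimately show ?thesis by (simp add: norm_mult mult_left_le)
qed

lemma B_lt_1: "norm z < 1 \<Longrightarrow> norm (B z) < 1"
  using B_le_norm[of z] by simp

lemma B_lt_1': "norm (B z) < 1"
  using B_lt_1[of z] B_off[of z] by (cases "norm z < 1") auto

lemma B_zero: "B 0 = 0"
  using B_le_norm[of 0] by simp

lemma hb_B [intro]: "hb B"
  by (rule hbI[OF B_hol, of 1]) (use B_lt_1 less_imp_le in blast)

text \<open>The Moebius identity is applied to each factor, and a product of numbers in the unit
  interval falls short of 1 by at most the sum of their defects. The sum on the right consists of
  pseudo-Poisson terms \<open>(1 - (norm (a i))\<^sup>2) * (norm k)\<^sup>2\<close> with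
  \<open>k\<close> the Szego kernel at \<open>a i\<close>. It is kept exact because its mean over
  circles tends to \<open>n\<close>.\<close>

lemma B_gap:
  assumes z: "norm z < 1"
  shows "1 - (norm (B z))\<^sup>2 \<le> (1 - (norm z)\<^sup>2) * (\<Sum>i<n. (1 - (norm (a i))\<^sup>2) / (norm (1 - cnj (a i) * z))\<^sup>2)"
proof -
  have "1 - (norm (B z))\<^sup>2 = 1 - (\<Prod>i<n. (norm ((z - a i) / (1 - cnj (a i) * z)))\<^sup>2)"
    unfolding B_eq[OF z] by (simp add: prod_norm[symmetric] prod_power_distrib)
  also have "\<dots> \<le> (\<Sum>i<n. 1 - (norm ((z - a i) / (1 - cnj (a i) * z)))\<^sup>2)"
    by (rule one_minus_prod_le_sum) (use moebius_le[OF _ z] in \<open>auto intro: power_le_one\<close>)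
  also have "\<dots> = (\<Sum>i<n. (1 - (norm (a i))\<^sup>2) * (1 - (norm z)\<^sup>2) / (norm (1 - cnj (a i) * z))\<^sup>2)"
    by (intro sum.cong refl one_minus_moebius_sq(2) a_lt z) auto
  finally show ?thesis by (simp add: sum_distrib_left mult_ac)
qed

text \<open>The sum in \<open>B_gap\<close> with every \<open>norm (1 - cnj (a i) * z)\<close>
  replaced by its lower bound \<open>1 - norm (a i)\<close>: a cruder factor, but independent of
  \<open>z\<close>.\<close>

definition "\<kappa> = (\<Sum>i<n. (1 - (norm (a i))\<^sup>2) / (1 - norm (a i))\<^sup>2)"

lemma B_gap_\<kappa>:
  assumes z: "norm z < 1"
  shows "1 - (norm (B z))\<^sup>2 \<le> \<kappa> * (1 - (norm z)\<^sup>2)"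
proof -
  have "(\<Sum>i<n. (1 - (norm (a i))\<^sup>2) / (norm (1 - cnj (a i) * z))\<^sup>2) \<le> \<kappa>"
    unfolding \<kappa>_def
  proof (intro sum_mono divide_left_mono)
    fix i assume "i \<in> {..<n}"
    hence ai: "norm (a i) < 1" using a_lt by simp
    show "0 \<le> 1 - (norm (a i))\<^sup>2" using ai by (simp add: power_le_one)
    have "norm (cnj (a i) * z) \<le> norm (a i) * 1"
      unfolding norm_mult using z by (intro mult_mono) auto
    hence "1 - norm (a i) \<le> norm (1 - cnj (a i) * z)"
      using norm_triangle_ineq2[of 1 "cnj (a i) * z"] by simp
    thus "(1 - norm (a i))\<^sup>2 \<le> (norm (1 - cnj (a i) * z))\<^sup>2" using ai by (intro power_mono) auto
    show "0 < (norm (1 - cnj (a i) * z))\<^sup>2 * (1 - norm (a i))\<^sup>2"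
      using one_minus_moebius_sq(1)[OF ai z] ai by simp
  qed
  moreover have "0 \<le> 1 - (norm z)\<^sup>2" using z by (simp add: power_le_one)
  ultimately have "(1 - (norm z)\<^sup>2) * (\<Sum>i<n. (1 - (norm (a i))\<^sup>2) / (norm (1 - cnj (a i) * z))\<^sup>2) \<le> (1 - (norm z)\<^sup>2) * \<kappa>"
    by (rule mult_left_mono)
  thus ?thesis using B_gap[OF z] by (simp only: mult.commute[of \<kappa>])
qed

lemma \<kappa>_ge_1: "\<kappa> \<ge> 1"
  using B_gap_\<kappa>[of 0] by (simp add: B_zero)

lemma h2_isometry:
  assumes f: "hb f" and g: "hb g"
  shows "h2_inner (\<lambda>z. B z * f z) (\<lambda>z. B z * g z) = h2_inner f g"
proof (rule h2_inner_eqI)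
  have Bf: "hb (\<lambda>z. B z * f z)" "hb (\<lambda>z. B z * g z)" using f g by auto
  obtain C D where CD: "C > 0" "\<And>z. norm z < 1 \<Longrightarrow> norm (f z) \<le> C" "D > 0" "\<And>z. norm z < 1 \<Longrightarrow> norm (g z) \<le> D"
    using hb_bound f g by metis
  have "((\<lambda>r. circle_mean r f g - circle_mean r (\<lambda>z. B z * f z) (\<lambda>z. B z * g z)) \<longlongrightarrow> 0) (at_left 1)"
  proof (rule Lim_null_comparison)
    have "((\<lambda>r::real. \<kappa> * (1 - r\<^sup>2) * (C * D)) \<longlongrightarrow> \<kappa> * (1 - 1\<^sup>2) * (C * D)) (at_left 1)"
      by (intro tendsto_intros)
    thus "((\<lambda>r::real. \<kappa> * (1 - r\<^sup>2) * (C * D)) \<longlongrightarrow> 0) (at_left 1)" by simp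
    show "\<forall>\<^sub>F r in at_left 1. norm (circle_mean r f g - circle_mean r (\<lambda>z. B z * f z) (\<lambda>z. B z * g z)) \<le> \<kappa> * (1 - r\<^sup>2) * (C * D)"
    proof (rule eventually_at_left_1I)
      fix r :: real assume r: "0 < r" "r < 1"
      let ?z = "\<lambda>t. of_real r * cis t"
      have i: "(\<lambda>t. f (?z t) * cnj (g (?z t))) integrable_on {0..2*pi}"
        "(\<lambda>t. (B (?z t) * f (?z t)) * cnj (B (?z t) * g (?z t))) integrable_on {0..2*pi}"
        using circle_mean_integrable[OF f g, of r] circle_mean_integrable[OF Bf, of r] r by auto
      have "norm (integral {0..2*pi} (\<lambda>t. f (?z t) * cnj (g (?z t)) - (B (?z t) * f (?z t)) * cnj (B (?z t) * g (?z t))))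
         \<le> integral {0..2*pi} (\<lambda>t. \<kappa> * (1 - r\<^sup>2) * (C * D))"
      proof (rule integral_norm_bound_integral)
        fix t
        have z: "norm (?z t) < 1" "norm (?z t) = r" using r by (auto simp: norm_mult)
        have "f (?z t) * cnj (g (?z t)) - (B (?z t) * f (?z t)) * cnj (B (?z t) * g (?z t))
           = (1 - B (?z t) * cnj (B (?z t))) * (f (?z t) * cnj (g (?z t)))" by (simp add: algebra_simps)
        also have "1 - B (?z t) * cnj (B (?z t)) = of_real (1 - (norm (B (?z t)))\<^sup>2)"
          by (simp add: complex_norm_square del: of_real_power)
        also have "norm (of_real (1 - (norm (B (?z t)))\<^sup>2) * (f (?z t) * cnj (g (?z t)))) =
            (1 - (norm (B (?z t)))\<^sup>2) * (norm (f (?z t)) * norm (g (?z t)))"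
          using B_lt_1'[of "?z t"] unfolding norm_mult norm_of_real complex_mod_cnj by (simp add: power_le_one)
        also have "\<dots> \<le> (\<kappa> * (1 - r\<^sup>2)) * (C * D)"
          using B_gap_\<kappa>[OF z(1)] CD z B_lt_1'[of "?z t"] \<kappa>_ge_1 r
          by (intro mult_mono) (auto simp: power_le_one)
        finally show "norm (f (?z t) * cnj (g (?z t)) - (B (?z t) * f (?z t)) * cnj (B (?z t) * g (?z t))) \<le> \<kappa> * (1 - r\<^sup>2) * (C * D)" .
      qed (intro integrable_diff i integrable_const_ivl)+
      also have "\<dots> = 2 * pi * (\<kappa> * (1 - r\<^sup>2) * (C * D))" by simp
      finally show "norm (circle_mean r f g - circle_mean r (\<lambda>z. B z * f z) (\<lambda>z. B z * g z)) \<le> \<kappa> * (1 - r\<^sup>2) * (C * D)"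
        unfolding circle_mean_def diff_divide_distrib[symmetric] integral_diff[OF i, symmetric]
        by (simp add: norm_divide norm_mult field_simps)
    qed
  qed
  from tendsto_diff[OF circle_mean_tendsto[OF f g] this]
  show "((\<lambda>r. circle_mean r (\<lambda>z. B z * f z) (\<lambda>z. B z * g z)) \<longlongrightarrow> h2_inner f g) (at_left 1)" by simp
qed

lemma h2_norm_B: "hb f \<Longrightarrow> h2_norm (\<lambda>z. B z * f z) = h2_norm f"
  unfolding h2_norm_def by (simp add: h2_isometry)

lemma h2_inner_B_power:
  "hb f \<Longrightarrow> hb g \<Longrightarrow> h2_inner (\<lambda>z. B z ^ m * f z) (\<lambda>z. B z ^ m * g z) = h2_inner f g"
proof (induction m)
  case (Suc m)
  have "h2_inner (\<lambda>z. B z * (B z ^ m * f z)) (\<lambda>z. B z * (B z ^ m * g z)) = h2_inner f g"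
    using Suc by (subst h2_isometry) (simp_all add: hb_intros hb_B)
  thus ?case by (simp add: mult.assoc)
qed simp

text \<open>Multiplication by \<open>1 / (1 - cnj w * B)\<close>, the reproducing kernel of \<open>H\<^sup>2\<close> at \<open>w\<close> composed with \<open>B\<close>.\<close>
definition ker :: "complex \<Rightarrow> (complex \<Rightarrow> complex) \<Rightarrow> complex \<Rightarrow> complex" where
  "ker w f z = f z / (1 - cnj w * B z)"

lemma ker_denom:
  assumes "norm w < 1" shows "1 - norm w \<le> norm (1 - cnj w * B z)" "1 - cnj w * B z \<noteq> 0"
proof -
  have "norm (cnj w * B z) \<le> norm w * 1"
    unfolding norm_mult complex_mod_cnj using B_lt_1'[of z] by (intro mult_left_mono) auto
  thus "1 - norm w \<le> norm (1 - cnj w * B z)"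
    using norm_triangle_ineq2[of 1 "cnj w * B z"] by simp
  thus "1 - cnj w * B z \<noteq> 0" using assms by auto
qed

lemma hb_ker1: "norm w < 1 \<Longrightarrow> hb (\<lambda>z. 1 / (1 - cnj w * B z))"
proof -
  assume w: "norm w < 1"
  show ?thesis
  proof (rule hbI[where C = "1 / (1 - norm w)"])
    show "(\<lambda>z. 1 / (1 - cnj w * B z)) holomorphic_on ball 0 1"
      using ker_denom(2)[OF w] by (intro holomorphic_intros B_hol) auto
    fix z show "norm (1 / (1 - cnj w * B z)) \<le> 1 / (1 - norm w)"
      using ker_denom[OF w, of z] w by (auto simp: norm_divide intro!: divide_left_mono mult_pos_pos)
  qed
qed

lemma ker_eq_mult: "ker w f = (\<lambda>z. 1 / (1 - cnj w * B z) * f z)"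
  by (simp add: ker_def fun_eq_iff)

lemma hb_ker [intro]: "norm w < 1 \<Longrightarrow> hb f \<Longrightarrow> hb (ker w f)"
  unfolding ker_eq_mult by (intro hb_mult hb_ker1)

text \<open>Resolvent identity. It exhibits \<open>ker w f - f\<close> as \<open>B\<close> times a
  multiple of \<open>ker w f\<close>, and in this form both the isometry and orthogonality to
  multiples of \<open>B\<close> can be applied to kernels.\<close>

lemma ker_eq: "norm w < 1 \<Longrightarrow> ker w f z = f z + B z * (cnj w * ker w f z)"
  using ker_denom(2)[of w z] by (simp add: ker_def field_simps)

lemma ker_minus: "norm w < 1 \<Longrightarrow> ker w f z - f z = B z * (cnj w * ker w f z)"
  using ker_eq[of w f z] by (simp only: diff_eq_eq add.commute)

lemma h2_norm_ker_le: "norm w < 1 \<Longrightarrow> hb f \<Longrightarrow> h2_norm (ker w f) \<le> h2_norm f / (1 - norm w)"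
proof -
  assume w: "norm w < 1" and f: "hb f"
  have "h2_norm (ker w f) \<le> 1 / (1 - norm w) * h2_norm f"
    unfolding ker_eq_mult
  proof (rule h2_norm_mult_le[OF hb_ker1[OF w] f])
    fix z show "norm (1 / (1 - cnj w * B z)) \<le> 1 / (1 - norm w)"
      using ker_denom[OF w, of z] w by (auto simp: norm_divide intro!: divide_left_mono mult_pos_pos)
  qed (use w in auto)
  thus ?thesis by simp
qed

text \<open>By \<open>ker_minus\<close> both differences \<open>ker w f - f\<close> and
  \<open>ker w g - g\<close> are multiples of \<open>B\<close>, so the isometry evaluates their
  inner product as \<open>(norm w)\<^sup>2\<close> times that of the kernels. Expanding the
  differences gives the identity.\<close>

lemma ker_inner_ker:
  assumes w: "norm w < 1" and f: "hb f" and g: "hb g"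
  shows "of_real (1 - (norm w)\<^sup>2) * h2_inner (ker w f) (ker w g) = h2_inner f (ker w g) + h2_inner (ker w f) g - h2_inner f g"
proof -
  have k: "hb (ker w f)" "hb (ker w g)" "hb (\<lambda>z. cnj w * ker w f z)" "hb (\<lambda>z. cnj w * ker w g z)"
    "hb (\<lambda>z. B z * (cnj w * ker w f z))" "hb (\<lambda>z. B z * (cnj w * ker w g z))"
    using w f g by (auto intro!: hb_mult)
  have "h2_inner (\<lambda>z. ker w f z - f z) (\<lambda>z. ker w g z - g z) =
      h2_inner (\<lambda>z. B z * (cnj w * ker w f z)) (\<lambda>z. B z * (cnj w * ker w g z))"
    by (intro h2_inner_cong hb_diff f g k ker_minus w)
  also have "\<dots> = of_real ((norm w)\<^sup>2) * h2_inner (ker w f) (ker w g)"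
    unfolding h2_isometry[OF k(3,4)] h2_inner_scale_left[OF k(1,4)] h2_inner_scale_right[OF k(2,1)] complex_norm_square
    by (simp add: mult_ac)
  also have "h2_inner (\<lambda>z. ker w f z - f z) (\<lambda>z. ker w g z - g z) =
     h2_inner (ker w f) (ker w g) - h2_inner (ker w f) g - (h2_inner f (ker w g) - h2_inner f g)"
    using k f g by (simp add: h2_inner_diff_left h2_inner_diff_right hb_diff)
  finally show ?thesis by (simp add: algebra_simps)
qed

text \<open>The resolvent identity is iterated \<open>K\<close> times; by Cauchy-Schwarz and the
  isometry the remainder is at most a constant times \<open>norm w ^ K\<close>. The conjugate inside
  \<open>ker\<close> makes the series one in \<open>w\<close> itself, hence holomorphic.\<close>

lemma h2_inner_ker_sums:
  assumes w: "norm w < 1" and f: "hb f" and g: "hb g"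
  shows "(\<lambda>m. h2_inner f (\<lambda>z. B z ^ m * g z) * w ^ m) sums h2_inner f (ker w g)"
proof -
  have k: "hb (ker w g)" using w g by auto
  have eq: "h2_inner f (ker w g) = (\<Sum>m<K. h2_inner f (\<lambda>z. B z ^ m * g z) * w ^ m) + w ^ K * h2_inner f (\<lambda>z. B z ^ K * ker w g z)" for K
  proof (induction K)
    case (Suc K)
    have "h2_inner f (\<lambda>z. B z ^ K * ker w g z) = h2_inner f (\<lambda>z. B z ^ K * g z + cnj w * (B z ^ Suc K * ker w g z))"
      by (intro h2_inner_cong f hb_mult hb_power hb_B k refl) (subst ker_eq[OF w], simp add: algebra_simps)
    also have "\<dots> = h2_inner f (\<lambda>z. B z ^ K * g z) + w * h2_inner f (\<lambda>z. B z ^ Suc K * ker w g z)"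
      using f g k hb_mult[OF hb_power[OF hb_B, of "Suc K"] k]
      by (subst h2_inner_add_right) (simp_all add: hb_intros hb_B h2_inner_scale_right del: power_Suc)
    finally show ?case using Suc by (simp add: algebra_simps)
  qed simp
  have "(\<lambda>K. w ^ K * h2_inner f (\<lambda>z. B z ^ K * ker w g z)) \<longlonglongrightarrow> 0"
  proof (rule Lim_null_comparison)
    show "\<forall>\<^sub>F K in sequentially. norm (w ^ K * h2_inner f (\<lambda>z. B z ^ K * ker w g z)) \<le> norm w ^ K * (h2_norm f * h2_norm (ker w g))"
    proof (rule always_eventually, rule allI)
      fix K
      have "norm (h2_inner f (\<lambda>z. B z ^ K * ker w g z)) \<le> h2_norm f * h2_norm (\<lambda>z. B z ^ K * ker w g z)"
        by (intro h2_cauchy_schwarz f hb_mult hb_power hb_B k)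
      also have "h2_norm (\<lambda>z. B z ^ K * ker w g z) = h2_norm (ker w g)"
        unfolding h2_norm_def using h2_inner_B_power[OF k k] by simp
      finally show "norm (w ^ K * h2_inner f (\<lambda>z. B z ^ K * ker w g z)) \<le> norm w ^ K * (h2_norm f * h2_norm (ker w g))"
        unfolding norm_mult norm_power by (intro mult_left_mono) auto
    qed
    have "(\<lambda>K. norm w ^ K * (h2_norm f * h2_norm (ker w g))) \<longlonglongrightarrow> 0 * (h2_norm f * h2_norm (ker w g))"
      by (intro tendsto_intros LIMSEQ_realpow_zero) (use w in auto)
    thus "(\<lambda>K. norm w ^ K * (h2_norm f * h2_norm (ker w g))) \<longlonglongrightarrow> 0" by simp
  qed
  from tendsto_diff[OF tendsto_const[of "h2_inner f (ker w g)"] this]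
  have "(\<lambda>K. h2_inner f (ker w g) - w ^ K * h2_inner f (\<lambda>z. B z ^ K * ker w g z)) \<longlonglongrightarrow> h2_inner f (ker w g)" by simp
  moreover have "h2_inner f (ker w g) - w ^ K * h2_inner f (\<lambda>z. B z ^ K * ker w g z) = (\<Sum>m<K. h2_inner f (\<lambda>z. B z ^ m * g z) * w ^ m)" for K
    using eq[of K] by (simp add: diff_eq_eq)
  ultimately show ?thesis by (simp add: sums_def)
qed

lemma h2_inner_ker_holomorphic:
  assumes f: "hb f" and g: "hb g"
  shows "(\<lambda>w. h2_inner f (ker w g)) holomorphic_on ball 0 1"
  by (rule power_series_holomorphic[where a = "\<lambda>m. h2_inner f (\<lambda>z. B z ^ m * g z)"])
     (use h2_inner_ker_sums[OF _ f g] in auto)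

text \<open>The Herglotz transform of the measure \<open>\<bar>f\<bar>\<^sup>2 dt\<close> pushed forward by \<open>B\<close>.\<close>
definition herg :: "(complex \<Rightarrow> complex) \<Rightarrow> complex \<Rightarrow> complex" where
  "herg f w = 2 * h2_inner f (ker w f) - h2_inner f f"

lemma herg_holomorphic: "hb f \<Longrightarrow> herg f holomorphic_on ball 0 1"
  unfolding herg_def by (intro holomorphic_intros h2_inner_ker_holomorphic)

lemma Re_herg:
  assumes w: "norm w < 1" and f: "hb f"
  shows "Re (herg f w) = (1 - (norm w)\<^sup>2) * (h2_norm (ker w f))\<^sup>2"
proof -
  have k: "hb (ker w f)" using w f by auto
  have "of_real (1 - (norm w)\<^sup>2) * h2_inner (ker w f) (ker w f) = h2_inner f (ker w f) + cnj (h2_inner f (ker w f)) - h2_inner f f"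
    using ker_inner_ker[OF w f f] h2_inner_cnj[OF f k] by simp
  hence "of_real ((1 - (norm w)\<^sup>2) * (h2_norm (ker w f))\<^sup>2) = h2_inner f (ker w f) + cnj (h2_inner f (ker w f)) - h2_inner f f"
    by (simp only: h2_inner_self[OF k] of_real_mult)
  from arg_cong[OF this, of Re] show ?thesis by (simp add: herg_def)
qed

lemma Re_herg_nonneg: "norm w < 1 \<Longrightarrow> hb f \<Longrightarrow> 0 \<le> Re (herg f w)"
  by (simp add: Re_herg power_le_one)

text \<open>At \<open>w = B z\<close> the kernel divides \<open>f z\<close> by the real number
  \<open>1 - (norm w)\<^sup>2\<close>. Bounding the value of \<open>ker w f\<close> at
  \<open>z\<close> by its norm leaves the factor
  \<open>(1 - (norm w)\<^sup>2) / (1 - (norm z)\<^sup>2)\<close>, which is at most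
  \<open>\<kappa>\<close>.\<close>

lemma norm_sq_le_herg:
  assumes z: "norm z < 1" and f: "hb f"
  shows "(norm (f z))\<^sup>2 \<le> \<kappa> * Re (herg f (B z))"
proof -
  define w where "w = B z"
  have w: "norm w < 1" using B_lt_1' by (simp add: w_def)
  have p: "0 < 1 - (norm w)\<^sup>2" "0 < 1 - (norm z)\<^sup>2" using w z by (auto simp: power_less_one_iff)
  have "(norm (f z))\<^sup>2 = (1 - (norm w)\<^sup>2)\<^sup>2 * (norm (ker w f z))\<^sup>2"
  proof -
    have "1 - cnj w * B z = of_real (1 - (norm w)\<^sup>2)"
      by (simp add: w_def complex_norm_square mult.commute del: of_real_power)
    hence "f z = of_real (1 - (norm w)\<^sup>2) * ker w f z" using p unfolding ker_def by (simp del: of_real_diff)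
    hence "norm (f z) = (1 - (norm w)\<^sup>2) * norm (ker w f z)" using p by (simp add: norm_mult del: of_real_diff)
    thus ?thesis by (simp add: power_mult_distrib)
  qed
  also have "\<dots> \<le> (1 - (norm w)\<^sup>2)\<^sup>2 * ((h2_norm (ker w f))\<^sup>2 / (1 - (norm z)\<^sup>2))"
    by (intro mult_left_mono h2_eval_bound hb_ker w f z) auto
  also have "\<dots> = (1 - (norm w)\<^sup>2) / (1 - (norm z)\<^sup>2) * Re (herg f w)"
    by (simp add: Re_herg[OF w f] power2_eq_square)
  also have "\<dots> \<le> \<kappa> * Re (herg f w)"
    using B_gap_\<kappa>[OF z] p by (intro mult_right_mono Re_herg_nonneg w f) (auto simp: w_def divide_simps)
  finally show ?thesis by (simp add: w_def)
qed

end

section \<open>Shift-invariant subspaces\<close>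

text \<open>Point evaluations are uniformly bounded on smaller discs, so a norm-Cauchy sequence
  converges locally uniformly. The limit may be unbounded; convergence in norm is therefore asserted
  only under \<open>hb g\<close>, where it follows from \<open>h2_norm_fatou\<close>.\<close>

lemma h2_cauchy_limit:
  assumes hk: "\<And>k. hb (h k)"
    and cau: "\<And>e. e > 0 \<Longrightarrow> \<exists>K. \<forall>k\<ge>K. \<forall>l\<ge>K. h2_norm (\<lambda>z. h k z - h l z) < e"
  obtains g where "g holomorphic_on ball 0 1" "\<And>z. norm z < 1 \<Longrightarrow> (\<lambda>k. h k z) \<longlonglongrightarrow> g z"
    "\<And>z. norm z \<ge> 1 \<Longrightarrow> g z = 0" "hb g \<Longrightarrow> (\<lambda>k. h2_norm (\<lambda>z. h k z - g z)) \<longlonglongrightarrow> 0"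
proof -
  have hd: "hb (\<lambda>z. h k z - h l z)" for k l by (intro hb_intros hk)
  have unif: "\<exists>K. \<forall>k\<ge>K. \<forall>l\<ge>K. \<forall>z\<in>cball 0 \<rho>. norm (h k z - h l z) \<le> e" if e: "e > 0" and \<rho>: "0 \<le> \<rho>" "\<rho> < 1" for e \<rho>
  proof -
    have p: "0 < 1 - \<rho>\<^sup>2" using \<rho> by (simp add: power_less_one_iff)
    \<comment> \<open>Chosen to cancel the factor \<open>1 / (1 - \<rho>\<^sup>2)\<close> of the
      evaluation bound on the disc of radius \<open>\<rho>\<close>.\<close>
    define e' where "e' = e * sqrt (1 - \<rho>\<^sup>2)"
    have "e' > 0" using e p by (simp add: e'_def)
    from cau[OF this] obtain K where K: "\<And>k l. k \<ge> K \<Longrightarrow> l \<ge> K \<Longrightarrow> h2_norm (\<lambda>z. h k z - h l z) < e'" by auto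
    show ?thesis
    proof (intro exI[of _ K] allI impI ballI)
      fix k l and z :: complex assume kl: "K \<le> k" "K \<le> l" and z: "z \<in> cball 0 \<rho>"
      have z1: "norm z < 1" using z \<rho> by auto
      have zr: "(norm z)\<^sup>2 \<le> \<rho>\<^sup>2" using z by (intro power_mono) auto
      have "(norm (h k z - h l z))\<^sup>2 \<le> (h2_norm (\<lambda>z. h k z - h l z))\<^sup>2 / (1 - (norm z)\<^sup>2)"
        by (rule h2_eval_bound[OF hd z1])
      also have "\<dots> \<le> e'\<^sup>2 / (1 - \<rho>\<^sup>2)"
      proof (rule frac_le)
        show "(h2_norm (\<lambda>z. h k z - h l z))\<^sup>2 \<le> e'\<^sup>2"
          by (rule power_mono[OF less_imp_le[OF K[OF kl]] h2_norm_ge_0[OF hd]])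
      qed (use zr p in auto)
      also have "\<dots> = e\<^sup>2"
        unfolding e'_def power_mult_distrib real_sqrt_pow2[OF less_imp_le[OF p]] using p by (intro nonzero_mult_div_cancel_right) linarith
      finally show "norm (h k z - h l z) \<le> e" by (rule power2_le_imp_le) (use e in simp)
    qed
  qed
  define g where "g z = (if norm z < 1 then lim (\<lambda>k. h k z) else 0)" for z
  have lim: "(\<lambda>k. h k z) \<longlonglongrightarrow> g z" if z: "norm z < 1" for z
  proof -
    have "Cauchy (\<lambda>k. h k z)"
    proof (rule metric_CauchyI)
      fix e :: real assume e: "e > 0"
      from unif[OF half_gt_zero[OF e] norm_ge_zero z]
      obtain K where "\<forall>k\<ge>K. \<forall>l\<ge>K. \<forall>y\<in>cball 0 (norm z). norm (h k y - h l y) \<le> e / 2" by blast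
      hence K: "norm (h k z - h l z) \<le> e / 2" if "k \<ge> K" "l \<ge> K" for k l using that by simp
      show "\<exists>M. \<forall>m\<ge>M. \<forall>n\<ge>M. dist (h m z) (h n z) < e"
      proof (intro exI[of _ K] allI impI)
        fix m n assume "K \<le> m" "K \<le> n"
        from K[OF this] e show "dist (h m z) (h n z) < e" by (simp add: dist_norm)
      qed
    qed
    hence "convergent (\<lambda>k. h k z)" by (simp add: Cauchy_convergent_iff)
    thus ?thesis using z by (simp add: g_def convergent_LIMSEQ_iff)
  qed
  have hol: "g holomorphic_on ball 0 1"
  proof (rule holomorphic_uniform_sequence[of _ h])
    fix x :: complex assume x: "x \<in> ball 0 1"
    define d where "d = (1 - norm x) / 2"
    define \<rho> where "\<rho> = (1 + norm x) / 2"
    have d: "d > 0" "0 \<le> \<rho>" "\<rho> < 1" using x by (auto simp: d_def \<rho>_def)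
    have sub: "cball x d \<subseteq> cball 0 \<rho>"
    proof
      fix y assume "y \<in> cball x d"
      hence "norm (x - y) \<le> d" by (simp add: dist_norm)
      hence "norm y \<le> norm x + d" by norm
      thus "y \<in> cball 0 \<rho>" by (simp add: d_def \<rho>_def field_simps)
    qed
    show "\<exists>d. 0 < d \<and> cball x d \<subseteq> ball 0 1 \<and> uniform_limit (cball x d) h g sequentially"
    proof (intro exI[of _ d] conjI d(1))
      show "cball x d \<subseteq> ball 0 1" using sub d(3) by force
      show "uniform_limit (cball x d) h g sequentially"
      proof (rule uniform_limitI)
        fix e :: real assume e: "e > 0"
        from unif[OF half_gt_zero[OF e] d(2,3)]
        obtain K where K: "\<And>k l z. k \<ge> K \<Longrightarrow> l \<ge> K \<Longrightarrow> z \<in> cball 0 \<rho> \<Longrightarrow> norm (h k z - h l z) \<le> e / 2" by blast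
        show "\<forall>\<^sub>F k in sequentially. \<forall>z\<in>cball x d. dist (h k z) (g z) < e"
          using eventually_ge_at_top[of K]
        proof eventually_elim
          case (elim k)
          show ?case
          proof
            fix z assume "z \<in> cball x d"
            hence z: "z \<in> cball 0 \<rho>" "norm z < 1" using sub d(3) by force+
            have "norm (h k z - g z) \<le> e / 2"
            proof (rule tendsto_upperbound)
              show "(\<lambda>l. norm (h k z - h l z)) \<longlonglongrightarrow> norm (h k z - g z)" by (intro tendsto_intros lim z)
              show "\<forall>\<^sub>F l in sequentially. norm (h k z - h l z) \<le> e / 2"
                using eventually_ge_at_top[of K] by eventually_elim (use K elim z in auto)
            qed simp
            thus "dist (h k z) (g z) < e" using e by (simp add: dist_norm)
          qed
        qed
      qed
    qed
  qed (use hk in \<open>auto simp: hb_def\<close>)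
  show ?thesis
  proof (rule that[OF hol lim])
    show "g z = 0" if "norm z \<ge> 1" for z using that by (simp add: g_def)
    assume g: "hb g"
    show "(\<lambda>k. h2_norm (\<lambda>z. h k z - g z)) \<longlonglongrightarrow> 0"
    proof (rule LIMSEQ_I)
      fix e :: real assume e: "e > 0"
      from cau[of "e/2"] e obtain K where K: "\<And>k l. k \<ge> K \<Longrightarrow> l \<ge> K \<Longrightarrow> h2_norm (\<lambda>z. h k z - h l z) < e/2" by auto
      show "\<exists>no. \<forall>k\<ge>no. norm (h2_norm (\<lambda>z. h k z - g z) - 0) < e"
      proof (intro exI[of _ K] allI impI)
        fix k assume k: "K \<le> k"
        have "h2_norm (\<lambda>z. h k z - g z) \<le> e / 2"
        proof (rule h2_norm_fatou[where f = "\<lambda>l z. h k z - h (l + K) z"])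
          show "(\<lambda>l. h k z - h (l + K) z) \<longlonglongrightarrow> h k z - g z" if "norm z < 1" for z
            by (intro tendsto_intros LIMSEQ_ignore_initial_segment lim that)
          show "h2_norm (\<lambda>z. h k z - h (l + K) z) \<le> e / 2" for l
            by (rule less_imp_le[OF K[OF k]]) simp
        qed (use e g hk in \<open>auto intro!: hb_diff\<close>)
        thus "norm (h2_norm (\<lambda>z. h k z - g z) - 0) < e"
          using e h2_norm_ge_0[OF hb_diff[OF hk g]] by simp
      qed
    qed
  qed auto
qed

lemma h2_norm_lim_pointwise:
  assumes gk: "\<And>k. hb (gk k)" and g: "hb g" and lim: "(\<lambda>k. h2_norm (\<lambda>z. gk k z - g z)) \<longlonglongrightarrow> 0"
    and z: "norm z < 1"
  shows "(\<lambda>k. gk k z) \<longlonglongrightarrow> g z"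
proof (rule LIM_zero_cancel, rule Lim_null_comparison)
  have p: "0 < 1 - (norm z)\<^sup>2" using z by (simp add: power_less_one_iff)
  have "(\<lambda>k. h2_norm (\<lambda>z. gk k z - g z) / sqrt (1 - (norm z)\<^sup>2)) \<longlonglongrightarrow> 0 / sqrt (1 - (norm z)\<^sup>2)"
    by (intro tendsto_intros lim) (use p in auto)
  thus "(\<lambda>k. h2_norm (\<lambda>z. gk k z - g z) / sqrt (1 - (norm z)\<^sup>2)) \<longlonglongrightarrow> 0" by simp
  show "\<forall>\<^sub>F k in sequentially. norm (gk k z - g z) \<le> h2_norm (\<lambda>z. gk k z - g z) / sqrt (1 - (norm z)\<^sup>2)"
  proof (rule always_eventually, rule allI)
    fix k
    have d: "hb (\<lambda>z. gk k z - g z)" by (intro hb_intros gk g)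
    show "norm (gk k z - g z) \<le> h2_norm (\<lambda>z. gk k z - g z) / sqrt (1 - (norm z)\<^sup>2)"
      by (rule power2_le_imp_le)
         (use h2_eval_bound[OF d z] p h2_norm_ge_0[OF d] in \<open>auto simp: power_divide\<close>)
  qed
qed

section \<open>Norm continuity of Herglotz transforms and division by \<open>B\<close>\<close>

context finite_blaschke
begin

lemma hb_comp: "hb h \<Longrightarrow> hb (\<lambda>z. h (B z))"
proof -
  assume h: "hb h"
  obtain C where C: "\<And>z. norm z < 1 \<Longrightarrow> norm (h z) \<le> C" using hb_bound[OF h] by blast
  have "(h \<circ> B) holomorphic_on ball 0 1"
    by (rule holomorphic_on_compose_gen[OF B_hol hbD[OF h]]) (use B_lt_1' in auto)
  thus ?thesis by (intro hbI[where C = C]) (use C B_lt_1' in \<open>auto simp: o_def\<close>)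
qed

lemma herg_tendsto:
  assumes gk: "\<And>k. hb (gk k)" and g: "hb g" and lim: "(\<lambda>k. h2_norm (\<lambda>z. gk k z - g z)) \<longlonglongrightarrow> 0"
    and w: "norm w < 1"
  shows "(\<lambda>k. herg (gk k) w) \<longlonglongrightarrow> herg g w"
proof -
  define \<delta> where "\<delta> k = h2_norm (\<lambda>z. gk k z - g z)" for k
  have "\<delta> = (\<lambda>k. h2_norm (\<lambda>z. gk k z - g z))" by (simp add: fun_eq_iff \<delta>_def)
  hence \<delta>: "\<delta> \<longlonglongrightarrow> 0" using lim by simp
  have main: "(\<lambda>k. h2_inner (gk k) (ker v (gk k))) \<longlonglongrightarrow> h2_inner g (ker v g)" if v: "norm v < 1" for v
  proof (rule LIM_zero_cancel, rule Lim_null_comparison)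
    have "(\<lambda>k. \<delta> k * (h2_norm g + \<delta> k) / (1 - norm v) + h2_norm g * \<delta> k / (1 - norm v))
        \<longlonglongrightarrow> 0 * (h2_norm g + 0) / (1 - norm v) + h2_norm g * 0 / (1 - norm v)"
      by (intro tendsto_intros \<delta>) (use v in auto)
    thus "(\<lambda>k. \<delta> k * (h2_norm g + \<delta> k) / (1 - norm v) + h2_norm g * \<delta> k / (1 - norm v)) \<longlonglongrightarrow> 0" by simp
    show "\<forall>\<^sub>F k in sequentially. norm (h2_inner (gk k) (ker v (gk k)) - h2_inner g (ker v g))
        \<le> \<delta> k * (h2_norm g + \<delta> k) / (1 - norm v) + h2_norm g * \<delta> k / (1 - norm v)"
    proof (rule always_eventually, rule allI)
      fix k
      let ?d = "\<lambda>z. gk k z - g z"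
      have d: "hb ?d" by (intro hb_intros gk g)
      have \<delta>0: "0 \<le> \<delta> k" unfolding \<delta>_def by (rule h2_norm_ge_0[OF d])
      have "ker v ?d = (\<lambda>z. ker v (gk k) z - ker v g z)" by (simp add: ker_def fun_eq_iff diff_divide_distrib)
      hence eq: "h2_inner (gk k) (ker v (gk k)) - h2_inner g (ker v g) = h2_inner ?d (ker v (gk k)) + h2_inner g (ker v ?d)"
        using gk g v by (simp add: h2_inner_diff_left h2_inner_diff_right hb_ker)
      have b1: "norm (h2_inner ?d (ker v (gk k))) \<le> \<delta> k * (h2_norm g + \<delta> k) / (1 - norm v)"
      proof -
        have "h2_norm (gk k) \<le> h2_norm g + \<delta> k"
          using h2_norm_triangle[OF g d] by (simp add: \<delta>_def)
        hence "h2_norm (ker v (gk k)) \<le> (h2_norm g + \<delta> k) / (1 - norm v)"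
          using h2_norm_ker_le[OF v gk] v by (meson divide_right_mono diff_ge_0_iff_ge less_imp_le order_trans)
        hence "\<delta> k * h2_norm (ker v (gk k)) \<le> \<delta> k * ((h2_norm g + \<delta> k) / (1 - norm v))"
          by (intro mult_left_mono \<delta>0)
        thus ?thesis using h2_cauchy_schwarz[OF d hb_ker[OF v gk[of k]]] by (simp add: \<delta>_def)
      qed
      have b2: "norm (h2_inner g (ker v ?d)) \<le> h2_norm g * \<delta> k / (1 - norm v)"
      proof -
        have "h2_norm g * h2_norm (ker v ?d) \<le> h2_norm g * (\<delta> k / (1 - norm v))"
          using h2_norm_ker_le[OF v d] by (intro mult_left_mono h2_norm_ge_0 g) (simp add: \<delta>_def)
        thus ?thesis using h2_cauchy_schwarz[OF g hb_ker[OF v d]] by simp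
      qed
      show "norm (h2_inner (gk k) (ker v (gk k)) - h2_inner g (ker v g))
        \<le> \<delta> k * (h2_norm g + \<delta> k) / (1 - norm v) + h2_norm g * \<delta> k / (1 - norm v)"
        unfolding eq by (rule norm_triangle_mono[OF b1 b2])
    qed
  qed
  \<comment> \<open>At \<open>w = 0\<close> the kernel is trivial, so both terms of
    \<open>herg\<close> have the shape treated in \<open>main\<close>.\<close>
  have "ker 0 f = f" for f by (simp add: ker_def fun_eq_iff)
  hence "herg f w = 2 * h2_inner f (ker w f) - h2_inner f (ker 0 f)" for f by (simp add: herg_def)
  thus ?thesis using main[OF w] main[of 0] by (auto intro!: tendsto_intros)
qed

text \<open>Quantitative form of the fact that a vector of minimal norm is orthogonal to the
  directions of variation. It is stated for almost minimal \<open>h\<close> because no minimiser in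
  the subspace is available yet; the test value \<open>c\<close> is the projection coefficient on
  \<open>B u\<close>.\<close>

lemma near_minimal_inner:
  assumes h: "hb h" and u: "hb u" and d: "0 \<le> d" "0 \<le> \<delta>" "(h2_norm h)\<^sup>2 \<le> d\<^sup>2 + \<delta>"
    and min: "\<And>c. d \<le> h2_norm (\<lambda>z. h z - c * (B z * u z))"
  shows "norm (h2_inner h (\<lambda>z. B z * u z)) \<le> sqrt \<delta> * h2_norm u"
proof (cases "h2_norm u = 0")
  case True
  have Bu: "hb (\<lambda>z. B z * u z)" by (intro hb_intros hb_B u)
  show ?thesis using h2_cauchy_schwarz[OF h Bu] h2_norm_B[OF u] True by simp
next
  case False
  have Bu: "hb (\<lambda>z. B z * u z)" by (intro hb_intros hb_B u)
  define X where "X = h2_inner h (\<lambda>z. B z * u z)"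
  define v where "v = h2_norm u"
  have v: "v > 0" using False h2_norm_ge_0[OF u] by (simp add: v_def)
  define c where "c = X / of_real (v\<^sup>2)"
  have cBu: "hb (\<lambda>z. c * (B z * u z))" by (intro hb_intros Bu)
  have "d\<^sup>2 \<le> (h2_norm (\<lambda>z. h z - c * (B z * u z)))\<^sup>2" using min[of c] d by (intro power_mono) auto
  also have "\<dots> = (h2_norm h)\<^sup>2 - 2 * Re (cnj c * X) + (norm c * v)\<^sup>2"
    unfolding h2_norm_diff_sq[OF h cBu] h2_inner_scale_right[OF Bu h] h2_norm_scale[OF Bu] h2_norm_B[OF u] X_def v_def ..
  also have "cnj c * X = of_real ((norm X)\<^sup>2 / v\<^sup>2)"
    unfolding c_def by (simp add: complex_norm_square mult.commute del: of_real_power)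
  also have "(norm c * v)\<^sup>2 = (norm X)\<^sup>2 / v\<^sup>2"
    using v unfolding c_def by (simp add: norm_divide norm_power power_mult_distrib power_divide field_simps)
  finally have "(norm X)\<^sup>2 / v\<^sup>2 \<le> \<delta>" using d by simp
  hence "(norm X)\<^sup>2 \<le> \<delta> * v\<^sup>2" using v by (simp add: divide_simps)
  also have "\<dots> = (sqrt \<delta> * v)\<^sup>2" using d by (simp add: power_mult_distrib)
  finally show ?thesis unfolding X_def[symmetric] v_def[symmetric]
    by (rule power2_le_imp_le) (use v d in auto)
qed

text \<open>Near the circle \<open>B\<close> is bounded away from 0 by
  \<open>B_gap_\<kappa>\<close>, and on the remaining compact disc \<open>g\<close> is bounded by
  continuity. Zeros of \<open>B\<close> cause no harm since \<open>g\<close> is already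
  holomorphic.\<close>

lemma bounded_quotient_B:
  assumes g: "g holomorphic_on ball 0 1" and Bg: "hb (\<lambda>z. B z * g z)"
  shows "hb g"
proof -
  obtain C where C: "C > 0" "\<And>z. norm z < 1 \<Longrightarrow> norm (B z * g z) \<le> C" using hb_bound[OF Bg] by blast
  \<comment> \<open>Solves \<open>\<kappa> * (1 - \<rho>\<^sup>2) = 1 / 2\<close>, so outside radius
    \<open>\<rho>\<close> the squared modulus of \<open>B\<close> is at least one half.\<close>
  define \<rho> where "\<rho> = sqrt (1 - 1 / (2 * \<kappa>))"
  have \<kappa>: "0 \<le> 1 - 1 / (2 * \<kappa>)" "1 - 1 / (2 * \<kappa>) < 1" using \<kappa>_ge_1 by (auto simp: divide_simps)
  have \<rho>: "\<rho> < 1" "0 \<le> \<rho>" "\<rho>\<^sup>2 = 1 - 1 / (2 * \<kappa>)" using \<kappa> by (auto simp: \<rho>_def)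
  have "compact (g ` cball 0 \<rho>)"
    by (intro compact_continuous_image continuous_on_subset[OF holomorphic_on_imp_continuous_on[OF g]])
       (use \<rho> in auto)
  then obtain D where D: "D > 0" "\<And>z. z \<in> cball 0 \<rho> \<Longrightarrow> norm (g z) \<le> D"
    using compact_imp_bounded bounded_pos by (metis image_eqI)
  show ?thesis
  proof (rule hbI[OF g, where C = "max D (2 * C)"])
    fix z :: complex assume z: "norm z < 1"
    show "norm (g z) \<le> max D (2 * C)"
    proof (cases "norm z \<le> \<rho>")
      case True thus ?thesis using D(2)[of z] by simp
    next
      case False
      hence "\<rho>\<^sup>2 \<le> (norm z)\<^sup>2" using \<rho> by (intro power_mono) auto
      hence "\<kappa> * (1 - (norm z)\<^sup>2) \<le> \<kappa> * (1 / (2 * \<kappa>))" using \<rho>(3) \<kappa>_ge_1 by (intro mult_left_mono) auto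
      hence "1 - (norm (B z))\<^sup>2 \<le> 1 / 2" using B_gap_\<kappa>[OF z] \<kappa>_ge_1 by simp
      hence "(1/2)\<^sup>2 \<le> (norm (B z))\<^sup>2" by (simp add: power2_eq_square)
      hence "1/2 \<le> norm (B z)" by (rule power2_le_imp_le) simp
      hence "1/2 * norm (g z) \<le> norm (B z) * norm (g z)" by (intro mult_right_mono) auto
      thus ?thesis using C(2)[OF z] by (simp add: norm_mult)
    qed
  qed
qed

end

section \<open>Subspaces of bounded functions invariant under multiplication by
  \<open>B\<close>\<close>

locale shift_invariant = finite_blaschke +
  fixes N :: "(complex \<Rightarrow> complex) set"
  assumes N_csubspace: "csubspace N" and N_hinf: "N \<subseteq> hinf" and N_bp: "bp_closed N"
    and N_B: "f \<in> N \<Longrightarrow> (\<lambda>z. B z * f z) \<in> N"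
begin

lemma N_hb: "f \<in> N \<Longrightarrow> hb f"
  using N_hinf by (auto simp: hinf_iff)

lemma N_off: "f \<in> N \<Longrightarrow> norm z \<ge> 1 \<Longrightarrow> f z = 0"
  using N_hinf by (auto simp: hinf_iff)

lemma N_zero: "(\<lambda>z. 0) \<in> N"
  using N_csubspace by (simp add: csubspace_def)

lemma N_add: "f \<in> N \<Longrightarrow> g \<in> N \<Longrightarrow> (\<lambda>z. f z + g z) \<in> N"
  using N_csubspace unfolding csubspace_def by blast

lemma N_scale: "f \<in> N \<Longrightarrow> (\<lambda>z. c * f z) \<in> N"
  using N_csubspace unfolding csubspace_def by blast

lemma N_diff: "f \<in> N \<Longrightarrow> g \<in> N \<Longrightarrow> (\<lambda>z. f z - g z) \<in> N"
  using N_add[of f "\<lambda>z. (-1) * g z"] N_scale[of g "-1"] by simp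

lemma N_sum: "(\<And>i. i \<in> I \<Longrightarrow> f i \<in> N) \<Longrightarrow> (\<lambda>z. \<Sum>i\<in>I. f i z) \<in> N"
  by (induction I rule: infinite_finite_induct) (simp_all add: N_zero N_add)

lemma N_B_power: "f \<in> N \<Longrightarrow> (\<lambda>z. B z ^ m * f z) \<in> N"
proof (induction m)
  case (Suc m)
  thus ?case using N_B[of "\<lambda>z. B z ^ m * f z"] by (simp add: mult.assoc)
qed simp

lemma hinf_comp_mult: "hb h \<Longrightarrow> f \<in> N \<Longrightarrow> (\<lambda>z. h (B z) * f z) \<in> hinf"
  by (simp add: hinf_iff hb_mult hb_comp N_hb N_off)

text \<open>Taylor partial sums of a bounded function need not be uniformly bounded, so two limits
  are taken: for a dilation by \<open>\<rho> < 1\<close> the partial sums are bounded by an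
  absolutely convergent series, and the dilations themselves are bounded by the bound of
  \<open>h\<close> as \<open>\<rho>\<close> tends to 1.\<close>

lemma N_comp:
  assumes h: "hb h" and f: "f \<in> N"
  shows "(\<lambda>z. h (B z) * f z) \<in> N"
proof -
  obtain C where C: "C > 0" "\<And>z. norm z < 1 \<Longrightarrow> norm (h z) \<le> C" using hb_bound[OF h] by blast
  obtain D where D: "D > 0" "\<And>z. norm z < 1 \<Longrightarrow> norm (f z) \<le> D" using hb_bound[OF N_hb[OF f]] by blast
  have dil: "(\<lambda>z. h (of_real \<rho> * B z) * f z) \<in> N" if \<rho>: "0 \<le> \<rho>" "\<rho> < 1" for \<rho> :: real
  proof -
    have rl: "norm (of_real \<rho> * w) < 1" if "norm w < 1" for w :: complex
      using mult_mono[of \<rho> 1 "norm w" "norm w"] that \<rho> by (simp add: norm_mult)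
    have h\<rho>: "hb (\<lambda>w. h (of_real \<rho> * w))"
    proof (rule hbI[where C = C])
      have "(h \<circ> (\<lambda>w. of_real \<rho> * w)) holomorphic_on ball 0 1"
        by (rule holomorphic_on_compose_gen[OF _ hbD[OF h]]) (use rl in \<open>auto intro!: holomorphic_intros\<close>)
      thus "(\<lambda>w. h (of_real \<rho> * w)) holomorphic_on ball 0 1" by (simp add: o_def)
    qed (use C rl in auto)
    define A where "A = (\<Sum>m. norm (coef h m) * \<rho> ^ m)"
    have sA: "summable (\<lambda>m. norm (coef h m) * \<rho> ^ m)" by (rule coef_norm_summable[OF hbD[OF h] \<rho>])
    have A0: "0 \<le> A" unfolding A_def using \<rho> by (intro suminf_nonneg sA) auto
    show ?thesis
    proof (rule bp_closedD[OF N_bp, where C = "A * D"])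
      show "(\<lambda>z. \<Sum>m<K. (coef h m * of_real \<rho> ^ m) * (B z ^ m * f z)) \<in> N" for K
        by (intro N_sum N_scale N_B_power f)
      show "(\<lambda>z. h (of_real \<rho> * B z) * f z) \<in> hinf" by (rule hinf_comp_mult[OF h\<rho> f])
    next
      fix K :: nat and z :: complex assume z: "norm z < 1"
      have "norm (\<Sum>m<K. coef h m * of_real \<rho> ^ m * B z ^ m) \<le> (\<Sum>m<K. norm (coef h m) * \<rho> ^ m)"
      proof (rule sum_norm_le)
        fix m
        have "norm (coef h m * of_real \<rho> ^ m * B z ^ m) = norm (coef h m) * \<rho> ^ m * norm (B z) ^ m"
          using \<rho> by (simp add: norm_mult norm_power)
        also have "\<dots> \<le> norm (coef h m) * \<rho> ^ m * 1"
          using \<rho> B_lt_1'[of z] by (intro mult_left_mono power_le_one) auto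
        finally show "norm (coef h m * of_real \<rho> ^ m * B z ^ m) \<le> norm (coef h m) * \<rho> ^ m" by simp
      qed
      also have "\<dots> \<le> A" unfolding A_def using \<rho> by (intro sum_le_suminf sA) auto
      finally have "norm (\<Sum>m<K. coef h m * of_real \<rho> ^ m * B z ^ m) * norm (f z) \<le> A * D"
        using D z A0 by (intro mult_mono) auto
      thus "norm (\<Sum>m<K. (coef h m * of_real \<rho> ^ m) * (B z ^ m * f z)) \<le> A * D"
        by (simp add: mult.assoc[symmetric] sum_distrib_right[symmetric] norm_mult)
    next
      fix z :: complex assume "norm z < 1"
      have "(\<lambda>m. coef h m * (of_real \<rho> * B z) ^ m) sums h (of_real \<rho> * B z)"
        by (rule coef_sums[OF hbD[OF h] rl[OF B_lt_1']])
      from sums_mult2[OF this, of "f z"]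
      show "(\<lambda>K. \<Sum>m<K. (coef h m * of_real \<rho> ^ m) * (B z ^ m * f z)) \<longlonglongrightarrow> h (of_real \<rho> * B z) * f z"
        by (simp add: sums_def power_mult_distrib mult.assoc)
    qed
  qed
  define \<rho> where "\<rho> k = 1 + - inverse (real (Suc k))" for k
  have \<rho>: "0 \<le> \<rho> k" "\<rho> k < 1" for k by (auto simp: \<rho>_def field_simps)
  have \<rho>1: "\<rho> \<longlonglongrightarrow> 1" unfolding \<rho>_def by (rule LIMSEQ_inverse_real_of_nat_add_minus)
  have rl: "norm (of_real (\<rho> k) * w) < 1" if "norm w < 1" for k and w :: complex
    using mult_mono[of "\<rho> k" 1 "norm w" "norm w"] that \<rho>[of k] by (simp add: norm_mult)
  show ?thesis
  proof (rule bp_closedD[OF N_bp, where C = "C * D"])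
    show "(\<lambda>z. h (of_real (\<rho> k) * B z) * f z) \<in> N" for k by (rule dil[OF \<rho>])
    show "norm (h (of_real (\<rho> k) * B z) * f z) \<le> C * D" if "norm z < 1" for k z
      unfolding norm_mult using C D that rl[OF B_lt_1'] by (intro mult_mono) auto
    show "(\<lambda>k. h (of_real (\<rho> k) * B z) * f z) \<longlonglongrightarrow> h (B z) * f z" for z
    proof (intro tendsto_intros)
      have "isCont h (B z)"
        using holomorphic_on_imp_continuous_on[OF hbD[OF h]] B_lt_1'[of z]
        by (simp add: continuous_on_eq_continuous_at)
      moreover have "(\<lambda>k. of_real (\<rho> k) * B z) \<longlonglongrightarrow> of_real 1 * B z" by (intro tendsto_intros \<rho>1)
      ultimately show "(\<lambda>k. h (of_real (\<rho> k) * B z)) \<longlonglongrightarrow> h (B z)" by (auto intro: isCont_tendsto_compose[where g = h])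
    qed
  qed (rule hinf_comp_mult[OF h f])
qed

lemma N_ker: "norm w < 1 \<Longrightarrow> f \<in> N \<Longrightarrow> ker w f \<in> N"
proof -
  assume w: "norm w < 1" and f: "f \<in> N"
  have d: "1 - norm w \<le> norm (1 - cnj w * z)" if "norm z < 1" for z
  proof -
    have "norm (cnj w * z) \<le> norm w * 1"
      unfolding norm_mult complex_mod_cnj using that by (intro mult_left_mono) auto
    thus ?thesis using norm_triangle_ineq2[of 1 "cnj w * z"] by simp
  qed
  have "hb (\<lambda>z. 1 / (1 - cnj w * z))"
  proof (rule hbI[where C = "1 / (1 - norm w)"])
    show "(\<lambda>z. 1 / (1 - cnj w * z)) holomorphic_on ball 0 1"
      by (intro holomorphic_intros) (use d w in force)
    show "norm (1 / (1 - cnj w * z)) \<le> 1 / (1 - norm w)" if "norm z < 1" for z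
      using d[OF that] w by (auto simp: norm_divide intro!: divide_left_mono mult_pos_pos)
  qed
  from N_comp[OF this f] show ?thesis by (simp add: ker_eq_mult)
qed

text \<open>Dividing by \<open>1 + \<epsilon> herg(g\<^sub>k)(B)\<close> turns convergence in norm into bounded pointwise convergence.\<close>
lemma N_h2_closed:
  assumes gk: "\<And>k. gk k \<in> N" and g: "g \<in> hinf" and lim: "(\<lambda>k. h2_norm (\<lambda>z. gk k z - g z)) \<longlonglongrightarrow> 0"
  shows "g \<in> N"
proof -
  have ghb: "hb g" and goff: "\<And>z. norm z \<ge> 1 \<Longrightarrow> g z = 0" using g by (auto simp: hinf_iff)
  define q where "q e f w = 1 / (1 + of_real e * herg f w)" for e :: real and f w
  have q1: "norm (1 + of_real e * herg f w) \<ge> 1 + e * Re (herg f w)" "1 + e * Re (herg f w) \<ge> 1"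
    if "e > 0" "hb f" "norm w < 1" for e f w
  proof -
    show "norm (1 + of_real e * herg f w) \<ge> 1 + e * Re (herg f w)"
      using complex_Re_le_cmod[of "1 + of_real e * herg f w"] by simp
    show "1 + e * Re (herg f w) \<ge> 1" using Re_herg_nonneg[OF that(3,2)] that by simp
  qed
  have hbq: "hb (q e f)" if "e > 0" "hb f" for e f
    unfolding q_def
  proof (rule hbI[where C = 1])
    have "1 + of_real e * herg f w \<noteq> 0" if "norm w < 1" for w
      using q1[OF \<open>e > 0\<close> \<open>hb f\<close> that] by auto
    thus "(\<lambda>w. 1 / (1 + of_real e * herg f w)) holomorphic_on ball 0 1"
      by (intro holomorphic_intros herg_holomorphic that) auto
    show "norm (1 / (1 + of_real e * herg f w)) \<le> 1" if "norm w < 1" for w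
      using q1[OF \<open>e > 0\<close> \<open>hb f\<close> that] by (simp add: norm_divide divide_simps)
  qed
  have step: "(\<lambda>z. q e g (B z) * g z) \<in> N" if e: "e > 0" for e
  proof (rule bp_closedD[OF N_bp, where C = "sqrt (\<kappa> / e)"])
    show "(\<lambda>z. q e (gk k) (B z) * gk k z) \<in> N" for k
      by (intro N_comp hbq e N_hb gk)
    show "(\<lambda>z. q e g (B z) * g z) \<in> hinf"
      using goff by (auto simp: hinf_iff intro!: hb_mult hb_comp hbq e ghb)
  next
    fix k z assume z: "norm (z::complex) < 1"
    \<comment> \<open>The numerator is at most \<open>\<kappa> * x\<close> by
      \<open>norm_sq_le_herg\<close>, the denominator at least \<open>(1 + e * x)\<^sup>2\<close>
      because the Herglotz transform has nonnegative real part. Since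
      \<open>e * x \<le> (1 + e * x)\<^sup>2\<close>, the quotient is at most
      \<open>\<kappa> / e\<close>, whatever \<open>k\<close> is.\<close>
    define x where "x = Re (herg (gk k) (B z))"
    have x: "x \<ge> 0" unfolding x_def by (intro Re_herg_nonneg B_lt_1' N_hb gk)
    have d: "norm (1 + of_real e * herg (gk k) (B z)) \<ge> 1 + e * x"
      using q1[OF e N_hb[OF gk] B_lt_1', of k z] by (simp add: x_def)
    have "(norm (q e (gk k) (B z) * gk k z))\<^sup>2 = (norm (gk k z))\<^sup>2 / (norm (1 + of_real e * herg (gk k) (B z)))\<^sup>2"
      by (simp add: q_def norm_mult norm_divide power_divide power_mult_distrib)
    also have "\<dots> \<le> (\<kappa> * x) / (1 + e * x)\<^sup>2"
    proof (intro frac_le power_mono d)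
      show "0 < (1 + e * x)\<^sup>2" using x e by (intro zero_less_power add_pos_nonneg) auto
      show "(norm (gk k z))\<^sup>2 \<le> \<kappa> * x" using norm_sq_le_herg[OF z N_hb[OF gk[of k]]] by (simp add: x_def)
    qed (use x e \<kappa>_ge_1 in auto)
    also have "\<dots> \<le> \<kappa> / e"
    proof -
      have p: "(1 + e * x)\<^sup>2 > 0" using x e by (intro zero_less_power add_pos_nonneg) auto
      have "e * x \<le> (1 + e * x)\<^sup>2" using x e by (simp add: power2_eq_square algebra_simps)
      hence "\<kappa> * (e * x) \<le> \<kappa> * (1 + e * x)\<^sup>2" using \<kappa>_ge_1 by (intro mult_left_mono) auto
      thus ?thesis using p e by (simp add: divide_simps mult_ac)
    qed
    finally show "norm (q e (gk k) (B z) * gk k z) \<le> sqrt (\<kappa> / e)" by (rule real_le_rsqrt)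
  next
    fix z assume z: "norm (z::complex) < 1"
    have ne: "1 + of_real e * herg g (B z) \<noteq> 0" using q1[OF e ghb B_lt_1', of z] by auto
    show "(\<lambda>k. q e (gk k) (B z) * gk k z) \<longlonglongrightarrow> q e g (B z) * g z"
      unfolding q_def
      by (intro tendsto_mult tendsto_divide tendsto_add tendsto_const ne)
         (rule herg_tendsto[OF N_hb[OF gk] ghb lim B_lt_1'] h2_norm_lim_pointwise[OF N_hb[OF gk] ghb lim z])+
  qed
  obtain D where D: "D > 0" "\<And>z. norm z < 1 \<Longrightarrow> norm (g z) \<le> D" using hb_bound[OF ghb] by blast
  \<comment> \<open>Now \<open>e\<close> runs through \<open>inverse (Suc j)\<close>: the
    multipliers have modulus at most 1 and tend to 1 pointwise, so the bound of \<open>g\<close>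
    serves for all \<open>j\<close>.\<close>
  show ?thesis
  proof (rule bp_closedD[OF N_bp _ _ g, where C = D])
    show "(\<lambda>z. q (inverse (real (Suc j))) g (B z) * g z) \<in> N" for j by (rule step) simp
  next
    fix j z assume z: "norm (z::complex) < 1"
    have "norm (q (inverse (real (Suc j))) g (B z)) \<le> 1"
    proof -
      have "1 \<le> norm (1 + of_real (inverse (real (Suc j))) * herg g (B z))"
        by (rule order_trans[OF q1(2) q1(1)]) (use ghb B_lt_1' in auto)
      thus ?thesis unfolding q_def norm_divide norm_one by (subst divide_le_eq_1_pos) linarith+
    qed
    from mult_mono[OF this D(2)[OF z]]
    show "norm (q (inverse (real (Suc j))) g (B z) * g z) \<le> D"
      by (simp only: norm_mult) simp
  next
    fix z assume z: "norm (z::complex) < 1"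
    have "(\<lambda>j. q (inverse (real (Suc j))) g (B z) * g z) \<longlonglongrightarrow> 1 / (1 + of_real 0 * herg g (B z)) * g z"
      unfolding q_def by (intro tendsto_intros LIMSEQ_inverse_real_of_nat) simp
    thus "(\<lambda>j. q (inverse (real (Suc j))) g (B z) * g z) \<longlonglongrightarrow> g z" by simp
  qed
qed

end

section \<open>Projection onto the orthogonal complement of \<open>B N\<close>\<close>

context shift_invariant
begin

text \<open>A minimising sequence for the distance of \<open>f\<close> from \<open>B N\<close> is
  norm-Cauchy, but its members have no common sup bound. Almost minimality makes the real part of
  the Herglotz transform of \<open>h k\<close> nearly the constant \<open>d\<^sup>2\<close>, which
  bounds the limit pointwise by \<open>sqrt (\<kappa> * d\<^sup>2)\<close>.\<close>

lemma orthogonal_decomposition: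
  assumes f: "f \<in> N"
  obtains J g where "J \<in> N" "g \<in> N" "\<And>z. f z = J z + B z * g z" "\<And>u. u \<in> N \<Longrightarrow> h2_inner J (\<lambda>z. B z * u z) = 0"
proof -
  define S where "S = (\<lambda>g. h2_norm (\<lambda>z. f z - B z * g z)) ` N"
  define d where "d = Inf S"
  have hN: "(\<lambda>z. f z - B z * g z) \<in> N" if "g \<in> N" for g by (intro N_diff f N_B that)
  have S: "S \<noteq> {}" "bdd_below S"
    using N_zero h2_norm_ge_0[OF N_hb[OF hN]] by (auto simp: S_def intro!: bdd_belowI[of _ 0])
  have d0: "0 \<le> d" unfolding d_def using h2_norm_ge_0[OF N_hb[OF hN]] by (intro cInf_greatest S) (auto simp: S_def)
  have dle: "d \<le> h2_norm (\<lambda>z. f z - B z * g z)" if "g \<in> N" for g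
    unfolding d_def using that by (intro cInf_lower S) (auto simp: S_def)
  have "\<exists>g\<in>N. h2_norm (\<lambda>z. f z - B z * g z) < d + inverse (real (Suc k))" for k
    using cInf_lessD[OF S(1), of "d + inverse (real (Suc k))"] unfolding d_def[symmetric] by (auto simp: S_def)
  then obtain g where g: "\<And>k. g k \<in> N" and gd: "\<And>k. h2_norm (\<lambda>z. f z - B z * g k z) < d + inverse (real (Suc k))"
    by metis
  define h where "h k z = f z - B z * g k z" for k z
  \<comment> \<open>The slack in the squared norm of \<open>h k\<close> over the infimum; all later
    errors are measured in \<open>\<delta> k\<close> or its square root.\<close>
  define \<delta> where "\<delta> k = (d + inverse (real (Suc k)))\<^sup>2 - d\<^sup>2" for k
  have h_eq: "h k = (\<lambda>z. f z - B z * g k z)" for k by (simp add: fun_eq_iff h_def)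
  have hN': "h k \<in> N" for k unfolding h_eq by (rule hN[OF g])
  have hhb: "hb (h k)" for k by (rule N_hb[OF hN'])
  have ghb: "hb (g k)" for k by (rule N_hb[OF g])
  have \<delta>0: "0 \<le> \<delta> k" for k unfolding \<delta>_def using d0 by (simp add: power_mono)
  have hsq: "(h2_norm (h k))\<^sup>2 \<le> d\<^sup>2 + \<delta> k" for k
    unfolding \<delta>_def using power_mono[OF less_imp_le[OF gd[of k]] h2_norm_ge_0[OF N_hb[OF hN[OF g]]], of 2]
    by (simp add: h_eq)
  have \<delta>lim: "\<delta> \<longlonglongrightarrow> 0"
  proof -
    have "(\<lambda>k. (d + inverse (real (Suc k)))\<^sup>2 - d\<^sup>2) \<longlonglongrightarrow> (d + 0)\<^sup>2 - d\<^sup>2"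
      by (intro tendsto_intros LIMSEQ_inverse_real_of_nat)
    moreover have "\<delta> = (\<lambda>k. (d + inverse (real (Suc k)))\<^sup>2 - d\<^sup>2)" by (simp add: fun_eq_iff \<delta>_def)
    ultimately show ?thesis by simp
  qed
  have near: "norm (h2_inner (h k) (\<lambda>z. B z * u z)) \<le> sqrt (\<delta> k) * h2_norm u" if u: "u \<in> N" for k u
  proof (rule near_minimal_inner[OF hhb N_hb[OF u] d0 \<delta>0 hsq])
    fix c
    have "(\<lambda>z. g k z + c * u z) \<in> N" by (intro N_add N_scale g u)
    from dle[OF this] show "d \<le> h2_norm (\<lambda>z. h k z - c * (B z * u z))"
      by (simp add: h_def algebra_simps)
  qed
  \<comment> \<open>Parallelogram law: half of \<open>h k + h l\<close> is \<open>f\<close> minus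
    \<open>B\<close> times the midpoint of \<open>g k\<close> and \<open>g l\<close>, so its norm is
    at least \<open>d\<close>.\<close>
  have dist: "(h2_norm (\<lambda>z. h k z - h l z))\<^sup>2 \<le> 2 * \<delta> k + 2 * \<delta> l" for k l
  proof -
    have m: "(\<lambda>z. (1/2) * (g k z + g l z)) \<in> N" by (intro N_add N_scale g)
    have s: "hb (\<lambda>z. h k z + h l z)" by (intro hb_intros hhb)
    have ml: "hb (\<lambda>z. (-1) * h l z)" by (intro hb_intros hhb)
    have "d \<le> h2_norm (\<lambda>z. (1/2) * (h k z + h l z))"
      using dle[OF m] by (simp add: h_def algebra_simps)
    also have "\<dots> = 1/2 * h2_norm (\<lambda>z. h k z + h l z)" using h2_norm_scale[OF s, of "1/2"] by simp
    finally have "(2 * d)\<^sup>2 \<le> (h2_norm (\<lambda>z. h k z + h l z))\<^sup>2" using d0 by (intro power_mono) auto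
    also have "\<dots> = (h2_norm (h k))\<^sup>2 + 2 * Re (h2_inner (h k) (h l)) + (h2_norm (h l))\<^sup>2"
      using h2_norm_diff_sq[OF hhb ml, of k] h2_inner_scale_right[OF hhb hhb, of k "-1" l] h2_norm_scale[OF hhb, of "-1" l] by simp
    finally show ?thesis using h2_norm_diff_sq[OF hhb hhb, of k l] hsq[of k] hsq[of l] by (simp add: power_mult_distrib)
  qed
  have cauchy: "\<exists>K. \<forall>k\<ge>K. \<forall>l\<ge>K. h2_norm (\<lambda>z. h k z - h l z) < e" if e: "e > 0" for e
  proof -
    have "e\<^sup>2 / 4 > 0" using e by simp
    from order_tendstoD(2)[OF \<delta>lim this] obtain K where K: "\<And>k. k \<ge> K \<Longrightarrow> \<delta> k < e\<^sup>2 / 4"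
      unfolding eventually_sequentially by auto
    show ?thesis
    proof (intro exI[of _ K] allI impI)
      fix k l assume "K \<le> k" "K \<le> l"
      hence "(h2_norm (\<lambda>z. h k z - h l z))\<^sup>2 < e\<^sup>2" using dist[of k l] K[of k] K[of l] by simp
      thus "h2_norm (\<lambda>z. h k z - h l z) < e" by (rule power2_less_imp_less) (use e in simp)
    qed
  qed
  obtain J where J: "J holomorphic_on ball 0 1" "\<And>z. norm z < 1 \<Longrightarrow> (\<lambda>k. h k z) \<longlonglongrightarrow> J z"
    "\<And>z. norm z \<ge> 1 \<Longrightarrow> J z = 0" "hb J \<Longrightarrow> (\<lambda>k. h2_norm (\<lambda>z. h k z - J z)) \<longlonglongrightarrow> 0"
    using h2_cauchy_limit[OF hhb cauchy] by blast
  have hbJ: "hb J"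
  proof (rule hbI[OF J(1), where C = "sqrt (\<kappa> * d\<^sup>2)"])
    fix z :: complex assume z: "norm z < 1"
    define w where "w = B z"
    have w: "norm w < 1" using B_lt_1' by (simp add: w_def)
    \<comment> \<open>By \<open>ker_minus\<close> the real part of the Herglotz transform is the
      squared norm of \<open>h k\<close> plus twice the real part of its product with an element of
      \<open>B N\<close>. The latter is at most \<open>sqrt (\<delta> k)\<close> times a norm, so
      \<open>E k\<close> tends to \<open>\<kappa> * d\<^sup>2\<close> for fixed
      \<open>z\<close>.\<close>
    define E where "E k = \<kappa> * (d\<^sup>2 + \<delta> k + 2 * (sqrt (\<delta> k) * (sqrt (d\<^sup>2 + \<delta> k) / (1 - norm w))))" for k
    have "E \<longlonglongrightarrow> \<kappa> * (d\<^sup>2 + 0 + 2 * (sqrt 0 * (sqrt (d\<^sup>2 + 0) / (1 - norm w))))"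
      unfolding E_def by (intro tendsto_intros \<delta>lim) (use w in auto)
    hence Elim: "E \<longlonglongrightarrow> \<kappa> * d\<^sup>2" by simp
    have hE: "(norm (h k z))\<^sup>2 \<le> E k" for k
    proof -
      have k: "ker w (h k) \<in> N" by (rule N_ker[OF w hN'])
      have "herg (h k) w = 2 * h2_inner (h k) (\<lambda>z. ker w (h k) z - h k z) + h2_inner (h k) (h k)"
        unfolding herg_def h2_inner_diff_right[OF hb_ker[OF w hhb] hhb hhb] by simp
      also have "(\<lambda>z. ker w (h k) z - h k z) = (\<lambda>z. B z * (cnj w * ker w (h k) z))"
        by (simp add: ker_minus[OF w])
      finally have e1: "Re (herg (h k) w) = 2 * Re (h2_inner (h k) (\<lambda>z. B z * (cnj w * ker w (h k) z))) + (h2_norm (h k))\<^sup>2"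
        using h2_inner_self[OF hhb[of k]] by simp
      have e2: "Re (h2_inner (h k) (\<lambda>z. B z * (cnj w * ker w (h k) z))) \<le> sqrt (\<delta> k) * h2_norm (\<lambda>z. cnj w * ker w (h k) z)"
        by (rule order_trans[OF complex_Re_le_cmod near[OF N_scale[OF k]]])
      have e3: "h2_norm (\<lambda>z. cnj w * ker w (h k) z) \<le> sqrt (d\<^sup>2 + \<delta> k) / (1 - norm w)"
      proof -
        have "h2_norm (\<lambda>z. cnj w * ker w (h k) z) = norm w * h2_norm (ker w (h k))"
          using h2_norm_scale[OF N_hb[OF k], of "cnj w"] by simp
        also have "\<dots> \<le> 1 * h2_norm (ker w (h k))"
          using w h2_norm_ge_0[OF N_hb[OF k]] by (intro mult_right_mono) auto
        also have "\<dots> \<le> h2_norm (h k) / (1 - norm w)" using h2_norm_ker_le[OF w hhb] by simp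
        also have "\<dots> \<le> sqrt (d\<^sup>2 + \<delta> k) / (1 - norm w)"
          using w hsq[of k] by (intro divide_right_mono real_le_rsqrt) auto
        finally show ?thesis .
      qed
      have "sqrt (\<delta> k) * h2_norm (\<lambda>z. cnj w * ker w (h k) z) \<le> sqrt (\<delta> k) * (sqrt (d\<^sup>2 + \<delta> k) / (1 - norm w))"
        using e3 \<delta>0[of k] by (intro mult_left_mono) auto
      with e1 e2 hsq[of k] have "Re (herg (h k) w) \<le> d\<^sup>2 + \<delta> k + 2 * (sqrt (\<delta> k) * (sqrt (d\<^sup>2 + \<delta> k) / (1 - norm w)))"
        by linarith
      hence "\<kappa> * Re (herg (h k) w) \<le> E k" unfolding E_def using \<kappa>_ge_1 by (intro mult_left_mono) auto
      thus ?thesis using norm_sq_le_herg[OF z hhb, of k] by (simp add: w_def)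
    qed
    have "(norm (J z))\<^sup>2 \<le> \<kappa> * d\<^sup>2"
      by (rule tendsto_le[OF _ Elim tendsto_power[OF tendsto_norm[OF J(2)[OF z]]]]) (use hE in auto)
    thus "norm (J z) \<le> sqrt (\<kappa> * d\<^sup>2)" by (rule real_le_rsqrt)
  qed
  have Jhinf: "J \<in> hinf" using hbJ J(3) by (simp add: hinf_iff)
  have JN: "J \<in> N" by (rule N_h2_closed[OF hN' Jhinf J(4)[OF hbJ]])
  have orth: "h2_inner J (\<lambda>z. B z * u z) = 0" if u: "u \<in> N" for u
  proof -
    have Bu: "hb (\<lambda>z. B z * u z)" by (rule N_hb[OF N_B[OF u]])
    have "(\<lambda>k. sqrt (\<delta> k) * h2_norm u + h2_norm (\<lambda>z. h k z - J z) * h2_norm u) \<longlonglongrightarrow> sqrt 0 * h2_norm u + 0 * h2_norm u"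
      by (intro tendsto_intros \<delta>lim J(4) hbJ)
    moreover have "norm (h2_inner J (\<lambda>z. B z * u z)) \<le> sqrt (\<delta> k) * h2_norm u + h2_norm (\<lambda>z. h k z - J z) * h2_norm u" for k
    proof -
      have dd: "hb (\<lambda>z. h k z - J z)" by (intro hb_intros hhb hbJ)
      have e: "h2_inner J (\<lambda>z. B z * u z) = h2_inner (h k) (\<lambda>z. B z * u z) - h2_inner (\<lambda>z. h k z - J z) (\<lambda>z. B z * u z)"
        by (simp add: h2_inner_diff_left[OF hhb hbJ Bu])
      have "norm (h2_inner (\<lambda>z. h k z - J z) (\<lambda>z. B z * u z)) \<le> h2_norm (\<lambda>z. h k z - J z) * h2_norm u"
        using h2_cauchy_schwarz[OF dd Bu] h2_norm_B[OF N_hb[OF u]] by simp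
      from add_mono[OF near[OF u, of k] this] show ?thesis
        unfolding e by (rule order_trans[OF norm_triangle_ineq4])
    qed
    ultimately have "norm (h2_inner J (\<lambda>z. B z * u z)) \<le> sqrt 0 * h2_norm u + 0 * h2_norm u"
      by (intro tendsto_lowerbound[where F = sequentially]) auto
    thus ?thesis by simp
  qed
  \<comment> \<open>The isometry transfers the Cauchy property from \<open>h k\<close> to the
    quotients \<open>g k\<close>, so these converge as well.\<close>
  have gdiff: "h2_norm (\<lambda>z. g k z - g l z) = h2_norm (\<lambda>z. h l z - h k z)" for k l
  proof -
    have gg: "hb (\<lambda>z. g k z - g l z)" by (intro hb_intros ghb)
    have "(\<lambda>z. h l z - h k z) = (\<lambda>z. B z * (g k z - g l z))" by (simp add: h_def fun_eq_iff algebra_simps)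
    thus ?thesis using h2_norm_B[OF gg] by simp
  qed
  have gcauchy: "\<exists>K. \<forall>k\<ge>K. \<forall>l\<ge>K. h2_norm (\<lambda>z. g k z - g l z) < e" if e: "e > 0" for e
    unfolding gdiff using cauchy[OF e] by blast
  obtain G where G: "G holomorphic_on ball 0 1" "\<And>z. norm z < 1 \<Longrightarrow> (\<lambda>k. g k z) \<longlonglongrightarrow> G z"
    "\<And>z. norm z \<ge> 1 \<Longrightarrow> G z = 0" "hb G \<Longrightarrow> (\<lambda>k. h2_norm (\<lambda>z. g k z - G z)) \<longlonglongrightarrow> 0"
    using h2_cauchy_limit[OF ghb gcauchy] by blast
  have eq: "f z = J z + B z * G z" for z
  proof (cases "norm z < 1")
    case True
    have "(\<lambda>k. h k z + B z * g k z) \<longlonglongrightarrow> J z + B z * G z" by (intro tendsto_intros J(2) G(2) True)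
    moreover have "h k z + B z * g k z = f z" for k by (simp add: h_def)
    ultimately show ?thesis by (simp add: LIMSEQ_const_iff)
  qed (use J(3) G(3) N_off[OF f] in auto)
  have hbG: "hb G"
  proof (rule bounded_quotient_B[OF G(1)])
    have "(\<lambda>z. B z * G z) = (\<lambda>z. f z - J z)" using eq by (simp add: fun_eq_iff)
    thus "hb (\<lambda>z. B z * G z)" using hb_diff[OF N_hb[OF f] hbJ] by simp
  qed
  have "G \<in> N"
    by (rule N_h2_closed[OF g _ G(4)[OF hbG]]) (use hbG G(3) in \<open>simp add: hinf_iff\<close>)
  from that[OF JN this eq orth] show ?thesis .
qed

end

section \<open>Wandering vectors\<close>

text \<open>The singularity at \<open>w\<close> is removable, and away from \<open>w\<close> the
  quotient is bounded: beyond the radius halfway between \<open>norm w\<close> and 1 the denominator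
  is at least \<open>(1 - norm w) / 2\<close>.\<close>

lemma hb_difference_quotient:
  assumes h: "hb h" and w: "norm w < 1"
  obtains v where "hb v" "\<And>\<zeta>. h \<zeta> = h w + (\<zeta> - w) * v \<zeta>"
proof -
  define v where "v \<zeta> = (if \<zeta> = w then deriv h w else (h \<zeta> - h w) / (\<zeta> - w))" for \<zeta>
  have hol: "v holomorphic_on ball 0 1"
    unfolding v_def by (rule pole_lemma_open[OF hbD[OF h]]) simp
  obtain C where C: "C > 0" "\<And>z. norm z < 1 \<Longrightarrow> norm (h z) \<le> C" using hb_bound[OF h] by blast
  define \<rho> where "\<rho> = (1 + norm w) / 2"
  have \<rho>: "\<rho> < 1" using w by (simp add: \<rho>_def)
  have "compact (v ` cball 0 \<rho>)"
    by (intro compact_continuous_image continuous_on_subset[OF holomorphic_on_imp_continuous_on[OF hol]])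
       (use \<rho> in auto)
  then obtain D where D: "D > 0" "\<And>z. z \<in> cball 0 \<rho> \<Longrightarrow> norm (v z) \<le> D"
    using compact_imp_bounded bounded_pos by (metis image_eqI)
  have "hb v"
  proof (rule hbI[OF hol, where C = "max D (4 * C / (1 - norm w))"])
    fix z :: complex assume z: "norm z < 1"
    show "norm (v z) \<le> max D (4 * C / (1 - norm w))"
    proof (cases "norm z \<le> \<rho>")
      case True thus ?thesis using D(2)[of z] by simp
    next
      case False
      hence dz: "norm (z - w) \<ge> (1 - norm w) / 2"
        using norm_triangle_ineq2[of z w] by (simp add: \<rho>_def field_simps)
      have "norm (h z - h w) \<le> 2 * C"
        using C(2)[OF z] C(2)[OF w] norm_triangle_ineq4[of "h z" "h w"] by linarith
      hence "norm (h z - h w) / norm (z - w) \<le> (2 * C) / ((1 - norm w) / 2)"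
        using dz w C by (intro frac_le) auto
      moreover have "v z = (h z - h w) / (z - w)" using dz w by (auto simp: v_def)
      ultimately show ?thesis by (simp add: norm_divide)
    qed
  qed
  moreover have "h \<zeta> = h w + (\<zeta> - w) * v \<zeta>" for \<zeta> by (simp add: v_def)
  ultimately show ?thesis using that by blast
qed

lemma h2_inner_one_right:
  assumes f: "hb f" shows "h2_inner f (\<lambda>z. 1) = f 0"
proof (rule h2_inner_eqI, rule tendsto_eventually, rule eventually_at_left_1I)
  fix r :: real assume r: "0 < r" "r < 1"
  show "circle_mean r f (\<lambda>z. 1) = f 0"
    using circle_integral_coef[OF hbD[OF f], of r 0] r by (simp add: circle_mean_def coef_def)
qed

context finite_blaschke
begin

text \<open>Since \<open>B 0 = 0\<close>, the kernel takes the value 1 at the origin, so its product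
  with the constant 1 is 1 and \<open>ker_inner_ker\<close> reduces to this normalisation.\<close>

lemma ker_one_norm:
  assumes w: "norm w < 1"
  shows "(1 - (norm w)\<^sup>2) * (h2_norm (ker w (\<lambda>z. 1)))\<^sup>2 = 1"
proof -
  let ?o = "\<lambda>z::complex. 1 :: complex"
  have o: "hb ?o" by auto
  have k: "hb (ker w ?o)" using w o by auto
  have k1: "h2_inner (ker w ?o) ?o = 1" by (simp add: h2_inner_one_right[OF k] ker_def B_zero)
  have "h2_inner ?o (ker w ?o) = 1" using h2_inner_cnj[OF k o] k1 by simp
  hence "of_real ((1 - (norm w)\<^sup>2) * (h2_norm (ker w ?o))\<^sup>2) = (1::complex)"
    using ker_inner_ker[OF w o o] k1 h2_inner_one_right[OF o] by (simp add: h2_inner_self[OF k])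
  thus ?thesis by (simp only: of_real_eq_1_iff)
qed

end

text \<open>The locale instantiated with the single zero 0 has \<open>B z = z\<close>, and
  \<open>ker a\<close> of the constant 1 becomes the ordinary Szego kernel.\<close>

lemma szego_kernel_norm:
  assumes a: "norm a < 1"
  shows "hb (\<lambda>z. 1 / (1 - cnj a * z))" "(1 - (norm a)\<^sup>2) * (h2_norm (\<lambda>z. 1 / (1 - cnj a * z)))\<^sup>2 = 1"
proof -
  interpret Z: finite_blaschke 1 "\<lambda>_. 0" by unfold_locales auto
  have B: "Z.B z = z" if "norm z < 1" for z using that by (simp add: blaschke_def)
  have k: "hb (Z.ker a (\<lambda>z. 1))" by (rule Z.hb_ker[OF a hb_const])
  have hol: "(\<lambda>z. 1 / (1 - cnj a * z)) holomorphic_on ball 0 1"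
    by (intro holomorphic_intros) (use one_minus_moebius_sq(1)[OF a] in auto)
  have kz: "Z.ker a (\<lambda>z. 1) z = 1 / (1 - cnj a * z)" if "norm z < 1" for z
    unfolding Z.ker_def B[OF that] ..
  obtain C where C: "\<And>z. norm z < 1 \<Longrightarrow> norm (Z.ker a (\<lambda>z. 1) z) \<le> C" using hb_bound[OF k] by blast
  show "hb (\<lambda>z. 1 / (1 - cnj a * z))"
    by (rule hbI[OF hol, where C = C]) (use C kz in metis)
  have "h2_norm (Z.ker a (\<lambda>z. 1)) = h2_norm (\<lambda>z. 1 / (1 - cnj a * z))"
    by (rule h2_norm_cong[OF k kz])
  thus "(1 - (norm a)\<^sup>2) * (h2_norm (\<lambda>z. 1 / (1 - cnj a * z)))\<^sup>2 = 1"
    using Z.ker_one_norm[OF a] by simp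
qed

section \<open>The wandering subspace and its dimension\<close>

context shift_invariant
begin

definition wandering :: "(complex \<Rightarrow> complex) \<Rightarrow> bool" where
  "wandering J \<longleftrightarrow> J \<in> N \<and> (\<forall>u\<in>N. h2_inner J (\<lambda>z. B z * u z) = 0)"

lemma wanderingD: "wandering J \<Longrightarrow> J \<in> N" "wandering J \<Longrightarrow> u \<in> N \<Longrightarrow> h2_inner J (\<lambda>z. B z * u z) = 0"
  by (auto simp: wandering_def)

lemma wandering_hb: "wandering J \<Longrightarrow> hb J"
  by (intro N_hb wanderingD)

lemma wandering_left: "wandering J \<Longrightarrow> u \<in> N \<Longrightarrow> h2_inner (\<lambda>z. B z * u z) J = 0"
  using h2_inner_cnj[OF wandering_hb N_hb[OF N_B]] wanderingD by simp

text \<open>The difference \<open>ker w g - g\<close> lies in \<open>B N\<close> and is orthogonal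
  to wandering vectors.\<close>

lemma wandering_ker_right:
  assumes f: "wandering f" and g: "g \<in> N" and w: "norm w < 1"
  shows "h2_inner f (ker w g) = h2_inner f g"
proof -
  have k: "hb (ker w g)" using w N_hb[OF g] by auto
  have "h2_inner f (\<lambda>z. ker w g z - g z) = 0"
    unfolding ker_minus[OF w] by (rule wanderingD(2)[OF f N_scale[OF N_ker[OF w g]]])
  thus ?thesis by (simp add: h2_inner_diff_right[OF k N_hb[OF g] wandering_hb[OF f]])
qed

text \<open>By the conjugate of \<open>wandering_ker_right\<close>,
  \<open>h2_inner (ker w f) g\<close> equals \<open>h2_inner f g\<close>, so two of the three terms
  of \<open>ker_inner_ker\<close> cancel.\<close>

lemma wandering_ker_ker:
  assumes f: "f \<in> N" and g: "wandering g" and w: "norm w < 1"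
  shows "of_real (1 - (norm w)\<^sup>2) * h2_inner (ker w f) (ker w g) = h2_inner f (ker w g)"
proof -
  have "h2_inner (ker w f) g = h2_inner f g"
    using wandering_ker_right[OF g f w] h2_inner_cnj[OF wandering_hb[OF g] N_hb[OF N_ker[OF w f]]]
      h2_inner_cnj[OF wandering_hb[OF g] N_hb[OF f]] by simp
  thus ?thesis using ker_inner_ker[OF w N_hb[OF f] wandering_hb[OF g]] by simp
qed

definition orthonormal :: "nat \<Rightarrow> (nat \<Rightarrow> complex \<Rightarrow> complex) \<Rightarrow> bool" where
  "orthonormal r J \<longleftrightarrow> (\<forall>j<r. wandering (J j)) \<and> (\<forall>i<r. \<forall>j<r. h2_inner (J i) (J j) = (if i = j then 1 else 0))"

lemma orthonormal_ker:
  assumes J: "orthonormal r J" and w: "norm w < 1" and ij: "i < r" "j < r"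
  shows "h2_inner (ker w (J i)) (ker w (J j)) = (if i = j then of_real (1 / (1 - (norm w)\<^sup>2)) else 0)"
proof -
  have W: "wandering (J i)" "wandering (J j)" and e: "h2_inner (J i) (J j) = (if i = j then 1 else 0)"
    using J ij by (auto simp: orthonormal_def)
  have p: "1 - (norm w)\<^sup>2 > 0" using w by (simp add: power_less_one_iff)
  have "of_real (1 - (norm w)\<^sup>2) * h2_inner (ker w (J i)) (ker w (J j)) = (if i = j then 1 else 0)"
    using wandering_ker_ker[OF wanderingD(1)[OF W(1)] W(2) w] wandering_ker_right[OF W(1) wanderingD(1)[OF W(2)] w] e by simp
  moreover have "complex_of_real (1 - (norm w)\<^sup>2) \<noteq> 0" using p by (simp del: of_real_diff)
  ultimately show ?thesis by (simp add: field_simps del: of_real_diff split: if_splits)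
qed

text \<open>Bessel's inequality for the reproducing kernel at \<open>z\<close> and the orthonormal family \<open>B\<^sup>m J\<^sub>j\<close>, summed over \<open>m\<close>.\<close>
lemma orthonormal_sum_le:
  assumes J: "orthonormal r J" and z: "norm z < 1"
  shows "(\<Sum>j<r. (norm (J j z))\<^sup>2) * (1 - (norm z)\<^sup>2) \<le> 1 - (norm (B z))\<^sup>2"
proof -
  define w where "w = B z"
  define S where "S = (\<Sum>j<r. (norm (J j z))\<^sup>2)"
  have w: "norm w < 1" using B_lt_1' by (simp add: w_def)
  have p: "1 - (norm w)\<^sup>2 > 0" "1 - (norm z)\<^sup>2 > 0" using w z by (auto simp: power_less_one_iff)
  have JN: "J j \<in> N" if "j < r" for j using J that by (auto simp: orthonormal_def wandering_def)
  have k: "hb (ker w (J j))" if "j < r" for j using w N_hb[OF JN[OF that]] by auto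
  \<comment> \<open>A multiple of the projection of the evaluation at \<open>z\<close> onto the span
    of the \<open>ker w (J j)\<close>: both \<open>h z\<close> and its squared norm equal
    \<open>S / (1 - (norm w)\<^sup>2)\<close>, so the evaluation bound for \<open>h\<close> becomes
    an inequality for \<open>S\<close>.\<close>
  define h where "h \<zeta> = (\<Sum>j<r. cnj (J j z) * ker w (J j) \<zeta>)" for \<zeta>
  have h: "hb h" unfolding h_def by (intro hb_intros k) auto
  have hz: "h z = of_real (S / (1 - (norm w)\<^sup>2))"
  proof -
    have "1 - cnj w * B z = of_real (1 - (norm w)\<^sup>2)"
      by (simp add: w_def complex_norm_square mult.commute del: of_real_power)
    thus ?thesis
      by (simp add: h_def ker_def S_def complex_norm_square sum_divide_distrib mult.commute del: of_real_power of_real_diff)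
  qed
  have hk: "h2_inner h (ker w (J j)) = cnj (J j z) * of_real (1 / (1 - (norm w)\<^sup>2))" if j: "j < r" for j
  proof -
    have "h2_inner h (ker w (J j)) = (\<Sum>i<r. h2_inner (\<lambda>\<zeta>. cnj (J i z) * ker w (J i) \<zeta>) (ker w (J j)))"
      unfolding h_def by (rule h2_inner_sum_left) (use k j in \<open>auto intro!: hb_intros\<close>)
    also have "\<dots> = (\<Sum>i<r. cnj (J i z) * (if i = j then of_real (1 / (1 - (norm w)\<^sup>2)) else 0))"
      by (intro sum.cong refl) (use k j orthonormal_ker[OF J w] in \<open>auto simp: h2_inner_scale_left\<close>)
    finally show ?thesis using j by (simp add: if_distrib cong: if_cong)
  qed
  have "h2_inner h h = (\<Sum>j<r. h2_inner (\<lambda>\<zeta>. cnj (J j z) * ker w (J j) \<zeta>) h)"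
  proof -
    have "h = (\<lambda>\<zeta>. \<Sum>j<r. cnj (J j z) * ker w (J j) \<zeta>)" by (simp add: fun_eq_iff h_def)
    thus ?thesis
      using h2_inner_sum_left[of "{..<r}" "\<lambda>j \<zeta>. cnj (J j z) * ker w (J j) \<zeta>" h] h
        hb_mult[OF hb_const k] by simp
  qed
  also have "\<dots> = (\<Sum>j<r. of_real ((norm (J j z))\<^sup>2 / (1 - (norm w)\<^sup>2)))"
  proof (intro sum.cong refl)
    fix j assume "j \<in> {..<r}"
    hence j: "j < r" by simp
    have "h2_inner (\<lambda>\<zeta>. cnj (J j z) * ker w (J j) \<zeta>) h = cnj (J j z) * (J j z * of_real (1 / (1 - (norm w)\<^sup>2)))"
      using hk[OF j] h2_inner_cnj[OF h k[OF j]] by (simp add: h2_inner_scale_left[OF k[OF j] h])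
    thus "h2_inner (\<lambda>\<zeta>. cnj (J j z) * ker w (J j) \<zeta>) h = of_real ((norm (J j z))\<^sup>2 / (1 - (norm w)\<^sup>2))"
      by (simp add: complex_norm_square mult.commute del: of_real_power of_real_diff)
  qed
  also have "\<dots> = of_real (S / (1 - (norm w)\<^sup>2))" by (simp only: S_def sum_divide_distrib of_real_sum)
  finally have hn: "(h2_norm h)\<^sup>2 = S / (1 - (norm w)\<^sup>2)" using h2_inner_self[OF h] by (simp only: of_real_eq_iff)
  have "(S / (1 - (norm w)\<^sup>2))\<^sup>2 \<le> S / (1 - (norm w)\<^sup>2) / (1 - (norm z)\<^sup>2)"
    using h2_eval_bound[OF h z] unfolding hz hn norm_of_real power2_abs .
  hence "S * (S * (1 - (norm z)\<^sup>2)) \<le> S * (1 - (norm w)\<^sup>2)"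
    using p by (simp add: power2_eq_square divide_simps mult_ac split: if_splits)
  moreover have "S \<ge> 0" unfolding S_def by (intro sum_nonneg) auto
  ultimately have "S * (1 - (norm z)\<^sup>2) \<le> 1 - (norm w)\<^sup>2"
    using p by (cases "S = 0") auto
  thus ?thesis by (simp add: S_def w_def)
qed

text \<open>Combined with \<open>B_gap\<close> the pointwise bound loses the factor
  \<open>1 - (norm z)\<^sup>2\<close> on both sides. In the limit of circle means each
  \<open>J j\<close> contributes 1 on the left and each zero contributes 1 on the right, by the
  normalisation of the Szego kernel.\<close>

lemma orthonormal_le_n:
  assumes J: "orthonormal r J"
  shows "r \<le> n"
proof -
  define k where "k i z = 1 / (1 - cnj (a i) * z)" for i z
  have k: "hb (k i)" "(1 - (norm (a i))\<^sup>2) * (h2_norm (k i))\<^sup>2 = 1" if "i < n" for i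
    using szego_kernel_norm[OF a_lt[OF that]] by (simp_all add: k_def[abs_def])
  have Jh: "hb (J j)" if "j < r" for j using J that wandering_hb by (auto simp: orthonormal_def)
  have Jn: "(h2_norm (J j))\<^sup>2 = 1" if "j < r" for j
  proof -
    have "h2_inner (J j) (J j) = 1" using J that by (auto simp: orthonormal_def)
    thus ?thesis using h2_inner_self[OF Jh[OF that]] by (simp only: of_real_eq_1_iff)
  qed
  have pt: "(\<Sum>j<r. (norm (J j z))\<^sup>2) \<le> (\<Sum>i<n. (1 - (norm (a i))\<^sup>2) * (norm (k i z))\<^sup>2)" if z: "norm z < 1" for z
  proof -
    have p: "1 - (norm z)\<^sup>2 > 0" using z by (simp add: power_less_one_iff)
    have "(\<Sum>j<r. (norm (J j z))\<^sup>2) * (1 - (norm z)\<^sup>2) \<le> (\<Sum>i<n. (1 - (norm (a i))\<^sup>2) * (norm (k i z))\<^sup>2) * (1 - (norm z)\<^sup>2)"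
      using orthonormal_sum_le[OF J z] B_gap[OF z] by (simp add: k_def norm_divide power_divide mult.commute)
    thus ?thesis using p by (simp add: mult_le_cancel_right)
  qed
  have "(\<Sum>j<r. (h2_norm (J j))\<^sup>2) \<le> (\<Sum>i<n. (1 - (norm (a i))\<^sup>2) * (h2_norm (k i))\<^sup>2)"
  proof (rule tendsto_le)
    show "((\<lambda>s. \<Sum>i<n. (1 - (norm (a i))\<^sup>2) * Re (circle_mean s (k i) (k i))) \<longlongrightarrow> (\<Sum>i<n. (1 - (norm (a i))\<^sup>2) * (h2_norm (k i))\<^sup>2)) (at_left 1)"
      by (intro tendsto_sum tendsto_mult tendsto_const circle_mean_self_tendsto k) auto
    show "((\<lambda>s. \<Sum>j<r. Re (circle_mean s (J j) (J j))) \<longlongrightarrow> (\<Sum>j<r. (h2_norm (J j))\<^sup>2)) (at_left 1)"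
      by (intro tendsto_sum circle_mean_self_tendsto Jh) auto
    show "\<forall>\<^sub>F s in at_left 1. (\<Sum>j<r. Re (circle_mean s (J j) (J j))) \<le> (\<Sum>i<n. (1 - (norm (a i))\<^sup>2) * Re (circle_mean s (k i) (k i)))"
    proof (rule eventually_at_left_1I)
      fix s :: real assume s: "0 < s" "s < 1"
      let ?z = "\<lambda>t. of_real s * cis t"
      have iJ: "(\<lambda>t. (norm (J j (?z t)))\<^sup>2) integrable_on {0..2*pi}" if "j < r" for j
        using s by (intro circle_norm_sq_integrable Jh that) auto
      have ik: "(\<lambda>t. (1 - (norm (a i))\<^sup>2) * (norm (k i (?z t)))\<^sup>2) integrable_on {0..2*pi}" if "i < n" for i
        using s by (intro integrable_on_mult_right circle_norm_sq_integrable k that) auto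
      have "(\<Sum>j<r. integral {0..2*pi} (\<lambda>t. (norm (J j (?z t)))\<^sup>2)) = integral {0..2*pi} (\<lambda>t. \<Sum>j<r. (norm (J j (?z t)))\<^sup>2)"
        by (rule integral_sum[symmetric]) (use iJ in auto)
      also have "\<dots> \<le> integral {0..2*pi} (\<lambda>t. \<Sum>i<n. (1 - (norm (a i))\<^sup>2) * (norm (k i (?z t)))\<^sup>2)"
        by (intro integral_le integrable_sum pt iJ ik) (use s in \<open>auto simp: norm_mult\<close>)
      also have "\<dots> = (\<Sum>i<n. integral {0..2*pi} (\<lambda>t. (1 - (norm (a i))\<^sup>2) * (norm (k i (?z t)))\<^sup>2))"
        by (rule integral_sum) (use ik in auto)
      finally have "(\<Sum>j<r. integral {0..2*pi} (\<lambda>t. (norm (J j (?z t)))\<^sup>2)) / (2*pi)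
         \<le> (\<Sum>i<n. integral {0..2*pi} (\<lambda>t. (1 - (norm (a i))\<^sup>2) * (norm (k i (?z t)))\<^sup>2)) / (2*pi)"
        by (rule divide_right_mono) simp
      thus "(\<Sum>j<r. Re (circle_mean s (J j) (J j))) \<le> (\<Sum>i<n. (1 - (norm (a i))\<^sup>2) * Re (circle_mean s (k i) (k i)))"
        using s by (simp add: Re_circle_mean_self Jh k(1) sum_divide_distrib)
    qed
  qed simp
  thus ?thesis by (simp add: Jn k(2))
qed

end

section \<open>Expansion along a basis of the wandering subspace\<close>

context shift_invariant
begin

text \<open>The lengths of orthonormal families are bounded by \<open>n\<close>, so a longest one
  exists. A wandering vector not reproduced by it would leave a nonzero residual, again wandering,
  whose normalisation extends the family.\<close>

lemma maximal_orthonormal_basis: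
  obtains r J where "orthonormal r J" "r \<le> n"
    "\<And>f z. wandering f \<Longrightarrow> f z = (\<Sum>j<r. h2_inner f (J j) * J j z)"
proof -
  have "\<exists>J. orthonormal 0 J" by (simp add: orthonormal_def)
  moreover have "\<forall>r. (\<exists>J. orthonormal r J) \<longrightarrow> r \<le> n" using orthonormal_le_n by blast
  ultimately obtain r where r: "\<exists>J. orthonormal r J" "\<And>s. (\<exists>J. orthonormal s J) \<Longrightarrow> s \<le> r"
    using ex_has_greatest_nat[of "\<lambda>r. \<exists>J. orthonormal r J" 0 "\<lambda>r. r" "Suc n"]
    by (auto simp: less_Suc_eq_le)
  then obtain J where J: "orthonormal r J" by blast
  have W: "wandering (J j)" if "j < r" for j using J that by (auto simp: orthonormal_def)
  have JN: "J j \<in> N" if "j < r" for j using W[OF that] wanderingD by blast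
  have Jh: "hb (J j)" if "j < r" for j using JN[OF that] N_hb by blast
  have e: "h2_inner (J i) (J j) = (if i = j then 1 else 0)" if "i < r" "j < r" for i j
    using J that by (auto simp: orthonormal_def)
  have "f z = (\<Sum>j<r. h2_inner f (J j) * J j z)" if f: "wandering f" for f z
  proof (rule ccontr)
    assume ne: "f z \<noteq> (\<Sum>j<r. h2_inner f (J j) * J j z)"
    define S where "S z = (\<Sum>j<r. h2_inner f (J j) * J j z)" for z
    define D where "D z = f z - S z" for z
    have SN: "S \<in> N" unfolding S_def by (intro N_sum N_scale JN) auto
    have DN: "D \<in> N" unfolding D_def by (intro N_diff SN wanderingD(1)[OF f])
    have S_inner: "h2_inner S g = (\<Sum>j<r. h2_inner f (J j) * h2_inner (J j) g)" if g: "hb g" for g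
    proof -
      have "h2_inner S g = (\<Sum>j<r. h2_inner (\<lambda>z. h2_inner f (J j) * J j z) g)"
        unfolding S_def by (rule h2_inner_sum_left) (use g Jh in \<open>auto intro!: hb_mult\<close>)
      also have "\<dots> = (\<Sum>j<r. h2_inner f (J j) * h2_inner (J j) g)"
        by (intro sum.cong refl h2_inner_scale_left g Jh) auto
      finally show ?thesis .
    qed
    have D_inner: "h2_inner D g = h2_inner f g - h2_inner S g" if "hb g" for g
      unfolding D_def by (rule h2_inner_diff_left[OF wandering_hb[OF f] N_hb[OF SN] that])
    have DW: "wandering D"
      unfolding wandering_def
    proof (intro conjI DN ballI)
      fix u assume u: "u \<in> N"
      have Bu: "hb (\<lambda>z. B z * u z)" by (rule N_hb[OF N_B[OF u]])
      show "h2_inner D (\<lambda>z. B z * u z) = 0"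
        unfolding D_inner[OF Bu] S_inner[OF Bu] using wanderingD(2)[OF f u] wanderingD(2)[OF W u] by simp
    qed
    have DJ: "h2_inner D (J j) = 0" if j: "j < r" for j
    proof -
      have "(\<Sum>i<r. h2_inner f (J i) * h2_inner (J i) (J j)) = (\<Sum>i<r. if i = j then h2_inner f (J i) else 0)"
        by (intro sum.cong refl) (simp add: e j)
      thus ?thesis unfolding D_inner[OF Jh[OF j]] S_inner[OF Jh[OF j]] using j by simp
    qed
    have z1: "norm z < 1"
    proof (rule ccontr)
      assume "\<not> norm z < 1"
      hence "f z = 0" "S z = 0" using N_off[OF wanderingD(1)[OF f]] N_off[OF SN] by auto
      thus False using ne by (simp add: S_def)
    qed
    have "D z \<noteq> 0" using ne by (simp add: D_def S_def)
    hence nD: "h2_norm D \<noteq> 0" using h2_norm_eq_0_imp[OF N_hb[OF DN] _ z1] by blast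
    define E where "E z = of_real (1 / h2_norm D) * D z" for z
    have EN: "E \<in> N" unfolding E_def by (intro N_scale DN)
    have E_inner: "h2_inner E g = of_real (1 / h2_norm D) * h2_inner D g" if "hb g" for g
      unfolding E_def by (rule h2_inner_scale_left[OF N_hb[OF DN] that])
    have EW: "wandering E"
      unfolding wandering_def using EN E_inner[OF N_hb[OF N_B]] wanderingD(2)[OF DW] by simp
    have EJ: "h2_inner E (J j) = 0" "h2_inner (J j) E = 0" if j: "j < r" for j
      using E_inner[OF Jh[OF j]] DJ[OF j] h2_inner_cnj[OF N_hb[OF EN] Jh[OF j]] by auto
    have EE: "h2_inner E E = 1"
    proof -
      have "h2_norm E = norm (complex_of_real (1 / h2_norm D)) * h2_norm D"
        unfolding E_def by (rule h2_norm_scale[OF N_hb[OF DN]])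
      also have "\<dots> = 1" using nD h2_norm_ge_0[OF N_hb[OF DN]] by (simp add: norm_divide)
      finally show ?thesis using h2_inner_self[OF N_hb[OF EN]] by simp
    qed
    have "orthonormal (Suc r) (J(r := E))"
      unfolding orthonormal_def using W EW e EJ EE by (auto simp: less_Suc_eq)
    hence "Suc r \<le> r" using r(2) by blast
    thus False by simp
  qed
  with that J orthonormal_le_n[OF J] show ?thesis by blast
qed

text \<open>The first \<open>K\<close> steps of the Wold decomposition. Each step splits off a
  wandering part and divides the rest by \<open>B\<close>; Pythagoras and the isometry keep the norm
  of the quotient below that of \<open>f\<close>, a bound uniform in \<open>K\<close>.\<close>

lemma wandering_expansion:
  assumes J: "orthonormal r J" and basis: "\<And>f z. wandering f \<Longrightarrow> f z = (\<Sum>j<r. h2_inner f (J j) * J j z)"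
    and f: "f \<in> N"
  shows "\<exists>g\<in>N. h2_norm g \<le> h2_norm f \<and>
     (\<forall>z. f z = (\<Sum>m<K. B z ^ m * (\<Sum>j<r. h2_inner f (\<lambda>z. B z ^ m * J j z) * J j z)) + B z ^ K * g z)"
  using f
proof (induction K arbitrary: f)
  case 0
  thus ?case by (intro bexI[of _ f]) auto
next
  case (Suc K)
  have W: "wandering (J j)" if "j < r" for j using J that by (auto simp: orthonormal_def)
  have JN: "J j \<in> N" if "j < r" for j using W[OF that] wanderingD by blast
  obtain H f1 where H: "H \<in> N" "f1 \<in> N" "\<And>z. f z = H z + B z * f1 z" "\<And>u. u \<in> N \<Longrightarrow> h2_inner H (\<lambda>z. B z * u z) = 0"
    using orthogonal_decomposition[OF Suc.prems] by blast
  have HW: "wandering H" using H by (simp add: wandering_def)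
  have f_eq: "f = (\<lambda>z. H z + B z * f1 z)" using H(3) by (simp add: fun_eq_iff)
  have Bf1: "hb (\<lambda>z. B z * f1 z)" by (rule N_hb[OF N_B[OF H(2)]])
  have f_inner: "h2_inner f g = h2_inner H g + h2_inner (\<lambda>z. B z * f1 z) g" if "hb g" for g
    unfolding f_eq by (rule h2_inner_add_left[OF N_hb[OF H(1)] Bf1 that])
  have c0: "h2_inner f (J j) = h2_inner H (J j)" if j: "j < r" for j
    using f_inner[OF N_hb[OF JN[OF j]]] wandering_left[OF W[OF j] H(2)] by simp
  \<comment> \<open>Dividing by \<open>B\<close> shifts the coefficients by one index, since the
    wandering part \<open>H\<close> is orthogonal to \<open>B N\<close>.\<close>
  have cS: "h2_inner f (\<lambda>z. B z ^ Suc m * J j z) = h2_inner f1 (\<lambda>z. B z ^ m * J j z)" if j: "j < r" for j m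
  proof -
    have m: "(\<lambda>z. B z ^ m * J j z) \<in> N" by (rule N_B_power[OF JN[OF j]])
    have "h2_inner f (\<lambda>z. B z * (B z ^ m * J j z)) = h2_inner f1 (\<lambda>z. B z ^ m * J j z)"
      using f_inner[OF N_hb[OF N_B[OF m]]] H(4)[OF m] h2_isometry[OF N_hb[OF H(2)] N_hb[OF m]] by simp
    thus ?thesis by (simp add: mult.assoc)
  qed
  obtain g where g: "g \<in> N" "h2_norm g \<le> h2_norm f1"
    "\<And>z. f1 z = (\<Sum>m<K. B z ^ m * (\<Sum>j<r. h2_inner f1 (\<lambda>z. B z ^ m * J j z) * J j z)) + B z ^ K * g z"
    using Suc.IH[OF H(2)] by blast
  have "h2_norm f1 \<le> h2_norm f"
  proof (rule power2_le_imp_le)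
    have m: "hb (\<lambda>z. (-1) * (B z * f1 z))" by (intro hb_mult hb_const Bf1)
    have "(h2_norm (\<lambda>z. H z - (-1) * (B z * f1 z)))\<^sup>2 = (h2_norm H)\<^sup>2 + (h2_norm f1)\<^sup>2"
      using h2_norm_diff_sq[OF N_hb[OF H(1)] m] h2_inner_scale_right[OF Bf1 N_hb[OF H(1)], of "-1"] H(4)[OF H(2)]
        h2_norm_scale[OF Bf1, of "-1"] h2_norm_B[OF N_hb[OF H(2)]] by simp
    thus "(h2_norm f1)\<^sup>2 \<le> (h2_norm f)\<^sup>2" by (simp add: f_eq)
  qed (rule h2_norm_ge_0[OF N_hb[OF Suc.prems]])
  hence gn: "h2_norm g \<le> h2_norm f" using g(2) by simp
  have "f z = (\<Sum>m<Suc K. B z ^ m * (\<Sum>j<r. h2_inner f (\<lambda>z. B z ^ m * J j z) * J j z)) + B z ^ Suc K * g z" for z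
  proof -
    have "(\<Sum>m<Suc K. B z ^ m * (\<Sum>j<r. h2_inner f (\<lambda>z. B z ^ m * J j z) * J j z))
       = (\<Sum>j<r. h2_inner f (J j) * J j z) + (\<Sum>m<K. B z ^ Suc m * (\<Sum>j<r. h2_inner f (\<lambda>z. B z ^ Suc m * J j z) * J j z))"
      unfolding sum.lessThan_Suc_shift by simp
    also have "(\<Sum>j<r. h2_inner f (J j) * J j z) = H z"
      unfolding basis[OF HW, of z] by (intro sum.cong refl) (simp add: c0)
    also have "(\<Sum>m<K. B z ^ Suc m * (\<Sum>j<r. h2_inner f (\<lambda>z. B z ^ Suc m * J j z) * J j z))
        = B z * (\<Sum>m<K. B z ^ m * (\<Sum>j<r. h2_inner f1 (\<lambda>z. B z ^ m * J j z) * J j z))"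
      unfolding sum_distrib_left[of "B z"]
    proof (intro sum.cong refl)
      fix m
      have "(\<Sum>j<r. h2_inner f (\<lambda>z. B z ^ Suc m * J j z) * J j z) = (\<Sum>j<r. h2_inner f1 (\<lambda>z. B z ^ m * J j z) * J j z)"
        by (intro sum.cong refl) (simp add: cS del: power_Suc)
      thus "B z ^ Suc m * (\<Sum>j<r. h2_inner f (\<lambda>z. B z ^ Suc m * J j z) * J j z)
         = B z * (B z ^ m * (\<Sum>j<r. h2_inner f1 (\<lambda>z. B z ^ m * J j z) * J j z))" by (simp only: power_Suc mult.assoc)
    qed
    also have "\<dots> = B z * (f1 z - B z ^ K * g z)" using g(3)[of z] by simp
    finally show ?thesis using H(3)[of z] by (simp add: algebra_simps)
  qed
  thus ?case using g(1) gn by blast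
qed

text \<open>The coordinates inherit the sup bound \<open>C\<close> of \<open>f\<close>: by
  \<open>wandering_ker_ker\<close>, \<open>g j w\<close> is \<open>1 - (norm w)\<^sup>2\<close>
  times a product of two kernels. Their norms are at most \<open>C * x\<close> and equal to
  \<open>x\<close>, where \<open>x\<close> is the norm of \<open>ker w\<close> of the constant 1,
  and \<open>x\<^sup>2\<close> cancels the factor.\<close>

lemma N_representation:
  assumes J: "orthonormal r J" and basis: "\<And>f z. wandering f \<Longrightarrow> f z = (\<Sum>j<r. h2_inner f (J j) * J j z)"
    and f: "f \<in> N"
  obtains g where "\<And>j. j < r \<Longrightarrow> hb (g j)" "\<And>z. f z = (\<Sum>j<r. J j z * g j (B z))"
proof -
  have W: "wandering (J j)" if "j < r" for j using J that by (auto simp: orthonormal_def)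
  have JN: "J j \<in> N" if "j < r" for j using W[OF that] wanderingD by blast
  have Jh: "hb (J j)" if "j < r" for j using JN[OF that] N_hb by blast
  define g where "g j w = h2_inner f (ker w (J j))" for j w
  obtain C where C: "C > 0" "\<And>z. norm z < 1 \<Longrightarrow> norm (f z) \<le> C" using hb_bound[OF N_hb[OF f]] by blast
  have gh: "hb (g j)" if j: "j < r" for j
  proof (rule hbI[where C = C])
    show "g j holomorphic_on ball 0 1"
      unfolding g_def by (rule h2_inner_ker_holomorphic[OF N_hb[OF f] Jh[OF j]])
    fix w :: complex assume w: "norm w < 1"
    define s where "s = 1 - (norm w)\<^sup>2"
    have s: "s > 0" using w by (simp add: s_def power_less_one_iff)
    have kf: "hb (ker w f)" and kJ: "hb (ker w (J j))" using w N_hb[OF f] Jh[OF j] by auto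
    define x where "x = h2_norm (ker w (\<lambda>z. 1))"
    have x: "s * x\<^sup>2 = 1" "x \<ge> 0" using ker_one_norm[OF w] h2_norm_ge_0[OF hb_ker[OF w hb_const]] by (auto simp: s_def x_def)
    have "h2_norm (ker w f) \<le> C * x"
    proof -
      have "ker w f = (\<lambda>z. f z * ker w (\<lambda>z. 1) z)" by (simp add: ker_def fun_eq_iff)
      thus ?thesis unfolding x_def using h2_norm_mult_le[OF N_hb[OF f] hb_ker[OF w hb_const], of C 1] C by simp
    qed
    moreover have "h2_norm (ker w (J j)) = x"
    proof -
      have "of_real ((h2_norm (ker w (J j)))\<^sup>2) = complex_of_real (1 / s)"
        using orthonormal_ker[OF J w j j] h2_inner_self[OF kJ] by (simp add: s_def)
      hence "(h2_norm (ker w (J j)))\<^sup>2 = 1 / s" by (simp only: of_real_eq_iff)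
      also have "\<dots> = x\<^sup>2" using x s by (simp add: field_simps)
      finally show ?thesis using x h2_norm_ge_0[OF kJ] by (simp add: power2_eq_iff_nonneg)
    qed
    ultimately have "norm (h2_inner (ker w f) (ker w (J j))) \<le> C * x * x"
      using h2_cauchy_schwarz[OF kf kJ] mult_right_mono[of "h2_norm (ker w f)" "C * x" x] x by simp
    hence "s * norm (h2_inner (ker w f) (ker w (J j))) \<le> s * (C * x * x)" using s by (intro mult_left_mono) auto
    also have "\<dots> = C * (s * x\<^sup>2)" by (simp add: power2_eq_square)
    also have "\<dots> = C" using x by simp
    also have "s * norm (h2_inner (ker w f) (ker w (J j))) = norm (g j w)"
      unfolding g_def wandering_ker_ker[OF f W[OF j] w, symmetric] norm_mult norm_of_real using s by (simp add: s_def)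
    finally show "norm (g j w) \<le> C" .
  qed
  have eq: "f z = (\<Sum>j<r. J j z * g j (B z))" for z
  proof (cases "norm z < 1")
    case False
    thus ?thesis using N_off[OF f] N_off[OF JN] by simp
  next
    case z: True
    define c where "c m = B z ^ m * (\<Sum>j<r. h2_inner f (\<lambda>z. B z ^ m * J j z) * J j z)" for m
    define Q where "Q = h2_norm f / sqrt (1 - (norm z)\<^sup>2)"
    have p: "0 < 1 - (norm z)\<^sup>2" using z by (simp add: power_less_one_iff)
    \<comment> \<open>The remainder is \<open>B z ^ K\<close> times the value at \<open>z\<close> of
      a function no larger in norm than \<open>f\<close>; at a fixed point this decays
      geometrically.\<close>
    have rem: "norm (f z - (\<Sum>m<K. c m)) \<le> norm (B z) ^ K * Q" for K
    proof -
      obtain h where h: "h \<in> N" "h2_norm h \<le> h2_norm f" "f z = (\<Sum>m<K. c m) + B z ^ K * h z"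
        using wandering_expansion[OF J basis f, of K] unfolding c_def by blast
      have "(norm (h z))\<^sup>2 \<le> (h2_norm h)\<^sup>2 / (1 - (norm z)\<^sup>2)" by (rule h2_eval_bound[OF N_hb[OF h(1)] z])
      also have "\<dots> \<le> (h2_norm f)\<^sup>2 / (1 - (norm z)\<^sup>2)"
        using h(2) p h2_norm_ge_0[OF N_hb[OF h(1)]] by (intro divide_right_mono power_mono) auto
      also have "\<dots> = Q\<^sup>2" using p by (simp add: Q_def power_divide)
      finally have "norm (h z) \<le> Q"
        by (rule power2_le_imp_le) (use p h2_norm_ge_0[OF N_hb[OF f]] in \<open>simp add: Q_def\<close>)
      thus ?thesis using h(3) by (simp add: norm_mult norm_power mult_left_mono)
    qed
    have "(\<lambda>K. norm (B z) ^ K * Q) \<longlonglongrightarrow> 0 * Q"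
      by (intro tendsto_mult tendsto_const LIMSEQ_realpow_zero) (use B_lt_1' in auto)
    hence "(\<lambda>K. norm (B z) ^ K * Q) \<longlonglongrightarrow> 0" by simp
    hence "(\<lambda>K. f z - (\<Sum>m<K. c m)) \<longlonglongrightarrow> 0"
      by (rule Lim_null_comparison[OF always_eventually[OF allI[OF rem]]])
    from tendsto_diff[OF tendsto_const[of "f z"] this] have "c sums f z" by (simp add: sums_def)
    moreover have "c sums (\<Sum>j<r. J j z * g j (B z))"
    proof -
      have "(\<lambda>m. h2_inner f (\<lambda>z. B z ^ m * J j z) * B z ^ m) sums g j (B z)" if "j < r" for j
        unfolding g_def by (rule h2_inner_ker_sums[OF B_lt_1' N_hb[OF f] Jh[OF that]])
      hence "(\<lambda>m. \<Sum>j<r. J j z * (h2_inner f (\<lambda>z. B z ^ m * J j z) * B z ^ m)) sums (\<Sum>j<r. J j z * g j (B z))"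
        by (intro sums_sum sums_mult) simp
      moreover have "c = (\<lambda>m. \<Sum>j<r. J j z * (h2_inner f (\<lambda>z. B z ^ m * J j z) * B z ^ m))"
        unfolding c_def sum_distrib_left by (intro ext sum.cong refl) (simp only: mult_ac)
      ultimately show ?thesis by simp
    qed
    ultimately show ?thesis by (rule sums_unique2)
  qed
  from that[OF gh eq] show ?thesis .
qed

text \<open>Reproducing property. Writing \<open>h\<close> as \<open>h w\<close> plus
  \<open>(\<zeta> - w)\<close> times a bounded quotient, the second part contributes nothing:
  multiplication by \<open>B\<close> and by \<open>w\<close> agree in products with
  \<open>ker w (J j)\<close>.\<close>

lemma h2_inner_comp_ker:
  assumes J: "orthonormal r J" and ij: "i < r" "j < r" and h: "hb h" and w: "norm w < 1"
  shows "h2_inner (\<lambda>z. J i z * h (B z)) (ker w (J j)) = (if i = j then h w else 0)"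
proof -
  have W: "wandering (J i)" "wandering (J j)" and e: "h2_inner (J i) (J j) = (if i = j then 1 else 0)"
    using J ij by (auto simp: orthonormal_def)
  have JN: "J i \<in> N" "J j \<in> N" using W wanderingD by auto
  obtain v where v: "hb v" "\<And>\<zeta>. h \<zeta> = h w + (\<zeta> - w) * v \<zeta>"
    using hb_difference_quotient[OF h w] by blast
  define V where "V z = v (B z) * J i z" for z
  have VN: "V \<in> N" unfolding V_def by (rule N_comp[OF v(1) JN(1)])
  let ?k = "ker w (J j)"
  have kN: "?k \<in> N" by (rule N_ker[OF w JN(2)])
  note hbs = N_hb[OF VN] N_hb[OF kN] N_hb[OF N_B[OF VN]] N_hb[OF JN(1)] N_hb[OF JN(2)]
  have "h2_inner (\<lambda>z. B z * V z) (\<lambda>z. ?k z - J j z) = w * h2_inner V ?k"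
    unfolding ker_minus[OF w] h2_isometry[OF hbs(1) hb_mult[OF hb_const hbs(2)]] h2_inner_scale_right[OF hbs(2,1)] by simp
  hence BV: "h2_inner (\<lambda>z. B z * V z) ?k = w * h2_inner V ?k"
    using h2_inner_diff_right[OF hbs(2,5,3)] wandering_left[OF W(2) VN] by simp
  have "(\<lambda>z. J i z * h (B z)) = (\<lambda>z. h w * J i z + (B z * V z - w * V z))"
    by (rule ext, subst v(2)) (simp add: V_def algebra_simps)
  hence "h2_inner (\<lambda>z. J i z * h (B z)) ?k = h w * h2_inner (J i) ?k + (h2_inner (\<lambda>z. B z * V z) ?k - w * h2_inner V ?k)"
    using hbs by (simp add: h2_inner_add_left h2_inner_diff_left h2_inner_scale_left hb_mult hb_diff hb_const)
  thus ?thesis using BV wandering_ker_right[OF W(1) JN(2) w] e by simp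
qed

text \<open>Pairing the relation with \<open>ker w (J j)\<close> isolates the single value
  \<open>u j w\<close>.\<close>

lemma representation_unique:
  assumes J: "orthonormal r J" and u: "\<And>j. j < r \<Longrightarrow> hb (u j)"
    and eq: "\<And>z. norm z < 1 \<Longrightarrow> (\<Sum>j<r. J j z * u j (B z)) = 0"
    and j: "j < r" and w: "norm w < 1"
  shows "u j w = 0"
proof -
  have JN: "J i \<in> N" if "i < r" for i using J that by (auto simp: orthonormal_def wandering_def)
  have k: "hb (ker w (J j))" using w N_hb[OF JN[OF j]] by auto
  have hi: "hb (\<lambda>z. J i z * u i (B z))" if "i < r" for i
    by (intro hb_mult hb_comp u that N_hb JN)
  have "h2_inner (\<lambda>z. \<Sum>i<r. J i z * u i (B z)) (ker w (J j)) = h2_inner (\<lambda>z. 0) (ker w (J j))"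
    by (intro h2_inner_cong hb_sum hi k eq) auto
  moreover have "h2_inner (\<lambda>z. \<Sum>i<r. J i z * u i (B z)) (ker w (J j)) = (\<Sum>i<r. h2_inner (\<lambda>z. J i z * u i (B z)) (ker w (J j)))"
    by (rule h2_inner_sum_left) (use hi k in auto)
  moreover have "\<dots> = (\<Sum>i<r. if i = j then u i w else 0)"
    by (intro sum.cong refl h2_inner_comp_ker[OF J _ j u w]) auto
  ultimately show ?thesis using h2_inner_zero_left[OF k] j by simp
qed

text \<open>The isometry removes the common power of \<open>B\<close>; any power left over makes the
  second factor an element of \<open>B N\<close>, orthogonal to the wandering
  \<open>J j\<close>.\<close>

lemma orthonormal_B_inner:
  assumes J: "orthonormal r J" and j: "j < r"
  shows "B_inner B (J j)"
proof -
  have W: "wandering (J j)" and e: "h2_inner (J j) (J j) = 1" using J j by (auto simp: orthonormal_def)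
  have JN: "J j \<in> N" using W wanderingD by blast
  have le: "h2_inner (\<lambda>z. B z ^ m * J j z) (\<lambda>z. B z ^ (m + d) * J j z) = (if d = 0 then 1 else 0)" for m d
  proof -
    have d: "(\<lambda>z. B z ^ d * J j z) \<in> N" by (rule N_B_power[OF JN])
    have "h2_inner (\<lambda>z. B z ^ m * J j z) (\<lambda>z. B z ^ m * (B z ^ d * J j z)) = h2_inner (J j) (\<lambda>z. B z ^ d * J j z)"
      by (rule h2_inner_B_power[OF N_hb[OF JN] N_hb[OF d]])
    also have "\<dots> = (if d = 0 then 1 else 0)"
    proof (cases d)
      case (Suc d')
      have "h2_inner (J j) (\<lambda>z. B z * (B z ^ d' * J j z)) = 0" by (rule wanderingD(2)[OF W N_B_power[OF JN]])
      thus ?thesis using Suc by (simp add: mult.assoc)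
    qed (use e in simp)
    finally show ?thesis by (simp add: power_add mult.assoc)
  qed
  have "h2_inner (\<lambda>z. B z ^ m * J j z) (\<lambda>z. B z ^ l * J j z) = (if m = l then 1 else 0)" for m l
  proof (cases "m \<le> l")
    case True
    thus ?thesis using le[of m "l - m"] by auto
  next
    case False
    hence "h2_inner (\<lambda>z. B z ^ l * J j z) (\<lambda>z. B z ^ m * J j z) = 0" using le[of l "m - l"] by auto
    thus ?thesis using False h2_inner_cnj[OF N_hb[OF N_B_power[OF JN, of l]] N_hb[OF N_B_power[OF JN, of m]]] by simp
  qed
  thus ?thesis using JN N_hinf by (auto simp: B_inner_def)
qed

end

section \<open>Linear algebra in spaces of complex functions\<close>

lemma csubspace_scale: "csubspace V \<Longrightarrow> f \<in> V \<Longrightarrow> (\<lambda>z. c * f z) \<in> V"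
  unfolding csubspace_def by blast

lemma csubspace_add: "csubspace V \<Longrightarrow> f \<in> V \<Longrightarrow> g \<in> V \<Longrightarrow> (\<lambda>z. f z + g z) \<in> V"
  unfolding csubspace_def by blast

lemma csubspace_diff: "csubspace V \<Longrightarrow> f \<in> V \<Longrightarrow> g \<in> V \<Longrightarrow> (\<lambda>z. f z - g z) \<in> V"
  using csubspace_add[of V f "\<lambda>z. (-1) * g z"] csubspace_scale[of V g "-1"] by simp

lemma csubspace_sum:
  assumes "csubspace V" "\<And>i. i \<in> I \<Longrightarrow> f i \<in> V"
  shows "(\<lambda>z. \<Sum>i\<in>I. f i z) \<in> V"
  using assms(2)
proof (induction I rule: infinite_finite_induct)
  case (insert x F)
  thus ?case using csubspace_add[OF assms(1), of "f x" "\<lambda>z. \<Sum>i\<in>F. f i z"] by simp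
qed (use assms(1) in \<open>auto simp: csubspace_def\<close>)

lemma sum_fun_apply: "(\<Sum>i\<in>I. f i) z = (\<Sum>i\<in>I. f i (z::'a) :: complex)"
  by (induction I rule: infinite_finite_induct) auto

text \<open>The \<open>e j\<close> may be linearly dependent, so the count is made in the function
  space: the given vector outside \<open>M\<close> is independent of any basis of the part of
  \<open>M\<close> inside the span, which leaves at most \<open>d - 1\<close> basis vectors.
  Normalisation concerns a chosen coefficient vector, not the function.\<close>

lemma normalized_basis_of_proper_subspace:
  fixes e :: "nat \<Rightarrow> complex \<Rightarrow> complex" and M :: "(complex \<Rightarrow> complex) set"
  assumes M: "csubspace M" and x: "(\<lambda>z. \<Sum>j<d. \<alpha>0 j * e j z) \<notin> M"
  obtains k \<beta> where "k + 1 \<le> d" "\<forall>i<k. (\<Sum>j<d. (norm (\<beta> j i))\<^sup>2) = 1"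
    "\<forall>i<k. (\<lambda>z. \<Sum>j<d. \<beta> j i * e j z) \<in> M"
    "\<forall>\<alpha>. (\<lambda>z. \<Sum>j<d. \<alpha> j * e j z) \<in> M \<longrightarrow>
        (\<exists>c. \<forall>z. (\<Sum>j<d. \<alpha> j * e j z) = (\<Sum>i<k. c i * (\<Sum>j<d. \<beta> j i * e j z)))"
    "\<forall>c. (\<forall>z. (\<Sum>i<k. c i * (\<Sum>j<d. \<beta> j i * e j z)) = 0) \<longrightarrow> (\<forall>i<k. c i = 0)"
proof -
  interpret fs: vector_space "\<lambda>(c::complex) (f::complex \<Rightarrow> complex) z. c * f z"
    by unfold_locales (auto simp: fun_eq_iff algebra_simps)
  have sub_iff: "fs.subspace V \<longleftrightarrow> csubspace V" for V
    by (simp add: fs.subspace_def csubspace_def plus_fun_def zero_fun_def)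
  define T where "T = e ` {..<d}"
  have T: "finite T" "card T \<le> d" unfolding T_def using card_image_le[of "{..<d}" e] by auto
  have spanT: "csubspace (fs.span T)" using fs.subspace_span sub_iff by blast
  have comb_in: "(\<lambda>z. \<Sum>j<d. \<alpha> j * e j z) \<in> fs.span T" for \<alpha>
    by (intro csubspace_sum[OF spanT] csubspace_scale[OF spanT] fs.span_base) (auto simp: T_def)
  have in_comb: "\<exists>b. \<forall>z. y z = (\<Sum>j<d. b j * e j z)" if y: "y \<in> fs.span T" for y
  proof -
    define V where "V = {y. \<exists>b. \<forall>z. y z = (\<Sum>j<d. b j * e j z)}"
    have V: "y \<in> V \<longleftrightarrow> (\<exists>b. \<forall>z. y z = (\<Sum>j<d. b j * e j z))" for y by (simp add: V_def)
    have "csubspace V"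
      unfolding csubspace_def
    proof (intro conjI ballI allI)
      show "(\<lambda>z. 0) \<in> V" unfolding V by (rule exI[of _ "\<lambda>_. 0"]) simp
    next
      fix f g assume "f \<in> V" "g \<in> V"
      then obtain b b' where "\<forall>z. f z = (\<Sum>j<d. b j * e j z)" "\<forall>z. g z = (\<Sum>j<d. b' j * e j z)"
        unfolding V by blast
      thus "(\<lambda>z. f z + g z) \<in> V" unfolding V
        by (intro exI[of _ "\<lambda>j. b j + b' j"]) (simp add: distrib_right sum.distrib)
    next
      fix c f assume "f \<in> V"
      then obtain b where "\<forall>z. f z = (\<Sum>j<d. b j * e j z)" unfolding V by blast
      thus "(\<lambda>z. c * f z) \<in> V" unfolding V
        by (intro exI[of _ "\<lambda>j. c * b j"]) (simp add: sum_distrib_left mult.assoc)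
    qed
    moreover have "T \<subseteq> V"
    proof
      fix y assume "y \<in> T"
      then obtain i where i: "i < d" "y = e i" by (auto simp: T_def)
      have "y z = (\<Sum>j<d. (if j = i then 1 else 0) * e j z)" for z
        using i by (simp add: if_distrib[of "\<lambda>x. x * _"] cong: if_cong)
      thus "y \<in> V" by (auto simp: V_def)
    qed
    ultimately have "fs.span T \<subseteq> V" using fs.span_minimal sub_iff by blast
    thus ?thesis using y by (auto simp: V_def)
  qed
  obtain S where S: "S \<subseteq> M \<inter> fs.span T" "fs.independent S" "M \<inter> fs.span T \<subseteq> fs.span S"
    using fs.maximal_independent_subset by blast
  have spanS: "fs.span S \<subseteq> M" using fs.span_minimal[of S M] S(1) M sub_iff by blast
  let ?x = "\<lambda>z. \<Sum>j<d. \<alpha>0 j * e j z"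
  have xS: "?x \<notin> fs.span S" using x spanS by blast
  \<comment> \<open>Adjoining the vector outside \<open>M\<close> preserves independence; this extra
    element is the 1 in \<open>k + 1 \<le> d\<close>.\<close>
  have ind: "fs.independent (insert ?x S)" by (rule fs.independent_insertI[OF xS S(2)])
  have "insert ?x S \<subseteq> fs.span T" using S(1) comb_in[of \<alpha>0] by simp
  hence fin: "finite (insert ?x S)" "card (insert ?x S) \<le> card T"
    using fs.independent_span_bound[OF T(1) ind] by simp_all
  have finS: "finite S" using fin by simp
  have "?x \<notin> S" using xS fs.span_base by blast
  define k where "k = card S"
  have kd: "k + 1 \<le> d" using fin T \<open>?x \<notin> S\<close> by (simp add: k_def)
  obtain s where s: "bij_betw s {..<k} S" using ex_bij_betw_nat_finite[OF finS] by (auto simp: k_def atLeast0LessThan)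
  have sS: "s i \<in> S" if "i < k" for i using s that by (auto simp: bij_betw_def)
  have "\<forall>i. \<exists>b. i < k \<longrightarrow> (\<forall>z. s i z = (\<Sum>j<d. b j * e j z))"
    using in_comb S(1) sS by blast
  then obtain b where b: "\<And>i z. i < k \<Longrightarrow> s i z = (\<Sum>j<d. b i j * e j z)" by metis
  define \<nu> where "\<nu> i = sqrt (\<Sum>j<d. (norm (b i j))\<^sup>2)" for i
  \<comment> \<open>A vanishing coefficient vector would make \<open>s i\<close> the zero function,
    which no independent set contains.\<close>
  have \<nu>: "\<nu> i > 0" if i: "i < k" for i
  proof (rule ccontr)
    assume "\<not> \<nu> i > 0"
    moreover have nn: "0 \<le> (\<Sum>j<d. (norm (b i j))\<^sup>2)" by (intro sum_nonneg) auto
    ultimately have "(\<Sum>j<d. (norm (b i j))\<^sup>2) = 0" by (simp add: \<nu>_def)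
    hence "b i j = 0" if "j < d" for j using that by (simp add: sum_nonneg_eq_0_iff)
    hence "s i = 0" using b[OF i] by (simp add: fun_eq_iff)
    thus False using sS[OF i] S(2) fs.dependent_zero by metis
  qed
  define \<beta> where "\<beta> j i = b i j / of_real (\<nu> i)" for j i
  have \<beta>s: "(\<Sum>j<d. \<beta> j i * e j z) = s i z / of_real (\<nu> i)" if "i < k" for i z
    by (simp add: \<beta>_def b[OF that] sum_divide_distrib)
  have reindex: "(\<Sum>v\<in>S. u v * v z) = (\<Sum>i<k. u (s i) * s i z)" for u :: "(complex \<Rightarrow> complex) \<Rightarrow> complex" and z
    by (rule sum.reindex_bij_betw[OF s, symmetric])
  show ?thesis
  proof (rule that[of k \<beta>, OF kd]; intro allI impI)
    fix i assume i: "i < k"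
    have "(\<Sum>j<d. (norm (\<beta> j i))\<^sup>2) = (\<Sum>j<d. (norm (b i j))\<^sup>2) / (\<nu> i)\<^sup>2"
      using \<nu>[OF i] by (simp add: \<beta>_def norm_divide power_divide sum_divide_distrib)
    also have "(\<nu> i)\<^sup>2 = (\<Sum>j<d. (norm (b i j))\<^sup>2)" by (simp add: \<nu>_def sum_nonneg)
    finally show "(\<Sum>j<d. (norm (\<beta> j i))\<^sup>2) = 1"
      using \<nu>[OF i] by (auto simp: \<nu>_def)
    have "(\<lambda>z. (1 / of_real (\<nu> i)) * s i z) \<in> M"
      using sS[OF i] S(1) by (intro csubspace_scale[OF M]) auto
    thus "(\<lambda>z. \<Sum>j<d. \<beta> j i * e j z) \<in> M" using \<beta>s[OF i] by simp
  next
    fix \<alpha> assume "(\<lambda>z. \<Sum>j<d. \<alpha> j * e j z) \<in> M"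
    hence "(\<lambda>z. \<Sum>j<d. \<alpha> j * e j z) \<in> fs.span S" using S(3) comb_in by blast
    then obtain u where u: "(\<lambda>z. \<Sum>j<d. \<alpha> j * e j z) = (\<Sum>v\<in>S. (\<lambda>z. u v * v z))"
      unfolding fs.span_finite[OF finS] by blast
    have "(\<Sum>j<d. \<alpha> j * e j z) = (\<Sum>i<k. (u (s i) * of_real (\<nu> i)) * (\<Sum>j<d. \<beta> j i * e j z))" for z
    proof -
      have "(\<Sum>j<d. \<alpha> j * e j z) = (\<Sum>i<k. u (s i) * s i z)"
        using fun_cong[OF u, of z] by (simp add: sum_fun_apply reindex)
      also have "\<dots> = (\<Sum>i<k. (u (s i) * of_real (\<nu> i)) * (\<Sum>j<d. \<beta> j i * e j z))"
      proof (intro sum.cong refl)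
        fix i assume "i \<in> {..<k}"
        thus "u (s i) * s i z = u (s i) * of_real (\<nu> i) * (\<Sum>j<d. \<beta> j i * e j z)"
          using \<nu>[of i] by (simp add: \<beta>s)
      qed
      finally show ?thesis .
    qed
    thus "\<exists>c. \<forall>z. (\<Sum>j<d. \<alpha> j * e j z) = (\<Sum>i<k. c i * (\<Sum>j<d. \<beta> j i * e j z))" by (intro exI allI)
  next
    fix c i assume z: "\<forall>z. (\<Sum>i<k. c i * (\<Sum>j<d. \<beta> j i * e j z)) = 0" and i: "i < k"
    define t where "t = the_inv_into {..<k} s"
    have t: "t (s i) = i" if "i < k" for i
      unfolding t_def by (rule the_inv_into_f_f) (use s that in \<open>auto simp: bij_betw_def\<close>)
    \<comment> \<open>Coefficients indexed by \<open>i < k\<close> are moved to the set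
      \<open>S\<close> through the inverse of the enumeration, with the scaling undone, so that
      independence of \<open>S\<close> applies.\<close>
    define u where "u v = c (t v) / of_real (\<nu> (t v))" for v
    have "(\<Sum>v\<in>S. u v * v z) = 0" for z
    proof -
      have "(\<Sum>v\<in>S. u v * v z) = (\<Sum>i<k. c i * (\<Sum>j<d. \<beta> j i * e j z))"
        unfolding reindex by (intro sum.cong refl) (simp add: u_def t \<beta>s)
      thus ?thesis using z by simp
    qed
    hence "(\<Sum>v\<in>S. (\<lambda>z. u v * v z)) = 0" by (simp add: fun_eq_iff sum_fun_apply)
    hence "u (s i) = 0" using S(2)[unfolded fs.dependent_finite[OF finS]] sS[OF i] by blast
    thus "c i = 0" using \<nu>[OF i] t[OF i] by (simp add: u_def)
  qed
qed

lemma sum_lessThan_double: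
  fixes F :: "nat \<Rightarrow> 'a :: comm_monoid_add"
  shows "(\<Sum>j<2*r. F j) = (\<Sum>j<r. F (2*j) + F (2*j+1))"
  by (induction r) (auto simp: add.assoc)

section \<open>Expansion modulo \<open>B\<^sup>2 N\<close>\<close>

context shift_invariant
begin

text \<open>Each coordinate function is expanded at 0 to second order by two difference quotients,
  so the remainder is again bounded. Thus the \<open>J j\<close> and \<open>B J j\<close> span
  \<open>N\<close> modulo \<open>B\<^sup>2 N\<close>.\<close>

lemma N_two_term_expansion:
  assumes J: "orthonormal r J" and basis: "\<And>f z. wandering f \<Longrightarrow> f z = (\<Sum>j<r. h2_inner f (J j) * J j z)"
    and f: "f \<in> N"
  obtains h p q where "\<forall>j<r. hb (h j)"
    "\<forall>z. f z = (\<Sum>j<r. (p j + q j * B z) * J j z) + (\<Sum>j<r. (B z)\<^sup>2 * (h j (B z) * J j z))"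
proof -
  obtain g where g: "\<And>j. j < r \<Longrightarrow> hb (g j)" "\<And>z. f z = (\<Sum>j<r. J j z * g j (B z))"
    using N_representation[OF J basis f] by blast
  have "\<exists>h c. hb h \<and> (\<forall>w. g j w = g j 0 + w * (c + w * h w))" if j: "j < r" for j
  proof -
    obtain v where v: "hb v" "\<And>w. g j w = g j 0 + (w - 0) * v w" using hb_difference_quotient[OF g(1)[OF j], of 0] by auto
    obtain h where h: "hb h" "\<And>w. v w = v 0 + (w - 0) * h w" using hb_difference_quotient[OF v(1), of 0] by auto
    have "g j w = g j 0 + w * (v 0 + w * h w)" for w using v(2)[of w] h(2)[of w] by simp
    thus ?thesis using h(1) by blast
  qed
  hence "\<forall>j. \<exists>h c. j < r \<longrightarrow> hb h \<and> (\<forall>w. g j w = g j 0 + w * (c + w * h w))" by blast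
  then obtain h q where hq: "\<And>j. j < r \<Longrightarrow> hb (h j)" "\<And>j w. j < r \<Longrightarrow> g j w = g j 0 + w * (q j + w * h j w)"
    by metis
  show ?thesis
  proof (rule that[of h "\<lambda>j. g j 0" q]; intro allI impI hq(1))
    fix z
    have "f z = (\<Sum>j<r. (g j 0 + q j * B z) * J j z + (B z)\<^sup>2 * (h j (B z) * J j z))"
      unfolding g(2)[of z]
    proof (intro sum.cong refl)
      fix j assume "j \<in> {..<r}"
      hence *: "g j (B z) = g j 0 + B z * (q j + B z * h j (B z))" by (intro hq(2)) simp
      show "J j z * g j (B z) = (g j 0 + q j * B z) * J j z + (B z)\<^sup>2 * (h j (B z) * J j z)"
        unfolding * by (simp add: power2_eq_square algebra_simps)
    qed
    thus "f z = (\<Sum>j<r. (g j 0 + q j * B z) * J j z) + (\<Sum>j<r. (B z)\<^sup>2 * (h j (B z) * J j z))"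
      by (simp add: sum.distrib)
  qed
qed

text \<open>All terms belonging to \<open>J j\<close> are merged into one coordinate function
  \<open>p j + q j * w + w\<^sup>2 * h j w\<close>, which vanishes on the disc by
  \<open>representation_unique\<close>. Its behaviour at 0 determines \<open>p j\<close> and then
  \<open>q j\<close>.\<close>

lemma two_term_unique:
  assumes J: "orthonormal r J" and h: "\<And>j. j < r \<Longrightarrow> hb (h j)"
    and eq: "\<And>z. norm z < 1 \<Longrightarrow> (\<Sum>j<r. (p j + q j * B z) * J j z) + (\<Sum>j<r. (B z)\<^sup>2 * (h j (B z) * J j z)) = 0"
    and j: "j < r"
  shows "p j = 0" "q j = 0" "\<And>w. norm w < 1 \<Longrightarrow> w\<^sup>2 * h j w = 0"
proof -
  define u where "u j w = p j + q j * w + w\<^sup>2 * h j w" for j w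
  have hid: "hb (\<lambda>w. w)" by (rule hbI[where C = 1]) (auto intro: holomorphic_intros)
  have u: "hb (u j)" if "j < r" for j
    unfolding u_def by (intro hb_intros hid h that)
  have sum0: "(\<Sum>j<r. J j z * u j (B z)) = 0" if "norm z < 1" for z
    using eq[OF that] by (simp add: u_def sum.distrib[symmetric] algebra_simps)
  have u0: "u j w = 0" if "norm w < 1" for w
    by (rule representation_unique[of r J u, OF J u sum0 j that])
  show p: "p j = 0" using u0[of 0] by (simp add: u_def)
  obtain C where C: "C > 0" "\<And>w. norm w < 1 \<Longrightarrow> norm (h j w) \<le> C" using hb_bound[OF h[OF j]] by blast
  show q: "q j = 0"
  proof (rule ccontr)
    assume q: "q j \<noteq> 0"
    \<comment> \<open>A point so close to 0 that the quadratic term, at most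
      \<open>\<epsilon>\<^sup>2 * C\<close>, cannot cancel the linear term.\<close>
    define \<epsilon> where "\<epsilon> = min (1/2) (norm (q j) / (2 * C))"
    have \<epsilon>: "0 < \<epsilon>" "\<epsilon> < 1" "\<epsilon> * C < norm (q j)"
    proof -
      show "0 < \<epsilon>" "\<epsilon> < 1" using q C by (auto simp: \<epsilon>_def)
      have "\<epsilon> * C \<le> norm (q j) / (2 * C) * C" using C by (intro mult_right_mono) (auto simp: \<epsilon>_def)
      also have "\<dots> = norm (q j) / 2" using C by simp
      also have "\<dots> < norm (q j)" using q by simp
      finally show "\<epsilon> * C < norm (q j)" .
    qed
    have n\<epsilon>: "norm (complex_of_real \<epsilon>) < 1" using \<epsilon> by simp
    have "of_real \<epsilon> * (q j + of_real \<epsilon> * h j (of_real \<epsilon>)) = 0"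
      using u0[OF n\<epsilon>] p by (simp add: u_def power2_eq_square algebra_simps)
    hence "q j = - (of_real \<epsilon> * h j (of_real \<epsilon>))" using \<epsilon> by (simp add: eq_neg_iff_add_eq_0)
    hence "norm (q j) = \<epsilon> * norm (h j (of_real \<epsilon>))" using \<epsilon> by (simp add: norm_mult)
    also have "\<dots> \<le> \<epsilon> * C" using \<epsilon> C(2)[OF n\<epsilon>] by (intro mult_left_mono) auto
    finally show False using \<epsilon> by simp
  qed
  show "w\<^sup>2 * h j w = 0" if "norm w < 1" for w using u0[OF that] p q by (simp add: u_def)
qed

end

section \<open>The position of \<open>M\<close> between \<open>B\<^sup>2 N\<close> and
  \<open>N\<close>\<close>

theorem theorem3p3:
  fixes n :: nat and a :: "nat \<Rightarrow> complex" and M :: "(complex \<Rightarrow> complex) set"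
  assumes "n \<ge> 1" and "\<forall>i<n. a i \<in> ball 0 1" and "a 0 = 0"
    and "csubspace M" and "M \<subseteq> hinf" and "wstar_closed M"
    and "invariant_under (hinf1 (blaschke n a)) M"
    and "\<not> invariant_under (hinf_of (blaschke n a)) M"
  shows "\<exists>(r::nat) (k::nat) (J::nat \<Rightarrow> complex \<Rightarrow> complex) (\<beta>::nat \<Rightarrow> nat \<Rightarrow> complex).
     r \<le> n \<and> k + 1 \<le> 2 * r \<and>
     (\<forall>j<r. B_inner (blaschke n a) (J j)) \<and>
     (\<forall>i<k. (\<Sum>j<2*r. (cmod (\<beta> j i))\<^sup>2) = 1) \<and>
     M = {(\<lambda>z. (\<Sum>i<k. c i * Bphi (blaschke n a) J \<beta> r i z)
               + (\<Sum>j<r. (blaschke n a z)\<^sup>2 * J j z * h j z))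
          | c h. \<forall>j<r. h j \<in> hinf_of (blaschke n a)} \<and>
     (\<forall>c h. (\<forall>j<r. h j \<in> hinf_of (blaschke n a)) \<and>
        (\<lambda>z. (\<Sum>i<k. c i * Bphi (blaschke n a) J \<beta> r i z)
               + (\<Sum>j<r. (blaschke n a z)\<^sup>2 * J j z * h j z)) = (\<lambda>z. 0)
        \<longrightarrow> (\<forall>i<k. (\<lambda>z. c i * Bphi (blaschke n a) J \<beta> r i z) = (\<lambda>z. 0)) \<and>
            (\<forall>j<r. (\<lambda>z. (blaschke n a z)\<^sup>2 * J j z * h j z) = (\<lambda>z. 0)))"
proof -
  interpret finite_blaschke n a by unfold_locales (use assms in auto)
  note Msub = assms(4) and Mhinf = assms(5)
  have Mhb: "hb f" and Moff: "\<And>z. norm z \<ge> 1 \<Longrightarrow> f z = 0" if "f \<in> M" for f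
    using Mhinf that by (auto simp: hinf_iff)
  \<comment> \<open>For \<open>m \<noteq> 1\<close> the power \<open>B ^ m\<close> is a one-term
    element of the spanning set of \<open>hinf1 B\<close> and so belongs to its closure.\<close>
  have MB: "(\<lambda>z. B z ^ m * f z) \<in> M" if f: "f \<in> M" and m: "m \<noteq> 1" for f m
  proof -
    have "(\<lambda>z. if z \<in> ball 0 1 then (\<Sum>m\<in>{m}. 1 * B z ^ m) else 0) \<in> hinf1 B"
      unfolding hinf1_def wstar_closure_def using m
      by (intro InterI) (auto intro!: exI[of _ "{m}"] exI[of _ "\<lambda>_. 1"] elim!: subsetD)
    from assms(7)[unfolded invariant_under_def, rule_format, OF this f]
    have "(\<lambda>z. (if z \<in> ball 0 1 then (\<Sum>m\<in>{m}. 1 * B z ^ m) else 0) * f z) \<in> M" .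
    also have "(\<lambda>z. (if z \<in> ball 0 1 then (\<Sum>m\<in>{m}. 1 * B z ^ m) else 0) * f z) = (\<lambda>z. B z ^ m * f z)"
      using Moff[OF f] by (auto simp: fun_eq_iff)
    finally show ?thesis .
  qed
  have Mbp: "bp_closed M" by (rule wstar_closed_imp_bp_closed[OF assms(6)])
  \<comment> \<open>Both exponents are needed for invariance under \<open>B\<close>:
    \<open>B\<^sup>2 (B f)\<close> is the cubic condition for \<open>f\<close>, and
    \<open>B\<^sup>3 (B f) = B\<^sup>2 (B\<^sup>2 f)\<close> follows from the quadratic one by
    \<open>MB\<close>.\<close>
  define N where "N = {f \<in> hinf. (\<lambda>z. B z ^ 2 * f z) \<in> M \<and> (\<lambda>z. B z ^ 3 * f z) \<in> M}"
  have hinf_B: "(\<lambda>z. B z ^ m * f z) \<in> hinf" if "f \<in> hinf" for f m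
    using that by (auto simp: hinf_iff intro!: hb_mult hb_power hb_B)
  interpret shift_invariant n a N
  proof
    show "csubspace N"
      unfolding csubspace_def
    proof (intro conjI ballI allI)
      show "(\<lambda>z. 0) \<in> N" using Msub by (auto simp: N_def hinf_iff csubspace_def)
    next
      fix f g assume "f \<in> N" "g \<in> N"
      thus "(\<lambda>z. f z + g z) \<in> N"
        using csubspace_add[OF Msub, of "\<lambda>z. B z ^ 2 * f z" "\<lambda>z. B z ^ 2 * g z"]
          csubspace_add[OF Msub, of "\<lambda>z. B z ^ 3 * f z" "\<lambda>z. B z ^ 3 * g z"]
        by (auto simp: N_def hinf_iff distrib_left)
    next
      fix c f assume "f \<in> N"
      thus "(\<lambda>z. c * f z) \<in> N"
        using csubspace_scale[OF Msub, of "\<lambda>z. B z ^ 2 * f z" c] csubspace_scale[OF Msub, of "\<lambda>z. B z ^ 3 * f z" c]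
        by (auto simp: N_def hinf_iff mult_ac)
    qed
    show "N \<subseteq> hinf" by (auto simp: N_def)
    show "bp_closed N"
      unfolding bp_closed_def
    proof (intro allI impI, elim conjE)
      fix fk f C assume fk: "\<forall>k. fk k \<in> N" and C: "\<forall>k z. norm z < 1 \<longrightarrow> norm (fk k z) \<le> C"
        and f: "f \<in> hinf" and lim: "\<forall>z. norm z < 1 \<longrightarrow> (\<lambda>k. fk k z) \<longlonglongrightarrow> f z"
      have "(\<lambda>z. B z ^ m * f z) \<in> M" if "m \<in> {2, 3}" for m
      proof (rule bp_closedD[OF Mbp, where C = "1 * C"])
        show "(\<lambda>z. B z ^ m * fk k z) \<in> M" for k using fk that by (auto simp: N_def)
        show "norm (B z ^ m * fk k z) \<le> 1 * C" if "norm z < 1" for k z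
          unfolding norm_mult norm_power using C that B_lt_1'[of z]
          by (intro mult_mono power_le_one) auto
        show "(\<lambda>k. B z ^ m * fk k z) \<longlonglongrightarrow> B z ^ m * f z" if "norm z < 1" for z
          using lim that by (intro tendsto_mult tendsto_const) auto
      qed (rule hinf_B[OF f])
      thus "f \<in> N" using f by (simp add: N_def)
    qed
    show "(\<lambda>z. B z * f z) \<in> N" if "f \<in> N" for f
    proof -
      have f: "f \<in> hinf" "(\<lambda>z. B z ^ 2 * f z) \<in> M" "(\<lambda>z. B z ^ 3 * f z) \<in> M" using that by (auto simp: N_def)
      have "(\<lambda>z. B z ^ 2 * (B z * f z)) \<in> M"
        using f(3) by (simp add: power2_eq_square power3_eq_cube mult.assoc)
      moreover have "(\<lambda>z. B z ^ 3 * (B z * f z)) \<in> M"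
        using MB[OF f(2), of 2] by (simp add: power2_eq_square power3_eq_cube mult.assoc)
      ultimately show ?thesis using hinf_B[OF f(1), of 1] by (simp add: N_def)
    qed
  qed
  have MN: "M \<subseteq> N" using MB Mhinf by (auto simp: N_def)
  have B2N: "(\<lambda>z. (B z)\<^sup>2 * f z) \<in> M" if "f \<in> N" for f using that by (simp add: N_def)
  obtain r J where J: "orthonormal r J" and rn: "r \<le> n"
    and basis: "\<And>f z. wandering f \<Longrightarrow> f z = (\<Sum>j<r. h2_inner f (J j) * J j z)"
    using maximal_orthonormal_basis by blast
  have JN: "J j \<in> N" if "j < r" for j using J that by (auto simp: orthonormal_def wandering_def)
  \<comment> \<open>The \<open>J j\<close> and \<open>B J j\<close> interleaved: even positions
    carry \<open>J j\<close>, odd ones \<open>B J j\<close>, matching the indices \<open>2*j\<close>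
    and \<open>2*j+1\<close> in \<open>Bphi\<close>.\<close>
  define e where "e i z = (if even i then J (i div 2) z else B z * J (i div 2) z)" for i z
  have comb: "(\<Sum>i<2*r. \<alpha> i * e i z) = (\<Sum>j<r. (\<alpha> (2*j) + \<alpha> (2*j+1) * B z) * J j z)" for \<alpha> z
    unfolding sum_lessThan_double by (simp add: e_def distrib_right mult.assoc)
  have tail: "(\<lambda>z. \<Sum>j<r. (B z)\<^sup>2 * (h j (B z) * J j z)) \<in> M" if "\<And>j. j < r \<Longrightarrow> hb (h j)" for h
    by (rule csubspace_sum[OF Msub], rule B2N, rule N_comp[OF that JN]) auto
  have decomp: "\<exists>\<alpha> h. (\<forall>j<r. hb (h j)) \<and> (\<forall>z. f z = (\<Sum>i<2*r. \<alpha> i * e i z) + (\<Sum>j<r. (B z)\<^sup>2 * (h j (B z) * J j z)))"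
    if f: "f \<in> N" for f
  proof -
    obtain h p q where pqh: "\<forall>j<r. hb (h j)"
      "\<forall>z. f z = (\<Sum>j<r. (p j + q j * B z) * J j z) + (\<Sum>j<r. (B z)\<^sup>2 * (h j (B z) * J j z))"
      by (rule N_two_term_expansion[OF J basis f])
    define \<alpha> where "\<alpha> i = (if even i then p (i div 2) else q (i div 2))" for i
    have "(\<Sum>i<2*r. \<alpha> i * e i z) = (\<Sum>j<r. (p j + q j * B z) * J j z)" for z
      unfolding comb by (simp add: \<alpha>_def)
    thus ?thesis using pqh by (intro exI[of _ \<alpha>] exI[of _ h]) auto
  qed
  \<comment> \<open>Here the failure of invariance under \<open>hinf_of B\<close> enters: otherwise
    \<open>M = N\<close>, which is invariant by \<open>N_comp\<close>. The existence of such a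
    combination also forces \<open>r\<close> to be positive.\<close>
  have "\<exists>\<alpha>. (\<lambda>z. \<Sum>i<2*r. \<alpha> i * e i z) \<notin> M"
  proof (rule ccontr)
    assume all: "\<not> (\<exists>\<alpha>. (\<lambda>z. \<Sum>i<2*r. \<alpha> i * e i z) \<notin> M)"
    have "N \<subseteq> M"
    proof
      fix f assume "f \<in> N"
      then obtain \<alpha> h where "\<forall>j<r. hb (h j)" and f: "\<forall>z. f z = (\<Sum>i<2*r. \<alpha> i * e i z) + (\<Sum>j<r. (B z)\<^sup>2 * (h j (B z) * J j z))"
        using decomp by blast
      hence "(\<lambda>z. (\<Sum>i<2*r. \<alpha> i * e i z) + (\<Sum>j<r. (B z)\<^sup>2 * (h j (B z) * J j z))) \<in> M"
        using all tail[of h] by (intro csubspace_add[OF Msub]) auto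
      also have "(\<lambda>z. (\<Sum>i<2*r. \<alpha> i * e i z) + (\<Sum>j<r. (B z)\<^sup>2 * (h j (B z) * J j z))) = f"
        using f by auto
      finally show "f \<in> M" .
    qed
    have "invariant_under (hinf_of B) M"
      unfolding invariant_under_def
    proof (intro ballI)
      fix b f assume "b \<in> hinf_of B" and f: "f \<in> M"
      then obtain h where h: "h \<in> hinf" "b = (\<lambda>z. if z \<in> ball 0 1 then h (B z) else 0)"
        by (auto simp: hinf_of_def)
      have "(\<lambda>z. h (B z) * f z) \<in> M"
        using N_comp[of h f] h(1) f MN \<open>N \<subseteq> M\<close> by (auto simp: hinf_iff)
      also have "(\<lambda>z. h (B z) * f z) = (\<lambda>z. b z * f z)" using Moff[OF f] h(2) by (auto simp: fun_eq_iff)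
      finally show "(\<lambda>z. b z * f z) \<in> M" .
    qed
    thus False using assms(8) by simp
  qed
  then obtain \<alpha>0 where \<alpha>0: "(\<lambda>z. \<Sum>i<2*r. \<alpha>0 i * e i z) \<notin> M" by blast
  obtain k \<beta> where k: "k + 1 \<le> 2 * r" and \<beta>1: "\<forall>i<k. (\<Sum>j<2*r. (norm (\<beta> j i))\<^sup>2) = 1"
    and \<beta>M: "\<forall>i<k. (\<lambda>z. \<Sum>j<2*r. \<beta> j i * e j z) \<in> M"
    and \<beta>span: "\<forall>\<alpha>. (\<lambda>z. \<Sum>j<2*r. \<alpha> j * e j z) \<in> M \<longrightarrow>
        (\<exists>c. \<forall>z. (\<Sum>j<2*r. \<alpha> j * e j z) = (\<Sum>i<k. c i * (\<Sum>j<2*r. \<beta> j i * e j z)))"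
    and \<beta>indep: "\<forall>c. (\<forall>z. (\<Sum>i<k. c i * (\<Sum>j<2*r. \<beta> j i * e j z)) = 0) \<longrightarrow> (\<forall>i<k. c i = 0)"
    by (rule normalized_basis_of_proper_subspace[OF Msub \<alpha>0])
  have Bphi: "Bphi B J \<beta> r i z = (\<Sum>j<2*r. \<beta> j i * e j z)" for i z
    unfolding Bphi_def comb ..
  have hinf_of_iff: "b \<in> hinf_of B \<longleftrightarrow> (\<exists>h. h \<in> hinf \<and> b = (\<lambda>z. if z \<in> ball 0 1 then h (B z) else 0))" for b
    by (auto simp: hinf_of_def)
  \<comment> \<open>Elements of \<open>hinf_of B\<close> are functions of \<open>z\<close>; each is
    replaced by a function \<open>H j\<close> of the variable \<open>B z\<close>, to which
    \<open>two_term_unique\<close> applies.\<close>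
  have lift: "\<exists>H. (\<forall>j<r. hb (H j)) \<and> (\<forall>j<r. \<forall>z. (B z)\<^sup>2 * J j z * h j z = (B z)\<^sup>2 * (H j (B z) * J j z))"
    if h: "\<forall>j<r. h j \<in> hinf_of B" for h
  proof -
    have "\<forall>j. \<exists>H. j < r \<longrightarrow> H \<in> hinf \<and> h j = (\<lambda>z. if z \<in> ball 0 1 then H (B z) else 0)"
      using h hinf_of_iff by blast
    then obtain H where H: "\<And>j. j < r \<Longrightarrow> H j \<in> hinf" "\<And>j. j < r \<Longrightarrow> h j = (\<lambda>z. if z \<in> ball 0 1 then H j (B z) else 0)"
      by metis
    thus ?thesis using B_off by (intro exI[of _ H]) (auto simp: hinf_iff)
  qed
  have "M = {(\<lambda>z. (\<Sum>i<k. c i * Bphi B J \<beta> r i z) + (\<Sum>j<r. (B z)\<^sup>2 * J j z * h j z)) | c h. \<forall>j<r. h j \<in> hinf_of B}"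
    (is "M = ?R")
  proof (intro equalityI subsetI)
    fix f assume f: "f \<in> M"
    then obtain \<alpha> h where h: "\<forall>j<r. hb (h j)" and fz: "\<forall>z. f z = (\<Sum>i<2*r. \<alpha> i * e i z) + (\<Sum>j<r. (B z)\<^sup>2 * (h j (B z) * J j z))"
      using decomp MN by blast
    have "(\<lambda>z. f z - (\<Sum>j<r. (B z)\<^sup>2 * (h j (B z) * J j z))) \<in> M"
      using h by (intro csubspace_diff[OF Msub f] tail) auto
    hence "(\<lambda>z. \<Sum>i<2*r. \<alpha> i * e i z) \<in> M" using fz by simp
    from \<beta>span[rule_format, OF this] obtain c where c: "\<forall>z. (\<Sum>j<2*r. \<alpha> j * e j z) = (\<Sum>i<k. c i * (\<Sum>j<2*r. \<beta> j i * e j z))" by blast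
    \<comment> \<open>The bounded function \<open>h j\<close> is arbitrary off the disc; both it and
      its composition with \<open>B\<close> are cut off to meet the normalisation in
      \<open>hinf\<close> and \<open>hinf_of\<close>.\<close>
    define H where "H j z = (if z \<in> ball 0 1 then h j (B z) else 0)" for j z
    have "H j \<in> hinf_of B" if j: "j < r" for j
      unfolding hinf_of_iff
    proof (intro exI conjI)
      obtain C where C: "\<And>w. norm w < 1 \<Longrightarrow> norm (h j w) \<le> C" using hb_bound h j by metis
      have "(\<lambda>w. if norm w < 1 then h j w else 0) holomorphic_on ball 0 1"
        by (rule holomorphic_transform[OF hbD[of "h j"]]) (use h j in auto)
      thus "(\<lambda>w. if norm w < 1 then h j w else 0) \<in> hinf"
        unfolding hinf_iff by (auto intro!: hbI[where C = C] C)
      show "H j = (\<lambda>z. if z \<in> ball 0 1 then (\<lambda>w. if norm w < 1 then h j w else 0) (B z) else 0)"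
        using B_lt_1' by (auto simp: H_def fun_eq_iff)
    qed
    moreover have "f = (\<lambda>z. (\<Sum>i<k. c i * Bphi B J \<beta> r i z) + (\<Sum>j<r. (B z)\<^sup>2 * J j z * H j z))"
    proof
      fix z
      have *: "(B z)\<^sup>2 * (h j (B z) * J j z) = (B z)\<^sup>2 * J j z * H j z" for j
        using B_off[of z] by (auto simp: H_def)
      show "f z = (\<Sum>i<k. c i * Bphi B J \<beta> r i z) + (\<Sum>j<r. (B z)\<^sup>2 * J j z * H j z)"
        unfolding fz[rule_format, of z] c[rule_format, of z] Bphi * ..
    qed
    ultimately show "f \<in> ?R" by blast
  next
    fix f assume "f \<in> ?R"
    then obtain c h where h: "\<forall>j<r. h j \<in> hinf_of B"
      and f: "f = (\<lambda>z. (\<Sum>i<k. c i * Bphi B J \<beta> r i z) + (\<Sum>j<r. (B z)\<^sup>2 * J j z * h j z))" by blast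
    obtain H where H: "\<forall>j<r. hb (H j)" "\<forall>j<r. \<forall>z. (B z)\<^sup>2 * J j z * h j z = (B z)\<^sup>2 * (H j (B z) * J j z)"
      using lift[OF h] by blast
    have Hsum: "(\<Sum>j<r. (B z)\<^sup>2 * J j z * h j z) = (\<Sum>j<r. (B z)\<^sup>2 * (H j (B z) * J j z))" for z
      by (intro sum.cong refl H(2)[rule_format]) simp
    have "f = (\<lambda>z. (\<Sum>i<k. c i * (\<Sum>j<2*r. \<beta> j i * e j z)) + (\<Sum>j<r. (B z)\<^sup>2 * (H j (B z) * J j z)))"
      unfolding f Bphi Hsum ..
    also have "\<dots> \<in> M"
    proof (rule csubspace_add[OF Msub])
      show "(\<lambda>z. \<Sum>i<k. c i * (\<Sum>j<2*r. \<beta> j i * e j z)) \<in> M"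
        by (rule csubspace_sum[OF Msub], rule csubspace_scale[OF Msub]) (use \<beta>M in auto)
      show "(\<lambda>z. \<Sum>j<r. (B z)\<^sup>2 * (H j (B z) * J j z)) \<in> M" by (rule tail) (use H(1) in auto)
    qed
    finally show "f \<in> M" .
  qed
  moreover have "(\<forall>i<k. (\<lambda>z. c i * Bphi B J \<beta> r i z) = (\<lambda>z. 0)) \<and> (\<forall>j<r. (\<lambda>z. (B z)\<^sup>2 * J j z * h j z) = (\<lambda>z. 0))"
    if h: "\<forall>j<r. h j \<in> hinf_of B"
      and eq: "(\<lambda>z. (\<Sum>i<k. c i * Bphi B J \<beta> r i z) + (\<Sum>j<r. (B z)\<^sup>2 * J j z * h j z)) = (\<lambda>z. 0)" for c h
  proof -
    obtain H where H: "\<forall>j<r. hb (H j)" "\<forall>j<r. \<forall>z. (B z)\<^sup>2 * J j z * h j z = (B z)\<^sup>2 * (H j (B z) * J j z)"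
      using lift[OF h] by blast
    have Hsum: "(\<Sum>j<r. (B z)\<^sup>2 * J j z * h j z) = (\<Sum>j<r. (B z)\<^sup>2 * (H j (B z) * J j z))" for z
      by (intro sum.cong refl H(2)[rule_format]) simp
    \<comment> \<open>The \<open>Bphi\<close> part is rewritten in the spanning functions
      \<open>e j\<close>. Uniqueness of the two-term expansion kills the \<open>\<alpha> j\<close>,
      so the \<open>Bphi\<close> combination is the zero function, and only then does independence
      give \<open>c i = 0\<close>.\<close>
    define \<alpha> where "\<alpha> j = (\<Sum>i<k. c i * \<beta> j i)" for j
    have \<alpha>: "(\<Sum>i<k. c i * Bphi B J \<beta> r i z) = (\<Sum>j<2*r. \<alpha> j * e j z)" for z
      unfolding Bphi \<alpha>_def sum_distrib_left sum_distrib_right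
      by (subst sum.swap) (simp add: mult.assoc)
    have eq': "(\<Sum>j<r. (\<alpha> (2*j) + \<alpha> (2*j+1) * B z) * J j z) + (\<Sum>j<r. (B z)\<^sup>2 * (H j (B z) * J j z)) = 0" for z
      using fun_cong[OF eq, of z] unfolding \<alpha> comb Hsum .
    have z: "\<alpha> (2*j) = 0" "\<alpha> (2*j+1) = 0" "\<And>w. norm w < 1 \<Longrightarrow> w\<^sup>2 * H j w = 0" if j: "j < r" for j
      using two_term_unique[where p = "\<lambda>j. \<alpha> (2*j)" and q = "\<lambda>j. \<alpha> (2*j+1)" and h = H, OF J _ eq' j] H(1) by auto
    have "(\<Sum>i<k. c i * (\<Sum>j<2*r. \<beta> j i * e j z)) = 0" for z
      using \<alpha>[of z] z unfolding comb Bphi by simp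
    hence c0: "c i = 0" if "i < k" for i using \<beta>indep that by blast
    have "(B z)\<^sup>2 * J j z * h j z = 0" if j: "j < r" for j z
    proof -
      have "(B z)\<^sup>2 * J j z * h j z = ((B z)\<^sup>2 * H j (B z)) * J j z"
        using H(2)[rule_format, OF j, of z] by (simp only: mult.assoc)
      thus ?thesis unfolding z(3)[OF j B_lt_1'[of z]] by simp
    qed
    thus ?thesis using c0 by (auto simp: fun_eq_iff)
  qed
  ultimately show ?thesis
    using rn k \<beta>1 orthonormal_B_inner[OF J]
    by (intro exI[of _ r] exI[of _ k] exI[of _ J] exI[of _ \<beta>] conjI) auto
qed

end
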